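(* Let $A$ be a finite set, $n\ge3$, $1\le r\le n$, and let $\rho\subseteq A^n$ be an essential key relation preserved by a WNU whose pattern is the equivalence relation with classes $\{1,\dots,r\},\{r+1\},\{r+2\},\dots,\{n\}$. Then for every key tuple $(a_1,\dots,a_n)$ of $\rho$ there exist sets $B_1,\dots,B_n\subseteq A$, a prime $p$, bijections $\phi_i:B_i\to\mathbb Z_p$ for $i=1,\dots,r$, and elements $b_{r+1},\dots,b_n\in A$ with $b_i\neq a_i$, such that, writing $\boldsymbol B=B_1\times\dots\times B_n$: $(a_1,\dots,a_n)\in\boldsymbol B$; $B_i=\{a_i,b_i\}$ for $i=r+1,\dots,n$; $$\rho\cap\boldsymbol B=\{(x_1,\dots,x_n)\in\boldsymbol B:\ \phi_1(x_1)+\dots+\phi_r(x_r)=0 \text{ in }\mathbb Z_p,\ \text{or } x_i=b_i\text{ for some } i\in\{r+1,\dots,n\}\};$$ and every tuple $\gamma\in\boldsymbol B\setminus\rho$ is a key tuple for $\rho$.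
   Context: A unary vector-function is a tuple $\Psi=(\psi_1,\dots,\psi_n)$ of maps $\psi_i:A\to A$ acting coordinatewise; it preserves $\rho$ if $\Psi(\rho)\subseteq\rho$. $\rho\subseteq A^n$ is a key relation if there is $\beta\in A^n\setminus\rho$ (a key tuple) such that every $\alpha\in A^n\setminus\rho$ is mapped to $\beta$ by some unary vector-function preserving $\rho$. $\rho$ is essential if it cannot be written as a conjunction of relations of smaller arities. A WNU is an $m$-ary ($m\ge2$) operation $f$ on $A$ with $f(x,\dots,x)=x$ and $f(y,x,\dots,x)=f(x,y,x,\dots,x)=\dots=f(x,\dots,x,y)$; it preserves $\rho$ if applying it coordinatewise to any $m$ tuples of $\rho$ gives a tuple of $\rho$. The pattern of $\rho$: for $i\ne j$, $i\overset{\rho}{\sim}j$ iff there do NOT exist $a_1,\dots,a_n,b_i,b_j\in A$ with $(a_1,\dots,a_n)\notin\rho$ while the tuples obtained by replacing $a_i$ by $b_i$, replacing $a_j$ by $b_j$, and replacing both, all lie in $\rho$; and $i\overset{\rho}{\sim}i$ always. *)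

theory Defs
  imports Main "HOL-Computational_Algebra.Primes"
begin

text \<open>Tuples in A^n are lists of length n over A; coordinates are indexed 0..n-1.\<close>

definition tuples :: "'a set \<Rightarrow> nat \<Rightarrow> 'a list set" where
  "tuples A n = {xs. length xs = n \<and> set xs \<subseteq> A}"

definition unary_vf :: "'a set \<Rightarrow> nat \<Rightarrow> (nat \<Rightarrow> 'a \<Rightarrow> 'a) \<Rightarrow> bool" where
  "unary_vf A n \<Psi> \<longleftrightarrow> (\<forall>i<n. \<forall>x\<in>A. \<Psi> i x \<in> A)"

definition apply_vf :: "nat \<Rightarrow> (nat \<Rightarrow> 'a \<Rightarrow> 'a) \<Rightarrow> 'a list \<Rightarrow> 'a list" where
  "apply_vf n \<Psi> \<alpha> = map (\<lambda>i. \<Psi> i (\<alpha> ! i)) [0..<n]"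

definition vf_preserves :: "nat \<Rightarrow> (nat \<Rightarrow> 'a \<Rightarrow> 'a) \<Rightarrow> 'a list set \<Rightarrow> bool" where
  "vf_preserves n \<Psi> \<rho> \<longleftrightarrow> (\<forall>\<alpha>\<in>\<rho>. apply_vf n \<Psi> \<alpha> \<in> \<rho>)"

definition key_tuple :: "'a set \<Rightarrow> nat \<Rightarrow> 'a list set \<Rightarrow> 'a list \<Rightarrow> bool" where
  "key_tuple A n \<rho> \<beta> \<longleftrightarrow> \<beta> \<in> tuples A n - \<rho> \<and>
     (\<forall>\<alpha>\<in>tuples A n - \<rho>. \<exists>\<Psi>. unary_vf A n \<Psi> \<and> vf_preserves n \<Psi> \<rho> \<and> apply_vf n \<Psi> \<alpha> = \<beta>)"

definition key_relation :: "'a set \<Rightarrow> nat \<Rightarrow> 'a list set \<Rightarrow> bool" where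
  "key_relation A n \<rho> \<longleftrightarrow> \<rho> \<subseteq> tuples A n \<and> (\<exists>\<beta>. key_tuple A n \<rho> \<beta>)"

definition conj_rel :: "'a set \<Rightarrow> nat \<Rightarrow> (nat list \<times> 'a list set) set \<Rightarrow> 'a list set" where
  "conj_rel A n S = {x \<in> tuples A n. \<forall>(I, \<sigma>)\<in>S. map (\<lambda>i. x ! i) I \<in> \<sigma>}"

definition essential :: "'a set \<Rightarrow> nat \<Rightarrow> 'a list set \<Rightarrow> bool" where
  "essential A n \<rho> \<longleftrightarrow> \<not> (\<exists>S. (\<forall>(I, \<sigma>)\<in>S. length I < n \<and> set I \<subseteq> {..<n}
        \<and> \<sigma> \<subseteq> tuples A (length I)) \<and> \<rho> = conj_rel A n S)"

definition is_wnu :: "'a set \<Rightarrow> nat \<Rightarrow> ('a list \<Rightarrow> 'a) \<Rightarrow> bool" where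
  "is_wnu A m f \<longleftrightarrow> m \<ge> 2 \<and> (\<forall>xs\<in>tuples A m. f xs \<in> A)
     \<and> (\<forall>x\<in>A. f (replicate m x) = x)
     \<and> (\<forall>x\<in>A. \<forall>y\<in>A. \<forall>i<m. f ((replicate m x)[i := y]) = f ((replicate m x)[0 := y]))"

definition op_preserves :: "nat \<Rightarrow> nat \<Rightarrow> ('a list \<Rightarrow> 'a) \<Rightarrow> 'a list set \<Rightarrow> bool" where
  "op_preserves m n f \<rho> \<longleftrightarrow> (\<forall>ts. length ts = m \<and> set ts \<subseteq> \<rho> \<longrightarrow>
      map (\<lambda>j. f (map (\<lambda>t. t ! j) ts)) [0..<n] \<in> \<rho>)"

definition pattern :: "'a set \<Rightarrow> nat \<Rightarrow> 'a list set \<Rightarrow> nat \<Rightarrow> nat \<Rightarrow> bool" where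
  "pattern A n \<rho> i j \<longleftrightarrow> i = j \<or>
     \<not> (\<exists>a\<in>tuples A n. \<exists>bi\<in>A. \<exists>bj\<in>A. a \<notin> \<rho> \<and> a[i := bi] \<in> \<rho> \<and> a[j := bj] \<in> \<rho>
          \<and> a[i := bi, j := bj] \<in> \<rho>)"

end

theory Submission
  imports Defs
begin

text \<open>
  Restrict \<open>\<rho>\<close> to the image of a preserving vector function that fixes the key tuple \<open>a\<close> and has the
  smallest possible image. On this core a preserving vector function either permutes every coordinate or
  sends all key tuples into the relation. Substituting tuples of the relation into a special weak
  near-unanimity operation (one with \<open>x \<circ> (x \<circ> y) = x \<circ> y\<close>, where
  \<open>x \<circ> y = f(x,\<dots>,x,y)\<close>) produces such vector functions, and the dichotomy forces
  the operation to behave on each coordinate either like a semilattice whose absorbing element repairs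
  \<open>a\<close>, or like an affine operation with \<open>a\<^sub>i \<circ> x = x\<close>.

  Semilattice coordinates give the elements \<open>b\<^sub>i\<close>; at most one coordinate outside the class
  \<open>{1,\<dots>,r}\<close> can fail to be of this kind, and for it \<open>b\<^sub>i\<close> is forced.
  For \<open>r \<le> 2\<close> two-element sets and \<open>p = 2\<close> suffice. For
  \<open>r \<ge> 3\<close> rectangularity excludes near-unanimity behaviour in the class, so it is affine: with
  a tuple of the relation as origin, the multiples of \<open>a\<^sub>1\<close> form a cyclic group whose order
  \<open>p\<close> is prime, because multiplication by \<open>k\<close> preserves the relation and hence is
  injective as soon as it does not annihilate \<open>a\<^sub>1\<close>.
\<close>

section \<open>Relations on functional tuples\<close>

text \<open>Passing to a core makes the relation rigid: if replacing \<open>c\<close> by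
  \<open>d\<close> at one coordinate respects the relation and moves no entry of some key tuple,
  then \<open>c = d\<close>. The uniqueness claims (one repairing element at an affine coordinate,
  one value completing a tuple in the class) come from building such a replacement out of the
  operation.

  The obstacle is that one operation acts on all coordinates at once and may be of a different kind
  on each. A term that is good at one coordinate can destroy what was achieved at another, so binary
  terms are combined in a way that loses no coordinate, and one with the largest number of good
  coordinates is taken.

  A class of three leaves room to rearrange arguments by rectangularity and to compare two summands
  with their sum. For smaller classes the sum only counts replaced entries of \<open>a\<close>, and
  no group has to be constructed.

  In the cyclic group \<open>a\<close> has entry one at the first coordinate and zero on the rest of
  the class, so the equation found is "first entry equals the sum of the others"; negating the first
  entry gives the stated form.\<close>

lemma funpow_fact_idem:
  assumes "finite A" "card A \<le> M" "\<And>z. z \<in> A \<Longrightarrow> f z \<in> A" "x \<in> A"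
  shows "(f ^^ fact M) ((f ^^ fact M) x) = (f ^^ fact M) x"
proof -
  have in_A: "(f ^^ k) x \<in> A" for k by (induction k) (use assms in auto)
  have "\<not> inj_on (\<lambda>k. (f ^^ k) x) {..card A}"
  proof
    assume "inj_on (\<lambda>k. (f ^^ k) x) {..card A}"
    then have "card {..card A} \<le> card A"
      using in_A assms(1) by (intro card_inj_on_le) auto
    then show False by simp
  qed
  then obtain i j where ij: "i < j" "j \<le> card A" "(f ^^ i) x = (f ^^ j) x"
    unfolding inj_on_def by (metis atMost_iff linorder_neqE_nat)
  define q where "q = j - i"
  have per: "(f ^^ (k + q)) x = (f ^^ k) x" if "i \<le> k" for k
  proof -
    have "(f ^^ (k + q)) x = (f ^^ ((k - i) + j)) x" using that ij by (simp add: q_def)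
    also have "\<dots> = (f ^^ ((k - i) + i)) x" using ij by (simp add: funpow_add)
    finally show ?thesis using that by simp
  qed
  have pers: "(f ^^ (k + s * q)) x = (f ^^ k) x" if "i \<le> k" for k s
  proof (induction s)
    case (Suc s)
    have "(f ^^ (k + Suc s * q)) x = (f ^^ ((k + s * q) + q)) x" by (simp add: algebra_simps)
    also have "\<dots> = (f ^^ (k + s * q)) x" using that by (intro per) simp
    finally show ?case using Suc by simp
  qed simp
  \<comment> \<open>The period \<open>q\<close> and the preperiod \<open>i\<close> are at most
    \<open>card A \<le> M\<close>, so \<open>fact M\<close> is a multiple of the one and at least
    the other.\<close>
  have "q dvd fact M" using ij assms(2) by (intro dvd_fact) (auto simp: q_def)
  then obtain s where s: "fact M = s * q" by (metis dvd_def mult.commute)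
  have "i \<le> fact M" using ij assms(2) fact_ge_self[of M] by linarith
  then have "(f ^^ (fact M + s * q)) x = (f ^^ fact M) x" by (rule pers)
  then show ?thesis by (simp add: s[symmetric] funpow_add)
qed

text \<open>Tuples are functions, so that changing an entry is function update;
  \<open>R_cong\<close> makes the values beyond \<open>n\<close> irrelevant. The domain depends on
  the coordinate because the images of a retraction do.\<close>

locale tuple_relation =
  fixes n :: nat and A :: "nat \<Rightarrow> 'a set" and R :: "(nat \<Rightarrow> 'a) set"
  assumes finite_A: "i < n \<Longrightarrow> finite (A i)"
    and R_in: "x \<in> R \<Longrightarrow> i < n \<Longrightarrow> x i \<in> A i"
    and R_cong: "x \<in> R \<Longrightarrow> (\<And>i. i < n \<Longrightarrow> x i = y i) \<Longrightarrow> y \<in> R"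
begin

definition T :: "(nat \<Rightarrow> 'a) set" where
  "T = {x. \<forall>i<n. x i \<in> A i}"

definition vf :: "(nat \<Rightarrow> 'a \<Rightarrow> 'a) \<Rightarrow> bool" where
  "vf \<Psi> \<longleftrightarrow> (\<forall>i<n. \<forall>x\<in>A i. \<Psi> i x \<in> A i) \<and> (\<forall>x\<in>R. (\<lambda>i. \<Psi> i (x i)) \<in> R)"

definition key :: "(nat \<Rightarrow> 'a) \<Rightarrow> bool" where
  "key a \<longleftrightarrow> a \<in> T \<and> a \<notin> R \<and>
     (\<forall>x\<in>T. x \<notin> R \<longrightarrow> (\<exists>\<Psi>. vf \<Psi> \<and> (\<forall>i<n. \<Psi> i (x i) = a i)))"

text \<open>The witness that \<open>i\<close> and \<open>j\<close> are not related by the pattern,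
  with \<open>x\<close> as the corner missing from the relation.\<close>

definition square :: "nat \<Rightarrow> nat \<Rightarrow> (nat \<Rightarrow> 'a) \<Rightarrow> 'a \<Rightarrow> 'a \<Rightarrow> bool" where
  "square i j x c d \<longleftrightarrow> x \<in> T \<and> x \<notin> R \<and> x(i := c) \<in> R \<and> x(j := d) \<in> R \<and> x(i := c, j := d) \<in> R"

definition C :: "(nat \<Rightarrow> 'a) \<Rightarrow> nat \<Rightarrow> 'a set" where
  "C a i = {c. a(i := c) \<in> R}"

definition pol2 :: "(nat \<Rightarrow> 'a \<Rightarrow> 'a \<Rightarrow> 'a) \<Rightarrow> bool" where
  "pol2 u \<longleftrightarrow> (\<forall>i<n. \<forall>x\<in>A i. \<forall>y\<in>A i. u i x y \<in> A i) \<and> (\<forall>i<n. \<forall>x\<in>A i. u i x x = x) \<and>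
     (\<forall>s\<in>R. \<forall>t\<in>R. (\<lambda>i. u i (s i) (t i)) \<in> R)"

text \<open>One exponent serves all coordinates: the factorial of a common bound on the domain sizes
  makes the \<open>N\<close>-th iterate of any self-map of any \<open>A i\<close>
  idempotent.\<close>

definition N :: nat where "N = fact (\<Sum>i<n. card (A i))"

lemma N_pos: "0 < N" by (simp add: N_def)

lemma funpow_N_idem:
  assumes "i < n" "\<And>z. z \<in> A i \<Longrightarrow> f z \<in> A i" "x \<in> A i"
  shows "(f ^^ N) ((f ^^ N) x) = (f ^^ N) x"
  unfolding N_def
proof (rule funpow_fact_idem)
  show "card (A i) \<le> (\<Sum>i<n. card (A i))" using assms(1) by (intro member_le_sum) auto
qed (use assms finite_A in auto)

lemma R_cong_iff: "(\<And>i. i < n \<Longrightarrow> x i = y i) \<Longrightarrow> x \<in> R \<longleftrightarrow> y \<in> R"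
  by (metis R_cong)

lemma T_upd: "x \<in> T \<Longrightarrow> c \<in> A i \<Longrightarrow> x(i := c) \<in> T" by (auto simp: T_def)

lemma T_in: "x \<in> T \<Longrightarrow> i < n \<Longrightarrow> x i \<in> A i" by (auto simp: T_def)

lemma C_in_A: "c \<in> C a i \<Longrightarrow> i < n \<Longrightarrow> c \<in> A i"
  using R_in[of "a(i := c)" i] by (auto simp: C_def)

lemma vf_in: "vf \<Psi> \<Longrightarrow> i < n \<Longrightarrow> x \<in> A i \<Longrightarrow> \<Psi> i x \<in> A i" by (auto simp: vf_def)

lemma vf_R: "vf \<Psi> \<Longrightarrow> x \<in> R \<Longrightarrow> (\<lambda>i. \<Psi> i (x i)) \<in> R" by (auto simp: vf_def)

lemma vf_T: "vf \<Psi> \<Longrightarrow> x \<in> T \<Longrightarrow> (\<lambda>i. \<Psi> i (x i)) \<in> T" by (auto simp: vf_def T_def)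

lemma vf_comp: "vf \<Phi> \<Longrightarrow> vf \<Psi> \<Longrightarrow> vf (\<lambda>i x. \<Phi> i (\<Psi> i x))"
  by (auto simp: vf_def)

lemma vf_pow: "vf \<Psi> \<Longrightarrow> vf (\<lambda>i. \<Psi> i ^^ k)"
proof (induction k)
  case (Suc k)
  from vf_comp[OF Suc.prems Suc.IH[OF Suc.prems]] show ?case by (simp add: comp_def)
qed (simp add: vf_def)

text \<open>An injective idempotent map is the identity, so the \<open>N\<close>-th iterate is the
  identity and iterate \<open>N - 1\<close> is an inverse; being an iterate, it preserves the
  relation.\<close>

lemma vf_inverse:
  assumes "vf \<Psi>" "\<And>i. i < n \<Longrightarrow> inj_on (\<Psi> i) (A i)"
  obtains \<Phi> where "vf \<Phi>" "\<And>i x. i < n \<Longrightarrow> x \<in> A i \<Longrightarrow> \<Phi> i (\<Psi> i x) = x"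
    "\<And>i x. i < n \<Longrightarrow> x \<in> A i \<Longrightarrow> \<Psi> i (\<Phi> i x) = x"
proof -
  have in_A: "(\<Psi> i ^^ k) x \<in> A i" if "i < n" "x \<in> A i" for i x k
    using vf_in[OF vf_pow[OF assms(1)] that] .
  have inj: "inj_on (\<Psi> i ^^ k) (A i)" if "i < n" for i k
  proof (induction k)
    case (Suc k)
    then show ?case using assms(2)[OF that] in_A[OF that]
      by (simp add: inj_on_def)
  qed simp
  have id: "(\<Psi> i ^^ N) x = x" if "i < n" "x \<in> A i" for i x
  proof (rule inj_onD[OF inj[OF that(1), of N]])
    show "(\<Psi> i ^^ N) ((\<Psi> i ^^ N) x) = (\<Psi> i ^^ N) x"
      using that vf_in[OF assms(1)] by (intro funpow_N_idem) auto
  qed (use in_A that in auto)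
  obtain N' where N: "N = Suc N'" using N_pos gr0_conv_Suc by auto
  define \<Phi> where "\<Phi> = (\<lambda>i. \<Psi> i ^^ N')"
  show ?thesis
  proof (rule that[of \<Phi>])
    show "vf \<Phi>" unfolding \<Phi>_def by (rule vf_pow[OF assms(1)])
    fix i x assume "i < n" "x \<in> A i"
    note * = id[OF this, unfolded N]
    show "\<Phi> i (\<Psi> i x) = x" using * by (simp only: \<Phi>_def funpow_Suc_right o_apply)
    show "\<Psi> i (\<Phi> i x) = x" using * by (simp only: \<Phi>_def funpow.simps o_apply)
  qed
qed

lemma pol2_in: "pol2 u \<Longrightarrow> i < n \<Longrightarrow> x \<in> A i \<Longrightarrow> y \<in> A i \<Longrightarrow> u i x y \<in> A i"
  by (auto simp: pol2_def)

lemma pol2_idem: "pol2 u \<Longrightarrow> i < n \<Longrightarrow> x \<in> A i \<Longrightarrow> u i x x = x"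
  by (auto simp: pol2_def)

lemma pol2_R: "pol2 u \<Longrightarrow> s \<in> R \<Longrightarrow> t \<in> R \<Longrightarrow> (\<lambda>i. u i (s i) (t i)) \<in> R"
  by (auto simp: pol2_def)

lemma pol2_swap: "pol2 u \<Longrightarrow> pol2 (\<lambda>i x y. u i y x)"
  by (auto simp: pol2_def)

lemma pol2_proj1: "pol2 (\<lambda>i x y. x)" by (auto simp: pol2_def)

lemma pol2_proj2: "pol2 (\<lambda>i x y. y)" by (auto simp: pol2_def)

lemma pol2_comp:
  "pol2 u \<Longrightarrow> pol2 v \<Longrightarrow> pol2 w \<Longrightarrow> pol2 (\<lambda>i x y. u i (v i x y) (w i x y))"
  by (simp add: pol2_def)

lemma pol2_iterate: "pol2 u \<Longrightarrow> pol2 (\<lambda>i x y. ((\<lambda>z. u i x z) ^^ k) y)"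
proof (induction k)
  case 0
  then show ?case by (simp add: pol2_proj2)
next
  case (Suc k)
  from pol2_comp[OF Suc.prems pol2_proj1 Suc.IH[OF Suc.prems]] show ?case by simp
qed

lemma pol2_iterate': "pol2 u \<Longrightarrow> pol2 (\<lambda>i x y. ((\<lambda>z. u i z x) ^^ k) y)"
  using pol2_iterate[OF pol2_swap] .

lemma vf_pol2_left: "pol2 u \<Longrightarrow> t \<in> R \<Longrightarrow> vf (\<lambda>i x. u i x (t i))"
  by (auto simp: pol2_def vf_def R_in)

lemma vf_pol2_right: "pol2 u \<Longrightarrow> t \<in> R \<Longrightarrow> vf (\<lambda>i x. u i (t i) x)"
  by (auto simp: pol2_def vf_def R_in)

lemma C_pol2: "pol2 u \<Longrightarrow> a \<in> T \<Longrightarrow> c \<in> C a i \<Longrightarrow> d \<in> C a i \<Longrightarrow> u i c d \<in> C a i"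
  unfolding C_def mem_Collect_eq
  by (rule R_cong, rule pol2_R, assumption+) (simp add: pol2_idem T_in)

end

text \<open>The operation may differ from coordinate to coordinate, as it does after composition
  with a retraction. Its argument is a function of the position, of which \<open>F_cong\<close> lets
  only the first \<open>m\<close> values count.\<close>

locale wnu_relation = tuple_relation +
  fixes m :: nat and F :: "nat \<Rightarrow> (nat \<Rightarrow> 'a) \<Rightarrow> 'a"
  assumes m_ge: "2 \<le> m"
    and F_cong: "i < n \<Longrightarrow> (\<And>k. k < m \<Longrightarrow> g k = g' k) \<Longrightarrow> F i g = F i g'"
    and F_in: "i < n \<Longrightarrow> (\<And>k. k < m \<Longrightarrow> g k \<in> A i) \<Longrightarrow> F i g \<in> A i"
    and F_idem: "i < n \<Longrightarrow> x \<in> A i \<Longrightarrow> F i (\<lambda>_. x) = x"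
    and F_wnu: "i < n \<Longrightarrow> x \<in> A i \<Longrightarrow> y \<in> A i \<Longrightarrow> k < m \<Longrightarrow>
      F i ((\<lambda>_. x)(k := y)) = F i ((\<lambda>_. x)(0 := y))"
    and F_R: "(\<And>k. k < m \<Longrightarrow> t k \<in> R) \<Longrightarrow> (\<lambda>i. F i (\<lambda>k. t k i)) \<in> R"

section \<open>Core relations\<close>

locale core_relation = tuple_relation +
  assumes core: "key a \<Longrightarrow> vf \<Psi> \<Longrightarrow> (\<And>i. i < n \<Longrightarrow> \<Psi> i (a i) = a i) \<Longrightarrow> i < n \<Longrightarrow> inj_on (\<Psi> i) (A i)"
    and essential_tuple: "\<exists>x\<in>T. x \<notin> R \<and> (\<forall>i<n. \<exists>c. x(i := c) \<in> R)"
begin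

lemma key_T: "key a \<Longrightarrow> a \<in> T" by (simp add: key_def)

lemma key_in: "key a \<Longrightarrow> i < n \<Longrightarrow> a i \<in> A i" by (simp add: key_def T_def)

lemma key_notR: "key a \<Longrightarrow> a \<notin> R" by (simp add: key_def)

lemma key_reach:
  assumes "key a" "x \<in> T" "x \<notin> R"
  obtains \<Psi> where "vf \<Psi>" "\<And>i. i < n \<Longrightarrow> \<Psi> i (x i) = a i"
  using assms by (auto simp: key_def)

lemma key_image:
  assumes "key a" "vf \<Psi>" "(\<lambda>i. \<Psi> i (a i)) \<notin> R"
  shows "key (\<lambda>i. \<Psi> i (a i))"
  unfolding key_def
proof (intro conjI ballI impI)
  show "(\<lambda>i. \<Psi> i (a i)) \<in> T" using assms key_T vf_T by blast
  fix x assume "x \<in> T" "x \<notin> R"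
  then obtain \<Phi> where \<Phi>: "vf \<Phi>" "\<And>i. i < n \<Longrightarrow> \<Phi> i (x i) = a i"
    using assms(1) key_reach by blast
  then show "\<exists>\<Psi>'. vf \<Psi>' \<and> (\<forall>i<n. \<Psi>' i (x i) = \<Psi> i (a i))"
    using vf_comp[OF assms(2) \<Phi>(1)] by (intro exI[of _ "\<lambda>i x. \<Psi> i (\<Phi> i x)"]) auto
qed (use assms in auto)

lemma key_cong:
  assumes "key x" "\<And>i. i < n \<Longrightarrow> x i = y i"
  shows "key y"
proof -
  have "y \<notin> R" using assms R_cong_iff[of x y] key_notR by blast
  moreover have "y \<in> T" using key_T[OF assms(1)] assms(2) by (auto simp: T_def)
  ultimately show ?thesis using assms by (simp add: key_def)
qed

text \<open>A vector function that keeps one key tuple outside the relation is a permutation of every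
  coordinate; all others send every key tuple into the relation.\<close>

lemma key_image_inj:
  assumes "key a" "vf \<Psi>" "(\<lambda>i. \<Psi> i (a i)) \<notin> R" "i < n"
  shows "inj_on (\<Psi> i) (A i)"
proof -
  have "(\<lambda>i. \<Psi> i (a i)) \<in> T" using assms key_T vf_T by blast
  then obtain \<Phi> where \<Phi>: "vf \<Phi>" "\<And>i. i < n \<Longrightarrow> \<Phi> i (\<Psi> i (a i)) = a i"
    by (rule key_reach[OF assms(1) _ assms(3)]) (rule that)
  have inj: "inj_on (\<lambda>x. \<Phi> i (\<Psi> i x)) (A i)"
    by (rule core[OF assms(1) vf_comp[OF \<Phi>(1) assms(2)] \<Phi>(2) assms(4)])
  show ?thesis
  proof (rule inj_onI)
    fix x y assume "x \<in> A i" "y \<in> A i" "\<Psi> i x = \<Psi> i y"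
    then show "x = y" using inj_onD[OF inj, of x y] by simp
  qed
qed

lemma notR_image:
  assumes "vf \<Psi>" "\<And>i. i < n \<Longrightarrow> inj_on (\<Psi> i) (A i)" "x \<in> T" "x \<notin> R"
  shows "(\<lambda>i. \<Psi> i (x i)) \<notin> R"
proof
  obtain \<Phi> where \<Phi>: "vf \<Phi>" "\<And>i x. i < n \<Longrightarrow> x \<in> A i \<Longrightarrow> \<Phi> i (\<Psi> i x) = x"
    by (rule vf_inverse[OF assms(1,2)], assumption, rule that)
  assume "(\<lambda>i. \<Psi> i (x i)) \<in> R"
  then have "(\<lambda>i. \<Phi> i (\<Psi> i (x i))) \<in> R" by (rule vf_R[OF \<Phi>(1)])
  then have "x \<in> R" by (rule R_cong) (use assms(3) \<Phi>(2) T_in in auto)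
  then show False using assms(4) by blast
qed

lemma key_absorb:
  assumes "key a" "vf \<Psi>" "(\<lambda>i. \<Psi> i (a i)) \<in> R" "key x"
  shows "(\<lambda>i. \<Psi> i (x i)) \<in> R"
  using notR_image[OF assms(2) key_image_inj[OF assms(4,2)] key_T[OF assms(1)] key_notR[OF assms(1)]]
    assms(3) by blast

text \<open>A function that takes the essential tuple to \<open>a\<close> takes its repairs to
  repairs of \<open>a\<close>.\<close>

lemma C_nonempty:
  assumes "key a" "i < n"
  obtains c where "c \<in> C a i"
proof -
  obtain x where x: "x \<in> T" "x \<notin> R" "\<exists>c. x(i := c) \<in> R"
    using essential_tuple assms(2) by blast
  then obtain c where c: "x(i := c) \<in> R" by blast
  obtain \<Psi> where \<Psi>: "vf \<Psi>" "\<And>i. i < n \<Longrightarrow> \<Psi> i (x i) = a i" using key_reach[OF assms(1) x(1,2)] by blast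
  have "a(i := \<Psi> i c) \<in> R" by (rule R_cong[OF vf_R[OF \<Psi>(1) c]]) (use \<Psi>(2) in auto)
  then show ?thesis using that by (auto simp: C_def)
qed

lemma CD: "c \<in> C a i \<Longrightarrow> a(i := c) \<in> R"
  by (simp add: C_def)

lemma C_neq: "key a \<Longrightarrow> a i \<notin> C a i"
  by (auto simp: C_def key_notR)

text \<open>A preserving function that takes the missing corner to \<open>a\<close> carries the
  other three corners along, so the pattern can be tested at \<open>a\<close> alone.\<close>

lemma square_at_key:
  assumes "key a" "square i j x c d" "i \<noteq> j"
  shows "\<exists>c d. square i j a c d"
proof -
  have x: "x \<in> T" "x \<notin> R" and R: "x(i := c) \<in> R" "x(j := d) \<in> R" "x(i := c, j := d) \<in> R"
    using assms(2) by (auto simp: square_def)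
  obtain \<Psi> where \<Psi>: "vf \<Psi>" "\<And>i. i < n \<Longrightarrow> \<Psi> i (x i) = a i" using key_reach[OF assms(1) x] by blast
  have "a(i := \<Psi> i c) \<in> R" by (rule R_cong[OF vf_R[OF \<Psi>(1) R(1)]]) (use \<Psi>(2) in auto)
  moreover have "a(j := \<Psi> j d) \<in> R" by (rule R_cong[OF vf_R[OF \<Psi>(1) R(2)]]) (use \<Psi>(2) in auto)
  moreover have "a(i := \<Psi> i c, j := \<Psi> j d) \<in> R"
    by (rule R_cong[OF vf_R[OF \<Psi>(1) R(3)]]) (use \<Psi>(2) assms(3) in auto)
  ultimately show ?thesis using assms(1) by (auto simp: square_def key_T key_notR)
qed

text \<open>The map that sends \<open>c\<close> to \<open>d\<close> at coordinate \<open>i\<close>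
  and fixes all else preserves the relation by \<open>imp\<close>, and it fixes \<open>a\<close>
  because \<open>a i \<noteq> c\<close>. On a core it is injective.\<close>

lemma collapse:
  assumes "key a" "i < n" "d \<in> A i" "c \<in> A i" "a i \<noteq> c"
    and imp: "\<And>v. v(i := c) \<in> R \<Longrightarrow> v(i := d) \<in> R"
  shows "c = d"
proof -
  define \<Psi> where "\<Psi> = (\<lambda>j x. if j = i \<and> x = c then d else x)"
  have "vf \<Psi>" unfolding vf_def
  proof (intro conjI ballI)
    fix x assume x: "x \<in> R"
    show "(\<lambda>j. \<Psi> j (x j)) \<in> R"
    proof (cases "x i = c")
      case True
      then have "x(i := c) \<in> R" using x by (metis fun_upd_triv)
      from imp[OF this] show ?thesis by (rule R_cong) (use True in \<open>auto simp: \<Psi>_def\<close>)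
    next
      case False
      show ?thesis by (rule R_cong[OF x]) (use False in \<open>auto simp: \<Psi>_def\<close>)
    qed
  qed (use assms in \<open>auto simp: \<Psi>_def\<close>)
  then have "inj_on (\<Psi> i) (A i)" using assms by (intro core) (auto simp: \<Psi>_def)
  then show ?thesis using assms(3,4) by (auto simp: inj_on_def \<Psi>_def split: if_splits)
qed

lemma pol2_upd:
  assumes "pol2 u" "a \<in> T"
  shows "(\<lambda>j. u j ((a(i := x)) j) ((a(i := y)) j)) \<in> R \<longleftrightarrow> u i x y \<in> C a i"
  unfolding C_def mem_Collect_eq
  by (rule R_cong_iff) (use assms in \<open>auto simp: pol2_idem T_in\<close>)

lemma pol2_upd1:
  assumes "pol2 u" "a \<in> T"
  shows "(\<lambda>j. u j (a j) ((a(i := y)) j)) \<in> R \<longleftrightarrow> u i (a i) y \<in> C a i"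
  using pol2_upd[OF assms, of i "a i" y] by simp

lemma pol2_upd2:
  assumes "pol2 u" "a \<in> T"
  shows "(\<lambda>j. u j ((a(i := x)) j) (a j)) \<in> R \<longleftrightarrow> u i x (a i) \<in> C a i"
  using pol2_upd[OF assms, of i x "a i"] by simp

text \<open>Substituting \<open>a(i := c)\<close> into the second argument gives a preserving
  function that leaves \<open>a\<close> outside the relation, hence permutes every
  coordinate.\<close>

lemma pol2_inj:
  assumes "pol2 u" "key a" "i < n" "c \<in> C a i" "u i (a i) c \<notin> C a i"
  shows "inj_on (\<lambda>x. u i x c) (A i)" "\<And>j. j < n \<Longrightarrow> j \<noteq> i \<Longrightarrow> inj_on (\<lambda>x. u j x (a j)) (A j)"
proof -
  define \<Psi> where "\<Psi> = (\<lambda>j x. u j x ((a(i := c)) j))"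
  have "vf \<Psi>" unfolding \<Psi>_def by (rule vf_pol2_left[OF assms(1) CD[OF assms(4)]])
  moreover have "(\<lambda>j. \<Psi> j (a j)) \<notin> R"
    unfolding \<Psi>_def pol2_upd1[OF assms(1) key_T[OF assms(2)]] by (rule assms(5))
  ultimately have inj: "inj_on (\<Psi> j) (A j)" if "j < n" for j
    using key_image_inj[OF assms(2)] that by blast
  show "inj_on (\<lambda>x. u i x c) (A i)" using inj[OF assms(3)] by (simp add: \<Psi>_def)
  show "inj_on (\<lambda>x. u j x (a j)) (A j)" if "j < n" "j \<noteq> i" for j
    using inj[OF that(1)] that by (simp add: \<Psi>_def)
qed

section \<open>Binary terms that absorb at a coordinate\<close>

definition near :: "(nat \<Rightarrow> 'a) \<Rightarrow> nat \<Rightarrow> 'a \<Rightarrow> bool" where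
  "near a j s \<longleftrightarrow> s \<in> C a j \<or> key (a(j := s))"

text \<open>Whatever a term makes of \<open>a j\<close> and a repairing element either repairs
  \<open>a\<close> or yields another key tuple. These are the entries that
  \<open>pol2_absorb\<close> can handle.\<close>

lemma near_pol2:
  assumes "pol2 v" "key a" "c \<in> C a j"
  shows "near a j (v j (a j) c)"
proof (cases "v j (a j) c \<in> C a j")
  case False
  have "vf (\<lambda>l x. v l x ((a(j := c)) l))" by (rule vf_pol2_left[OF assms(1) CD[OF assms(3)]])
  from key_image[OF assms(2) this] False
  have "key (\<lambda>l. v l (a l) ((a(j := c)) l))"
    using pol2_upd1[OF assms(1) key_T[OF assms(2)]] by blast
  then have "key (a(j := v j (a j) c))"
    by (rule key_cong) (use assms in \<open>auto simp: pol2_idem key_in\<close>)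
  then show ?thesis by (simp add: near_def)
qed (simp add: near_def)

text \<open>Substituting \<open>a(j := c)\<close> sends \<open>a\<close> into the relation, hence
  sends every key tuple there, \<open>a(j := s)\<close> included.\<close>

lemma pol2_absorb:
  assumes "pol2 u" "key a" "c \<in> C a j" "u j (a j) c \<in> C a j" "near a j s"
  shows "u j s c \<in> C a j"
proof (cases "s \<in> C a j")
  case True
  then show ?thesis using C_pol2[OF assms(1) key_T[OF assms(2)] _ assms(3)] by blast
next
  case False
  then have key: "key (a(j := s))" using assms by (simp add: near_def)
  have "vf (\<lambda>l x. u l x ((a(j := c)) l))" by (rule vf_pol2_left[OF assms(1) CD[OF assms(3)]])
  from key_absorb[OF assms(2) this _ key] show ?thesis
    using pol2_upd1[OF assms(1) key_T[OF assms(2)]] pol2_upd[OF assms(1) key_T[OF assms(2)]] assms(4)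
    by blast
qed

text \<open>The semilattice kind of coordinate in a weak form; equations are obtained from it by
  iteration in \<open>semilattice_term\<close>.\<close>

definition two_sided :: "(nat \<Rightarrow> 'a \<Rightarrow> 'a \<Rightarrow> 'a) \<Rightarrow> (nat \<Rightarrow> 'a) \<Rightarrow> nat \<Rightarrow> bool" where
  "two_sided u a j \<longleftrightarrow> (\<forall>c\<in>C a j. u j (a j) c \<in> C a j \<and> u j c (a j) \<in> C a j)"

text \<open>The term \<open>u (u x y) (v x y)\<close> works. Where \<open>u\<close> is two-sided,
  its first argument is already repairing and \<open>u\<close> absorbs on that side; at
  \<open>i\<close> its second argument is repairing thanks to \<open>v\<close>, and \<open>u\<close>
  absorbs on the other side by \<open>right\<close>.\<close>

lemma two_sided_improve:
  assumes u: "pol2 u" and v: "pol2 v" and a: "key a" and i: "two_sided v a i"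
    and right: "\<And>c. c \<in> C a i \<Longrightarrow> u i (a i) c \<in> C a i"
  obtains w where "pol2 w" "two_sided w a i" "\<And>j. two_sided u a j \<Longrightarrow> two_sided w a j"
proof
  let ?w = "\<lambda>i x y. u i (u i x y) (v i x y)"
  show "pol2 ?w" using pol2_comp[OF u u v] .
  have near: "near a j (w j (a j) c)" "near a j (w j c (a j))" if "pol2 w" "c \<in> C a j" for w c j
    using near_pol2[OF that(1) a that(2)] near_pol2[OF pol2_swap[OF that(1)] a that(2)] by auto
  show "two_sided ?w a i"
    unfolding two_sided_def
  proof (intro ballI conjI)
    fix c assume c: "c \<in> C a i"
    have vC: "v i (a i) c \<in> C a i" "v i c (a i) \<in> C a i" using i c by (auto simp: two_sided_def)
    show "u i (u i (a i) c) (v i (a i) c) \<in> C a i"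
      by (rule pol2_absorb[OF u a vC(1) right[OF vC(1)] near(1)[OF u c]])
    show "u i (u i c (a i)) (v i c (a i)) \<in> C a i"
      by (rule pol2_absorb[OF u a vC(2) right[OF vC(2)] near(2)[OF u c]])
  qed
  fix j assume j: "two_sided u a j"
  show "two_sided ?w a j"
    unfolding two_sided_def
  proof (intro ballI conjI)
    fix c assume c: "c \<in> C a j"
    have uC: "u j (a j) c \<in> C a j" "u j c (a j) \<in> C a j" using j c by (auto simp: two_sided_def)
    have left: "u j d (a j) \<in> C a j" if "d \<in> C a j" for d using j that by (auto simp: two_sided_def)
    show "u j (u j (a j) c) (v j (a j) c) \<in> C a j"
      by (rule pol2_absorb[OF pol2_swap[OF u] a uC(1) left[OF uC(1)] near(1)[OF v c]])
    show "u j (u j c (a j)) (v j c (a j)) \<in> C a j"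
      by (rule pol2_absorb[OF pol2_swap[OF u] a uC(2) left[OF uC(2)] near(2)[OF v c]])
  qed
qed

lemma C_vf:
  assumes "vf \<Psi>" "c \<in> C a i" "\<And>j. j < n \<Longrightarrow> j \<noteq> i \<Longrightarrow> \<Psi> j (a j) = a j"
  shows "\<Psi> i c \<in> C a i"
  unfolding C_def mem_Collect_eq
  by (rule R_cong[OF vf_R[OF assms(1) CD[OF assms(2)]]]) (use assms(3) in auto)

text \<open>Both substitutions are permutations, so for \<open>d\<close> in \<open>C a i\<close>
  there is \<open>e\<close> in \<open>C a i\<close> with \<open>u e c = u c' d\<close>. Applying
  \<open>u\<close> to \<open>a(i := e)\<close> and a tuple with entry \<open>c\<close>, and then
  undoing the substitution of \<open>a(i := c')\<close>, changes only that entry, to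
  \<open>d\<close>; \<open>collapse\<close> applies.\<close>

lemma both_sides_bad:
  assumes u: "pol2 u" and a: "key a" and i: "i < n" and c: "c \<in> C a i" "c' \<in> C a i"
    and bad: "u i (a i) c \<notin> C a i" "u i c' (a i) \<notin> C a i"
  shows "C a i = {c}"
proof -
  note aT = key_T[OF a]
  define \<Psi> where "\<Psi> = (\<lambda>j x. u j x ((a(i := c)) j))"
  define \<Psi>' where "\<Psi>' = (\<lambda>j x. u j ((a(i := c')) j) x)"
  have \<Psi>: "vf \<Psi>" unfolding \<Psi>_def by (rule vf_pol2_left[OF u CD[OF c(1)]])
  have \<Psi>': "vf \<Psi>'" unfolding \<Psi>'_def by (rule vf_pol2_right[OF u CD[OF c(2)]])
  have inj: "inj_on (\<Psi> j) (A j)" if "j < n" for j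
    using key_image_inj[OF a \<Psi> _ that] pol2_upd1[OF u aT] bad(1) by (auto simp: \<Psi>_def)
  have inj': "inj_on (\<Psi>' j) (A j)" if "j < n" for j
    using key_image_inj[OF a \<Psi>' _ that] pol2_upd2[OF u aT] bad(2) by (auto simp: \<Psi>'_def)
  obtain \<Phi> where \<Phi>: "vf \<Phi>" "\<And>j x. j < n \<Longrightarrow> x \<in> A j \<Longrightarrow> \<Phi> j (\<Psi> j x) = x"
    "\<And>j x. j < n \<Longrightarrow> x \<in> A j \<Longrightarrow> \<Psi> j (\<Phi> j x) = x"
    by (rule vf_inverse[OF \<Psi> inj], assumption, rule that)
  obtain \<Phi>' where \<Phi>': "vf \<Phi>'" "\<And>j x. j < n \<Longrightarrow> x \<in> A j \<Longrightarrow> \<Phi>' j (\<Psi>' j x) = x"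
    "\<And>j x. j < n \<Longrightarrow> x \<in> A j \<Longrightarrow> \<Psi>' j (\<Phi>' j x) = x"
    by (rule vf_inverse[OF \<Psi>' inj'], assumption, rule that)
  have fix_a: "\<Psi> j (a j) = a j" "\<Psi>' j (a j) = a j" "\<Phi> j (a j) = a j" "\<Phi>' j (a j) = a j"
    if "j < n" "j \<noteq> i" for j
  proof -
    have aj: "a j \<in> A j" using key_in[OF a that(1)] .
    show 1: "\<Psi> j (a j) = a j" "\<Psi>' j (a j) = a j"
      using that pol2_idem[OF u that(1) aj] by (auto simp: \<Psi>_def \<Psi>'_def)
    show "\<Phi> j (a j) = a j" "\<Phi>' j (a j) = a j" using 1 \<Phi>(2) \<Phi>'(2) that aj by metis+
  qed
  have "c = d" if d: "d \<in> C a i" for d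
  proof (rule collapse[OF a i])
    show "d \<in> A i" "c \<in> A i" using C_in_A i d c by auto
    show "a i \<noteq> c" using C_neq[OF a] c by auto
    fix v assume v: "v(i := c) \<in> R"
    have vA: "v j \<in> A j" if "j < n" "j \<noteq> i" for j using R_in[OF v that(1)] that by simp
    define e where "e = \<Phi> i (\<Psi>' i d)"
    have d1: "\<Psi>' i d \<in> C a i" using C_vf[OF \<Psi>' d] fix_a by blast
    have e: "e \<in> C a i" unfolding e_def using C_vf[OF \<Phi>(1) d1] fix_a by blast
    have "(\<lambda>j. \<Phi>' j (u j ((a(i := e)) j) ((v(i := c)) j))) \<in> R"
      by (rule vf_R[OF \<Phi>'(1) pol2_R[OF u CD[OF e] v]])
    then show "v(i := d) \<in> R"
    proof (rule R_cong)
      fix j assume j: "j < n"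
      show "\<Phi>' j (u j ((a(i := e)) j) ((v(i := c)) j)) = (v(i := d)) j"
      proof (cases "j = i")
        case True
        have "u i e c = \<Psi>' i d" using \<Phi>(3)[OF i C_in_A[OF d1 i]] by (simp add: e_def \<Psi>_def)
        then show ?thesis using True \<Phi>'(2)[OF i C_in_A[OF d i]] by simp
      next
        case False
        then show ?thesis using \<Phi>'(2)[OF j vA[OF j False]] by (simp add: \<Psi>'_def)
      qed
    qed
  qed
  then show ?thesis using c by auto
qed

text \<open>The injectivity assumptions make \<open>u\<close> a quasigroup at the relevant elements, and its
  Maltsev term maps the three corners of a square to \<open>a\<close>.\<close>

lemma pol2_maltsev_square:
  assumes u: "pol2 u" and a: "key a" and ij: "i < n" "j < n" "i \<noteq> j" and c: "c \<in> C a i" "d \<in> C a j"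
    and inj: "\<And>l. l < n \<Longrightarrow> inj_on (\<lambda>x. u l x (a l)) (A l)" "\<And>l. l < n \<Longrightarrow> inj_on (\<lambda>x. u l (a l) x) (A l)"
      "inj_on (\<lambda>x. u i x c) (A i)" "inj_on (\<lambda>x. u i c x) (A i)"
      "inj_on (\<lambda>x. u j x d) (A j)" "inj_on (\<lambda>x. u j d x) (A j)"
  shows "a(i := c, j := d) \<notin> R"
proof
  define t where "t = a(i := c, j := d)"
  assume "a(i := c, j := d) \<in> R"
  then have t: "t \<in> R" by (simp add: t_def)
  define \<Psi> where "\<Psi> = (\<lambda>l x. u l x (t l))"
  define \<Psi>' where "\<Psi>' = (\<lambda>l x. u l (t l) x)"
  have \<Psi>: "vf \<Psi>" unfolding \<Psi>_def by (rule vf_pol2_left[OF u t])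
  have \<Psi>': "vf \<Psi>'" unfolding \<Psi>'_def by (rule vf_pol2_right[OF u t])
  have inj\<Psi>: "inj_on (\<Psi> l) (A l)" "inj_on (\<Psi>' l) (A l)" if "l < n" for l
    using inj that ij by (auto simp: \<Psi>_def \<Psi>'_def t_def)
  obtain \<Phi> where \<Phi>: "vf \<Phi>" "\<And>j x. j < n \<Longrightarrow> x \<in> A j \<Longrightarrow> \<Phi> j (\<Psi> j x) = x"
    "\<And>j x. j < n \<Longrightarrow> x \<in> A j \<Longrightarrow> \<Psi> j (\<Phi> j x) = x"
    by (rule vf_inverse[OF \<Psi> inj\<Psi>(1)], assumption, rule that)
  obtain \<Phi>' where \<Phi>': "vf \<Phi>'" "\<And>j x. j < n \<Longrightarrow> x \<in> A j \<Longrightarrow> \<Phi>' j (\<Psi>' j x) = x"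
    "\<And>j x. j < n \<Longrightarrow> x \<in> A j \<Longrightarrow> \<Psi>' j (\<Phi>' j x) = x"
    by (rule vf_inverse[OF \<Psi>' inj\<Psi>(2)], assumption, rule that)
  have fix_t: "\<Phi> l (t l) = t l" "\<Phi>' l (t l) = t l" if "l < n" for l
    using \<Phi>(2)[OF that R_in[OF t that]] \<Phi>'(2)[OF that R_in[OF t that]]
      pol2_idem[OF u that R_in[OF t that]] by (auto simp: \<Psi>_def \<Psi>'_def)
  \<comment> \<open>With \<open>\<Phi>\<close> dividing by \<open>t\<close> on the right and
    \<open>\<Phi>'\<close> on the left, this is the Maltsev term of \<open>a(i := c)\<close>,
    \<open>t\<close> and \<open>a(j := d)\<close>. At \<open>i\<close> the first factor is
    \<open>t i\<close>, at \<open>j\<close> the second is \<open>t j\<close>, and the other division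
    cancels.\<close>
  have "(\<lambda>l. u l (\<Phi> l ((a(i := c)) l)) (\<Phi>' l ((a(j := d)) l))) \<in> R"
    by (rule pol2_R[OF u vf_R[OF \<Phi>(1) CD[OF c(1)]] vf_R[OF \<Phi>'(1) CD[OF c(2)]]])
  then have "a \<in> R"
  proof (rule R_cong)
    fix l assume l: "l < n"
    have al: "a l \<in> A l" using key_in[OF a l] .
    have tl: "t l \<in> A l" using R_in[OF t l] .
    show "u l (\<Phi> l ((a(i := c)) l)) (\<Phi>' l ((a(j := d)) l)) = a l"
    proof (cases "l = i")
      case True
      then have "\<Phi> l ((a(i := c)) l) = t l" using fix_t(1)[OF l] ij by (simp add: t_def)
      then show ?thesis using \<Phi>'(3)[OF l al] True ij by (simp add: \<Psi>'_def)
    next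
      case False
      show ?thesis
      proof (cases "l = j")
        case True
        then have "\<Phi>' l ((a(j := d)) l) = t l" using fix_t(2)[OF l] ij by (simp add: t_def)
        then show ?thesis using \<Phi>(3)[OF l al] True ij by (simp add: \<Psi>_def)
      next
        case False
        then show ?thesis using \<open>l \<noteq> i\<close> fix_t[OF l] pol2_idem[OF u l al] by (simp add: t_def)
      qed
    qed
  qed
  then show False using key_notR[OF a] by blast
qed

text \<open>With \<open>h(x, h(x, y)) = h(x, y)\<close> and \<open>k(x, y) = h(x, h(y, x))\<close>, any
  \<open>b\<close> fixed by \<open>h(a, \<cdot>)\<close> satisfies \<open>k(b, a) = b\<close>; iterating
  \<open>k\<close> in its second argument then makes \<open>k(a, b) = b\<close> hold as well.\<close>

lemma semilattice_term:
  assumes u: "pol2 u" and a: "key a"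
  obtains l w where "pol2 l" "pol2 w"
    "\<And>j c. j < n \<Longrightarrow> two_sided u a j \<Longrightarrow> c \<in> C a j \<Longrightarrow> w j (a j) c \<in> C a j"
    "\<And>j c. j < n \<Longrightarrow> two_sided u a j \<Longrightarrow> c \<in> C a j \<Longrightarrow> l j (a j) (w j (a j) c) = w j (a j) c"
    "\<And>j c. j < n \<Longrightarrow> two_sided u a j \<Longrightarrow> c \<in> C a j \<Longrightarrow> l j (w j (a j) c) (a j) = w j (a j) c"
    "\<And>j x. j < n \<Longrightarrow> inj_on (\<lambda>x. u j x (a j)) (A j) \<Longrightarrow> x \<in> A j \<Longrightarrow> l j x (a j) = x"
proof -
  note aT = key_T[OF a]
  define h where "h = (\<lambda>j x y. ((\<lambda>z. u j z x) ^^ N) y)"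
  define k where "k = (\<lambda>j x y. h j x (h j y x))"
  define l where "l = (\<lambda>j x y. ((\<lambda>z. k j x z) ^^ N) y)"
  define w where "w = (\<lambda>j x y. l j x (h j x y))"
  have h: "pol2 h" unfolding h_def by (rule pol2_iterate'[OF u])
  have k: "pol2 k" unfolding k_def by (rule pol2_comp[OF h pol2_proj1 pol2_swap[OF h]])
  have l: "pol2 l" unfolding l_def by (rule pol2_iterate[OF k])
  have w: "pol2 w" unfolding w_def by (rule pol2_comp[OF l pol2_proj1 h])
  obtain N' where N': "N = Suc N'" using N_pos gr0_conv_Suc by auto
  have hh: "h j x (h j x y) = h j x y" if "j < n" "x \<in> A j" "y \<in> A j" for j x y
    unfolding h_def using that pol2_in[OF u] by (intro funpow_N_idem) auto
  have ll: "l j x (l j x y) = l j x y" if "j < n" "x \<in> A j" "y \<in> A j" for j x y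
    unfolding l_def using that pol2_in[OF k] by (intro funpow_N_idem) auto
  have l_absorb: "l j x y = x" if "j < n" "x \<in> A j" "k j x y = x" for j x y
  proof -
    have "((\<lambda>z. k j x z) ^^ i) x = x" for i
      by (induction i) (use pol2_idem[OF k that(1,2)] in auto)
    then show ?thesis unfolding l_def N' funpow_Suc_right o_apply using that(3) by simp
  qed
  have props: "w j (a j) c \<in> C a j \<and> l j (a j) (w j (a j) c) = w j (a j) c
      \<and> l j (w j (a j) c) (a j) = w j (a j) c"
    if j: "j < n" and two: "two_sided u a j" and c: "c \<in> C a j" for j c
  proof -
    have aj: "a j \<in> A j" using key_in[OF a j] .
    have hC1: "h j (a j) y \<in> C a j" if "y \<in> C a j" for y
    proof -
      have "((\<lambda>z. u j z (a j)) ^^ i) y \<in> C a j" for i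
        by (induction i) (use two that in \<open>auto simp: two_sided_def\<close>)
      then show ?thesis by (simp add: h_def)
    qed
    have hC2: "h j y (a j) \<in> C a j" if "y \<in> C a j" for y
    proof -
      have "((\<lambda>z. u j z y) ^^ i) (u j (a j) y) \<in> C a j" for i
        by (induction i) (use two that C_pol2[OF u aT] in \<open>auto simp: two_sided_def\<close>)
      then show ?thesis unfolding h_def N' funpow_Suc_right o_apply .
    qed
    have kC: "k j (a j) y \<in> C a j" if "y \<in> C a j" for y
      unfolding k_def using hC1[OF hC2[OF that]] .
    have lC: "l j (a j) y \<in> C a j" if "y \<in> C a j" for y
    proof -
      have "((\<lambda>z. k j (a j) z) ^^ i) y \<in> C a j" for i
        by (induction i) (use that kC in auto)
      then show ?thesis by (simp add: l_def)
    qed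
    define b where "b = w j (a j) c"
    have b: "b \<in> C a j" unfolding b_def w_def using lC[OF hC1[OF c]] .
    then have bA: "b \<in> A j" using C_in_A j by blast
    have cA: "c \<in> A j" using C_in_A j c by blast
    have "h j (a j) c \<in> A j" using pol2_in[OF h j aj cA] .
    then have lb: "l j (a j) b = b" unfolding b_def w_def using ll[OF j aj] by blast
    have "\<exists>y\<in>A j. b = k j (a j) y"
    proof -
      have "b = k j (a j) (((\<lambda>z. k j (a j) z) ^^ N') (h j (a j) c))"
        by (simp add: b_def w_def l_def N')
      moreover have "((\<lambda>z. k j (a j) z) ^^ N') (h j (a j) c) \<in> A j"
        using pol2_in[OF pol2_iterate[OF k] j aj \<open>h j (a j) c \<in> A j\<close>] .
      ultimately show ?thesis by blast
    qed
    \<comment> \<open>As a value of \<open>k (a j)\<close>, \<open>b\<close> is a value of the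
      idempotent map \<open>h (a j)\<close>, hence fixed by it.\<close>
    then obtain y where y: "y \<in> A j" "b = h j (a j) (h j y (a j))" by (auto simp: k_def)
    have hb: "h j (a j) b = b" unfolding y(2) using hh[OF j aj pol2_in[OF h j y(1) aj]] .
    have "k j b (a j) = b" unfolding k_def hb using pol2_idem[OF h j bA] .
    from l_absorb[OF j bA this] b lb show ?thesis by (simp add: b_def)
  qed
  show ?thesis
  proof (rule that[OF l w])
    fix j x assume j: "j < n" and inj: "inj_on (\<lambda>x. u j x (a j)) (A j)" and x: "x \<in> A j"
    have aj: "a j \<in> A j" using key_in[OF a j] .
    \<comment> \<open>Where \<open>u\<close> is injective, so is the idempotent map
      \<open>h (a j)\<close>, which is therefore the identity; then
      \<open>k x (a j) = h x x = x\<close>, and iterating keeps \<open>x\<close>.\<close>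
    have inj': "inj_on (h j (a j)) (A j)"
    proof -
      have "inj_on ((\<lambda>z. u j z (a j)) ^^ i) (A j)" for i
      proof (induction i)
        case (Suc i)
        have "((\<lambda>z. u j z (a j)) ^^ i) y \<in> A j" if "y \<in> A j" for y
          using pol2_in[OF pol2_iterate'[OF u] j aj that] .
        then show ?case using Suc inj by (simp add: inj_on_def)
      qed simp
      then show ?thesis by (simp add: h_def)
    qed
    have "h j (a j) x = x"
      by (rule inj_onD[OF inj' hh[OF j aj x]]) (use pol2_in[OF h j aj x] x in auto)
    then have "k j x (a j) = x" unfolding k_def using pol2_idem[OF h j x] by simp
    then show "l j x (a j) = x" using l_absorb[OF j x] by blast
  qed (use props in auto)
qed

end

section \<open>Weak near-unanimity operations on a core\<close>

text \<open>\<open>F_special\<close> makes every injective \<open>opr i x\<close> the identity; this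
  is how permutations arising from the operation become computable.\<close>

locale core_wnu = core_relation + wnu_relation +
  fixes r :: nat
  assumes n_ge: "3 \<le> n" and r_pos: "1 \<le> r" and r_le: "r \<le> n"
    and F_special: "i < n \<Longrightarrow> x \<in> A i \<Longrightarrow> y \<in> A i \<Longrightarrow>
      F i ((\<lambda>_. x)(0 := F i ((\<lambda>_. x)(0 := y)))) = F i ((\<lambda>_. x)(0 := y))"
    and pattern_square: "i < n \<Longrightarrow> j < n \<Longrightarrow> i \<noteq> j \<Longrightarrow>
      (\<exists>x c d. square i j x c d) \<longleftrightarrow> \<not> (i < r \<and> j < r)"
begin

definition opr :: "nat \<Rightarrow> 'a \<Rightarrow> 'a \<Rightarrow> 'a" where
  "opr i x y = F i ((\<lambda>_. x)(0 := y))"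

lemma m_pos: "0 < m" using m_ge by simp

lemma F_opr:
  assumes "i < n" "x \<in> A i" "y \<in> A i" "k < m" "\<And>q. q < m \<Longrightarrow> q \<noteq> k \<Longrightarrow> g q = x" "g k = y"
  shows "F i g = opr i x y"
proof -
  have "F i g = F i ((\<lambda>_. x)(k := y))" by (rule F_cong) (use assms in auto)
  then show ?thesis using F_wnu[OF assms(1-4)] by (simp add: opr_def)
qed

lemma F_const:
  assumes "i < n" "x \<in> A i" "\<And>q. q < m \<Longrightarrow> g q = x"
  shows "F i g = x"
proof -
  have "F i g = F i (\<lambda>_. x)" by (rule F_cong) (use assms in auto)
  then show ?thesis using F_idem[OF assms(1,2)] by simp
qed

lemma opr_special: "i < n \<Longrightarrow> x \<in> A i \<Longrightarrow> y \<in> A i \<Longrightarrow> opr i x (opr i x y) = opr i x y"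
  unfolding opr_def by (rule F_special)

lemma opr_pol2: "pol2 opr"
  unfolding pol2_def
proof (intro conjI allI impI ballI)
  fix i x y assume "i < n" "x \<in> A i" "y \<in> A i"
  then show "opr i x y \<in> A i" unfolding opr_def by (intro F_in) auto
next
  fix i x assume "i < n" "x \<in> A i"
  then show "opr i x x = x" unfolding opr_def by (intro F_const) auto
next
  fix s t assume st: "s \<in> R" "t \<in> R"
  have "(\<lambda>i. F i (\<lambda>k. ((\<lambda>_. s)(0 := t)) k i)) \<in> R" by (rule F_R) (use st in auto)
  then show "(\<lambda>i. opr i (s i) (t i)) \<in> R"
    unfolding opr_def by (rule R_cong) (rule arg_cong[where f = "F _"], auto)
qed

lemma opr_in: "i < n \<Longrightarrow> x \<in> A i \<Longrightarrow> y \<in> A i \<Longrightarrow> opr i x y \<in> A i"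
  using pol2_in[OF opr_pol2] .

lemma opr_inj_id:
  assumes "i < n" "x \<in> A i" "y \<in> A i" "inj_on (opr i x) (A i)"
  shows "opr i x y = y"
  by (rule inj_onD[OF assms(4) opr_special[OF assms(1-3)]]) (use assms opr_in in auto)

lemma vf_F:
  assumes "\<And>k. k < m \<Longrightarrow> k \<in> P \<Longrightarrow> t k \<in> R"
  shows "vf (\<lambda>i x. F i (\<lambda>k. if k \<in> P then t k i else x))"
  unfolding vf_def
proof (intro conjI allI impI ballI)
  fix i x assume "i < n" "x \<in> A i"
  then show "F i (\<lambda>k. if k \<in> P then t k i else x) \<in> A i"
    using assms R_in by (intro F_in) auto
next
  fix x assume "x \<in> R"
  then have "(\<lambda>i. F i (\<lambda>k. (if k \<in> P then t k else x) i)) \<in> R"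
    using assms by (intro F_R) auto
  moreover have "(\<lambda>k. (if k \<in> P then t k else x) i) = (\<lambda>k. if k \<in> P then t k i else x i)" for i
    by auto
  ultimately show "(\<lambda>i. F i (\<lambda>k. if k \<in> P then t k i else x i)) \<in> R" by simp
qed

lemma F_upd:
  assumes "a \<in> T" "i < n"
  shows "(\<lambda>j. F j (\<lambda>q. (a(i := g q)) j)) \<in> R \<longleftrightarrow> F i g \<in> C a i"
  unfolding C_def mem_Collect_eq
proof (rule R_cong_iff)
  fix j assume j: "j < n"
  show "F j (\<lambda>q. (a(i := g q)) j) = (a(i := F i g)) j"
  proof (cases "j = i")
    case False
    then show ?thesis using F_const[OF j T_in[OF assms(1) j], of "\<lambda>q. (a(i := g q)) j"] by simp
  qed simp
qed

lemma F_C: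
  assumes "a \<in> T" "i < n" "\<And>q. q < m \<Longrightarrow> g q \<in> C a i"
  shows "F i g \<in> C a i"
  unfolding F_upd[OF assms(1,2), symmetric] by (rule F_R) (rule CD[OF assms(3)])

text \<open>The affine coordinates. The elements \<open>\<gamma> q\<close> may differ here, which is what
  makes the negation strong enough for \<open>two_sided_exists\<close>; \<open>lin_props\<close> shows that
  they coincide.\<close>

definition lin :: "(nat \<Rightarrow> 'a) \<Rightarrow> nat \<Rightarrow> bool" where
  "lin a i \<longleftrightarrow> (\<exists>\<gamma> k. k < m \<and> (\<forall>q<m. q \<noteq> k \<longrightarrow> \<gamma> q \<in> C a i) \<and> F i (\<gamma>(k := a i)) \<notin> C a i)"

lemma not_linD:
  assumes "\<not> lin a i" "k < m" "c \<in> C a i"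
  shows "F i ((\<lambda>_. c)(k := a i)) \<in> C a i"
proof (rule ccontr)
  assume "F i ((\<lambda>_. c)(k := a i)) \<notin> C a i"
  then have "lin a i" unfolding lin_def
    using assms(2,3) by (intro exI[of _ "\<lambda>_. c"] exI[of _ k] conjI) auto
  then show False using assms(1) by contradiction
qed

text \<open>The substitution witnessing linearity permutes every coordinate. Off \<open>i\<close> it
  is \<open>opr j (a j)\<close>, idempotent and injective, hence the identity. At \<open>i\<close>,
  letting one substituted position carry an arbitrary tuple shows that \<open>c\<close> can be
  replaced by any other element of \<open>C a i\<close> throughout the relation, so there is no
  other; the same function is then \<open>opr i c\<close>.\<close>

lemma lin_props:
  assumes a: "key a" and i: "i < n" and lin: "lin a i"
  obtains c where "C a i = {c}" "\<And>x. x \<in> A i \<Longrightarrow> opr i c x = x"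
    "\<And>j x. j < n \<Longrightarrow> j \<noteq> i \<Longrightarrow> x \<in> A j \<Longrightarrow> opr j (a j) x = x"
proof -
  note aT = key_T[OF a]
  obtain \<gamma> k where k: "k < m" and \<gamma>: "\<And>q. q < m \<Longrightarrow> q \<noteq> k \<Longrightarrow> \<gamma> q \<in> C a i"
    and notC: "F i (\<gamma>(k := a i)) \<notin> C a i"
    using lin by (auto simp: lin_def)
  define \<Psi> where "\<Psi> = (\<lambda>j x. F j (\<lambda>q. if q \<in> - {k} then (a(i := \<gamma> q)) j else x))"
  have \<Psi>: "vf \<Psi>" unfolding \<Psi>_def by (rule vf_F, rule CD, rule \<gamma>) auto
  have "(\<lambda>j. \<Psi> j (a j)) = (\<lambda>j. F j (\<lambda>q. (a(i := (\<gamma>(k := a i)) q)) j))"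
    unfolding \<Psi>_def by (intro ext arg_cong[where f = "F _"]) auto
  then have "(\<lambda>j. \<Psi> j (a j)) \<notin> R" using notC by (simp only: F_upd[OF aT i] not_False_eq_True)
  then have inj: "inj_on (\<Psi> j) (A j)" if "j < n" for j
    using key_image_inj[OF a \<Psi> _ that] by blast
  have \<Psi>_opr: "\<Psi> j x = opr j (a j) x" if "j < n" "j \<noteq> i" "x \<in> A j" for j x
    unfolding \<Psi>_def by (rule F_opr[OF that(1) key_in[OF a that(1)] that(3) k]) (use that in auto)
  have id: "opr j (a j) x = x" if "j < n" "j \<noteq> i" "x \<in> A j" for j x
  proof (rule opr_inj_id[OF that(1) key_in[OF a that(1)] that(3)])
    show "inj_on (opr j (a j)) (A j)" using inj[OF that(1)] \<Psi>_opr[OF that(1,2)]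
      by (simp add: inj_on_def)
  qed
  obtain \<Phi> where \<Phi>: "vf \<Phi>" "\<And>j x. j < n \<Longrightarrow> x \<in> A j \<Longrightarrow> \<Phi> j (\<Psi> j x) = x"
    "\<And>j x. j < n \<Longrightarrow> x \<in> A j \<Longrightarrow> \<Psi> j (\<Phi> j x) = x"
    by (rule vf_inverse[OF \<Psi> inj], assumption, rule that)
  have \<Phi>a: "\<Phi> j (a j) = a j" if "j < n" "j \<noteq> i" for j
    using \<Phi>(2)[OF that(1) key_in[OF a that(1)]] \<Psi>_opr[OF that key_in[OF a that(1)]]
      id[OF that key_in[OF a that(1)]] by simp
  obtain p where p: "p < m" "p \<noteq> k"
    using m_ge k by (metis One_nat_def Suc_1 Suc_le_lessD less_trans zero_less_one zero_neq_one)
  define c where "c = \<gamma> p"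
  have c: "c \<in> C a i" using \<gamma> p by (simp add: c_def)
  have single: "c = d" if d: "d \<in> C a i" for d
  proof (rule collapse[OF a i])
    show "d \<in> A i" "c \<in> A i" using C_in_A i d c by auto
    show "a i \<noteq> c" using C_neq[OF a] c by auto
    fix v assume v: "v(i := c) \<in> R"
    have e: "\<Phi> i d \<in> C a i" by (rule C_vf[OF \<Phi>(1) d \<Phi>a])
    \<comment> \<open>Position \<open>p\<close> keeps the entry \<open>c\<close> at \<open>i\<close>
      and carries \<open>v\<close> elsewhere, position \<open>k\<close> receives the preimage of
      \<open>d\<close>. The result is \<open>d\<close> at \<open>i\<close> and
      \<open>opr j (a j) (v j) = v j\<close> at the other coordinates.\<close>
    define t where "t = (\<lambda>q. if q = p then v(i := c) else if q = k then a(i := \<Phi> i d) else a(i := \<gamma> q))"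
    have "(\<lambda>j. F j (\<lambda>q. t q j)) \<in> R" by (rule F_R) (use v CD[OF e] CD[OF \<gamma>] in \<open>auto simp: t_def\<close>)
    then show "v(i := d) \<in> R"
    proof (rule R_cong)
      fix j assume j: "j < n"
      show "F j (\<lambda>q. t q j) = (v(i := d)) j"
      proof (cases "j = i")
        case True
        have "F i (\<lambda>q. t q i) = \<Psi> i (\<Phi> i d)" unfolding \<Psi>_def
          by (rule F_cong[OF i]) (use p in \<open>auto simp: t_def c_def\<close>)
        then show ?thesis using True \<Phi>(3)[OF i C_in_A[OF d i]] by simp
      next
        case False
        have vj: "v j \<in> A j" using R_in[OF v j] False by simp
        have "F j (\<lambda>q. t q j) = opr j (a j) (v j)"
          by (rule F_opr[OF j key_in[OF a j] vj p(1)]) (use False in \<open>auto simp: t_def\<close>)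
        then show ?thesis using False id[OF j False vj] by simp
      qed
    qed
  qed
  have \<gamma>c: "\<gamma> q = c" if "q < m" "q \<noteq> k" for q using single[OF \<gamma>[OF that]] by simp
  have cA: "c \<in> A i" using C_in_A c i by blast
  have \<Psi>c: "\<Psi> i x = opr i c x" if "x \<in> A i" for x
    unfolding \<Psi>_def by (rule F_opr[OF i cA that k]) (use \<gamma>c in auto)
  have "opr i c x = x" if "x \<in> A i" for x
  proof (rule opr_inj_id[OF i cA that])
    show "inj_on (opr i c) (A i)" using inj[OF i] \<Psi>c by (simp add: inj_on_def)
  qed
  moreover have "C a i = {c}" using single c by blast
  ultimately show ?thesis using that[of c] id by presburger
qed

text \<open>Otherwise the pattern gives a square at \<open>a\<close>, whose corners are determined
  since repairing elements are unique. Applied to the two single repairs and to the double repair in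
  all further positions, the operation returns \<open>a\<close>, because \<open>opr i c\<close> and
  \<open>opr j d\<close> are identities.\<close>

lemma lin_pair:
  assumes a: "key a" and ij: "i < n" "j < n" "i \<noteq> j" and lin: "lin a i" "lin a j"
  shows "i < r" "j < r"
proof -
  obtain c where c: "C a i = {c}" "\<And>x. x \<in> A i \<Longrightarrow> opr i c x = x" using lin_props[OF a ij(1) lin(1)] by metis
  obtain d where d: "C a j = {d}" "\<And>x. x \<in> A j \<Longrightarrow> opr j d x = x" using lin_props[OF a ij(2) lin(2)] by metis
  have "i < r \<and> j < r"
  proof (rule ccontr)
    assume "\<not> (i < r \<and> j < r)"
    then obtain c' d' where sq: "square i j a c' d'"
      using pattern_square[OF ij] square_at_key[OF a _ ij(3)] by blast
    then have R: "a(i := c') \<in> R" "a(j := d') \<in> R" "a(i := c', j := d') \<in> R"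
      by (auto simp: square_def)
    then have "c' = c" "d' = d" using c(1) d(1) by (auto simp: C_def)
    then have R: "a(i := c) \<in> R" "a(j := d) \<in> R" "a(i := c, j := d) \<in> R" using R by auto
    have cd: "c \<in> A i" "d \<in> A j" using c(1) d(1) C_in_A[of c a i] C_in_A[of d a j] ij by auto
    define t where "t = (\<lambda>q::nat. if q = 0 then a(i := c) else if q = 1 then a(j := d) else a(i := c, j := d))"
    have "(\<lambda>l. F l (\<lambda>q. t q l)) \<in> R" by (rule F_R) (use R in \<open>auto simp: t_def\<close>)
    then have "a \<in> R"
    proof (rule R_cong)
      fix l assume l: "l < n"
      consider "l = i" | "l = j" | "l \<noteq> i" "l \<noteq> j" by blast
      then show "F l (\<lambda>q. t q l) = a l"
      proof cases
        case 1
        have "F i (\<lambda>q. t q i) = opr i c (a i)"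
          by (rule F_opr[OF ij(1) cd(1) key_in[OF a ij(1)], of 1])
            (use m_ge ij in \<open>auto simp: t_def\<close>)
        then show ?thesis using 1 c(2) key_in[OF a ij(1)] by simp
      next
        case 2
        have "F j (\<lambda>q. t q j) = opr j d (a j)"
          by (rule F_opr[OF ij(2) cd(2) key_in[OF a ij(2)], of 0])
            (use m_ge ij in \<open>auto simp: t_def\<close>)
        then show ?thesis using 2 d(2) key_in[OF a ij(2)] by simp
      next
        case 3
        then show ?thesis by (intro F_const[OF l key_in[OF a l]]) (auto simp: t_def)
      qed
    qed
    then show False using key_notR[OF a] by blast
  qed
  then show "i < r" "j < r" by auto
qed

section \<open>Rectangularity and linearity of a class of three\<close>

lemma rectangular:
  assumes "i < r" "j < r" "i \<noteq> j"
    and "x(i := p, j := q) \<in> R" "x(i := p, j := q') \<in> R" "x(i := p', j := q) \<in> R"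
  shows "x(i := p', j := q') \<in> R"
proof (rule ccontr)
  let ?y = "x(i := p', j := q')"
  assume "?y \<notin> R"
  moreover have "?y \<in> T" unfolding T_def
  proof (intro CollectI allI impI)
    fix l assume "l < n"
    then show "?y l \<in> A l" using R_in[OF assms(4)] R_in[OF assms(5)] R_in[OF assms(6)] assms(3)
      by (auto simp: fun_upd_def split: if_splits) metis+
  qed
  moreover have "?y(i := p) = x(i := p, j := q')" "?y(j := q) = x(i := p', j := q)"
    "?y(i := p, j := q) = x(i := p, j := q)"
    using assms(3) by (auto simp: fun_upd_def)
  \<comment> \<open>The missing corner and the three given ones form a square, which the pattern
    forbids inside the class.\<close>
  ultimately have "square i j ?y p q" using assms unfolding square_def by simp
  then show False using pattern_square[of i j] assms(1-3) r_le by auto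
qed

text \<open>Without linear coordinates, a single argument \<open>a\<close> among arguments
  \<open>b\<close> still gives a repairing value. Rectangularity on three coordinates extends this
  to more arguments \<open>a\<close>, one at a time; when all \<open>m\<close> are reached,
  idempotence makes \<open>a 0\<close> itself repairing.\<close>

lemma lin_in_class:
  assumes a: "key a" and r: "3 \<le> r"
  shows "\<exists>i<r. lin a i"
proof (rule ccontr)
  assume contra: "\<not> (\<exists>i<r. lin a i)"
  note aT = key_T[OF a]
  have "\<forall>i<n. \<exists>c. c \<in> C a i" using C_nonempty[OF a] by metis
  then obtain b where b: "\<And>i. i < n \<Longrightarrow> b i \<in> C a i" by metis
  have "F i (\<lambda>q. if q < k then a i else b i) \<in> C a i" if "k \<le> m" "i < 3" for k i
    using that
  proof (induction k arbitrary: i)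
    case 0
    then show ?case using F_C[OF aT, of i "\<lambda>_. b i"] b n_ge by simp
  next
    case (Suc k l)
    \<comment> \<open>With \<open>l\<close>, these make up the coordinates \<open>0\<close>,
      \<open>1\<close>, \<open>2\<close>. The repair is placed at \<open>i\<close> in the first
      \<open>k\<close> positions, at \<open>j\<close> in position \<open>k\<close>, and at
      \<open>l\<close> in the later ones.\<close>
    define i where "i = (if l = 0 then 1 else 0 :: nat)"
    define j where "j = (if l = 2 then 1 else 2 :: nat)"
    have d: "i \<noteq> j" "i \<noteq> l" "j \<noteq> l" "i < 3" "j < 3" "l < 3"
      using Suc.prems by (auto simp: i_def j_def)
    then have rr: "i < r" "j < r" "l < r" and nn: "i < n" "j < n" "l < n" using r r_le by auto
    have aA: "a i \<in> A i" "a j \<in> A j" "a l \<in> A l" using key_in[OF a] nn by auto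
    have bA: "b i \<in> A i" "b j \<in> A j" "b l \<in> A l" using C_in_A[OF b] nn by auto
    have ab: "a(i := b i) \<in> R" "a(j := b j) \<in> R" "a(l := b l) \<in> R" using CD[OF b] nn by auto
    define tri where "tri = (\<lambda>x y z. a(i := x, j := y, l := z))"
    have rect_il: "tri x' y z' \<in> R" if "tri x y z \<in> R" "tri x y z' \<in> R" "tri x' y z \<in> R" for x x' y z z'
      using rectangular[OF rr(1,3) d(2), of "a(j := y)" x z z' x'] that d
      by (simp add: tri_def fun_upd_twist)
    have rect_jl: "tri x y' z' \<in> R" if "tri x y z \<in> R" "tri x y z' \<in> R" "tri x y' z \<in> R" for x y y' z z'
      using rectangular[OF rr(2,3) d(3), of "a(i := x)" y z z' y'] that by (simp add: tri_def)
    have rect_ij: "tri x' y' z \<in> R" if "tri x y z \<in> R" "tri x y' z \<in> R" "tri x' y z \<in> R" for x x' y y' z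
      using rectangular[OF rr(1,2) d(1), of "a(l := z)" x y y' x'] that d
      by (simp add: tri_def fun_upd_twist)
    have tri_F: "tri (F i (\<lambda>q. x q)) (F j (\<lambda>q. y q)) (F l (\<lambda>q. z q)) \<in> R"
      if xyz: "\<And>q. q < m \<Longrightarrow> tri (x q) (y q) (z q) \<in> R" for x y z
    proof -
      have "(\<lambda>h. F h (\<lambda>q. tri (x q) (y q) (z q) h)) \<in> R" by (rule F_R) (rule xyz)
      then show ?thesis
      proof (rule R_cong)
        fix h assume h: "h < n"
        consider "h = i" | "h = j" | "h = l" | "h \<noteq> i" "h \<noteq> j" "h \<noteq> l" by blast
        then show "F h (\<lambda>q. tri (x q) (y q) (z q) h) = tri (F i (\<lambda>q. x q)) (F j (\<lambda>q. y q)) (F l (\<lambda>q. z q)) h"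
          by cases (use d h F_const[OF h key_in[OF a h], of "\<lambda>q. a h"] in \<open>auto simp: tri_def\<close>)
      qed
    qed
    have tri_a: "tri (b i) (a j) (a l) \<in> R" "tri (a i) (b j) (a l) \<in> R" "tri (a i) (a j) (b l) \<in> R"
      using ab d by (auto simp: tri_def fun_upd_idem)
    have C_tri: "x \<in> C a l \<longleftrightarrow> tri (a i) (a j) x \<in> R" for x
      by (simp add: C_def tri_def)
    define p where "p = F i (\<lambda>q. if q < k then b i else a i)"
    define p' where "p' = F l (\<lambda>q. if q < k then a l else b l)"
    define u where "u = F j (\<lambda>q. if q = k then b j else a j)"
    define u' where "u' = F l (\<lambda>q. if q = k then a l else b l)"
    define s where "s = F l (\<lambda>q. if q < Suc k then a l else b l)"
    have aj: "a j = F j (\<lambda>q. a j)" "a i = F i (\<lambda>q. a i)" using F_idem nn aA by auto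
    have p': "tri (a i) (a j) p' \<in> R" using Suc.IH[of l] Suc.prems C_tri by (simp add: p'_def)
    \<comment> \<open>The value \<open>p'\<close> repairs \<open>a\<close> by the induction
      hypothesis, so rectangularity exchanges it for \<open>b l\<close> beside \<open>p\<close>. The
      pair \<open>u\<close>, \<open>u'\<close> repeats this for the single position
      \<open>k\<close>, with non-linearity as the input.\<close>
    have "tri p (a j) p' \<in> R" unfolding p_def p'_def
      by (subst aj(1), rule tri_F) (use tri_a in auto)
    from rect_il[OF p' tri_a(3) this] have pb: "tri p (a j) (b l) \<in> R" .
    have "k < m" using Suc.prems by simp
    have "F l ((\<lambda>q. b l)(k := a l)) \<in> C a l"
      by (rule not_linD) (use contra rr b nn \<open>k < m\<close> in auto)
    moreover have "(\<lambda>q. b l)(k := a l) = (\<lambda>q. if q = k then a l else b l)" by auto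
    ultimately have u': "tri (a i) (a j) u' \<in> R" using C_tri by (simp add: u'_def)
    have "tri (a i) u u' \<in> R" unfolding u_def u'_def
      by (subst aj(2), rule tri_F) (use tri_a in auto)
    from rect_jl[OF u' tri_a(3) this] have ub: "tri (a i) u (b l) \<in> R" .
    have pus: "tri p u s \<in> R" unfolding p_def u_def s_def
      by (rule tri_F) (use tri_a in auto)
    \<comment> \<open>Three applications of rectangularity now strip \<open>u\<close> and
      \<open>p\<close> from beside \<open>s\<close>.\<close>
    have pub: "tri p u (b l) \<in> R" by (rule rect_ij[OF tri_a(3) ub pb])
    have "tri p (a j) s \<in> R" by (rule rect_jl[OF pub pus pb])
    from rect_il[OF pb this tri_a(3)] show ?case using C_tri by (simp add: s_def)
  qed
  from this[of m 0] have "F 0 (\<lambda>q. if q < m then a 0 else b 0) \<in> C a 0" by simp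
  moreover have "F 0 (\<lambda>q. if q < m then a 0 else b 0) = a 0"
    using n_ge by (intro F_const key_in[OF a]) auto
  ultimately show False using C_neq[OF a] by metis
qed

text \<open>If \<open>j\<close> were not linear, \<open>opr\<close> would combine
  \<open>a(j := b)\<close> and \<open>a(k := e)\<close>, with \<open>k\<close> a third coordinate of
  the class, into a tuple whose entry at \<open>k\<close> is still \<open>e\<close>, as
  \<open>opr k (a k)\<close> is the identity. Rectangularity on \<open>j\<close> and
  \<open>k\<close> would put \<open>a\<close> into the relation.\<close>

lemma lin_class:
  assumes a: "key a" and r: "3 \<le> r" and j: "j < r"
  shows "lin a j"
proof (rule ccontr)
  assume nl: "\<not> lin a j"
  note aT = key_T[OF a]
  obtain i where i: "i < r" "lin a i" using lin_in_class[OF a r] by blast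
  then have "i \<noteq> j" using nl by auto
  have "\<exists>k<3. k \<noteq> i \<and> k \<noteq> j" by presburger
  then obtain k where "k < 3" "k \<noteq> i" "k \<noteq> j" by blast
  then have k: "k < r" "k < n" "k \<noteq> i" "k \<noteq> j" using r r_le by auto
  have nn: "i < n" "j < n" using i j r_le by auto
  obtain b where b: "b \<in> C a j" using C_nonempty[OF a nn(2)] by blast
  obtain e where e: "e \<in> C a k" using C_nonempty[OF a k(2)] by blast
  have eA: "e \<in> A k" and bA: "b \<in> A j" using C_in_A e b k nn by auto
  have oe: "opr k (a k) e = e" using lin_props[OF a nn(1) i(2)] k eA by metis
  have "F j ((\<lambda>_. b)(0 := a j)) \<in> C a j" by (rule not_linD[OF nl m_pos b])
  then have ob: "a(j := opr j b (a j)) \<in> R" by (simp add: opr_def C_def)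
  have "(\<lambda>l. opr l ((a(j := b)) l) ((a(k := e)) l)) \<in> R" by (rule pol2_R[OF opr_pol2 CD[OF b] CD[OF e]])
  then have be: "a(j := opr j b (a j), k := e) \<in> R"
    by (rule R_cong) (use k oe pol2_idem[OF opr_pol2] key_in[OF a] in auto)
  have "a(j := a j, k := a k) \<in> R"
  proof (rule rectangular[OF j k(1) k(4)[symmetric] be])
    show "a(j := opr j b (a j), k := a k) \<in> R" using ob k by (simp add: fun_upd_idem)
    show "a(j := a j, k := e) \<in> R" using CD[OF e] by simp
  qed
  then show False using key_notR[OF a] by simp
qed

lemma opr_key_id:
  assumes a: "key a" and r: "3 \<le> r" and j: "j < n" "x \<in> A j"
  shows "opr j (a j) x = x"
proof -
  obtain i where i: "i < r" "i \<noteq> j" using r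
    by (metis One_nat_def Suc_lessD Suc_le_lessD numeral_3_eq_3 zero_neq_one)
  then show ?thesis using lin_props[OF a _ lin_class[OF a r i(1)]] j r_le by (metis order_less_le_trans)
qed

text \<open>Take a maximal set \<open>P\<close> of positions that can be filled with elements of
  \<open>C a j\<close> while leaving a permutation \<open>\<Psi>\<close> of the remaining variable; splitting off one further position
  and composing with the inverse of \<open>\<Psi>\<close> gives the binary operation.\<close>

lemma two_sided_exists:
  assumes a: "key a" and j: "j < n" and nl: "\<not> lin a j"
  obtains v where "pol2 v" "two_sided v a j"
proof -
  note aT = key_T[OF a]
  define Q where "Q = (\<lambda>P. P \<subseteq> {..<m} \<and> (\<exists>\<gamma>. (\<forall>q\<in>P. \<gamma> q \<in> C a j) \<and>
      F j (\<lambda>q. if q \<in> P then \<gamma> q else a j) \<notin> C a j))"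
  have "Q {}" using F_idem[OF j key_in[OF a j]] C_neq[OF a] by (auto simp: Q_def)
  moreover have "\<forall>P. Q P \<longrightarrow> card P < Suc m"
    using card_mono[of "{..<m}"] by (auto simp: Q_def less_Suc_eq_le)
  ultimately obtain P where P: "Q P" and max: "\<And>P'. Q P' \<Longrightarrow> card P' \<le> card P"
    using ex_has_greatest_nat[of Q "{}" card "Suc m"] by blast
  obtain \<gamma> where sub: "P \<subseteq> {..<m}" and \<gamma>: "\<And>q. q \<in> P \<Longrightarrow> \<gamma> q \<in> C a j"
    and notC: "F j (\<lambda>q. if q \<in> P then \<gamma> q else a j) \<notin> C a j"
    using P by (auto simp: Q_def)
  have finP: "finite P" using sub finite_subset by blast
  have "P \<noteq> {..<m}" using F_C[OF aT j, of "\<lambda>q. if q \<in> P then \<gamma> q else a j"] \<gamma> notC by auto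
  then obtain k where k: "k < m" "k \<notin> P" using sub by blast
  \<comment> \<open>As \<open>j\<close> is not linear, a set satisfying \<open>Q\<close> never
    leaves just one position free; besides \<open>k\<close> there is a free position for the second
    variable.\<close>
  have not_co: "\<not> Q ({..<m} - {k'})" if k': "k' < m" for k'
  proof
    assume "Q ({..<m} - {k'})"
    then obtain \<delta> where \<delta>: "\<forall>q<m. q \<noteq> k' \<longrightarrow> \<delta> q \<in> C a j"
      "F j (\<lambda>q. if q \<in> {..<m} - {k'} then \<delta> q else a j) \<notin> C a j" by (auto simp: Q_def)
    have "F j (\<lambda>q. if q \<in> {..<m} - {k'} then \<delta> q else a j) = F j (\<delta>(k' := a j))"
      by (rule F_cong[OF j]) auto
    then show False using \<delta> nl k' unfolding lin_def by auto
  qed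
  have cardP: "card P < m - 1"
  proof -
    have "P \<subseteq> {..<m} - {k}" using sub k by auto
    moreover have "P \<noteq> {..<m} - {k}" using P not_co[OF k(1)] by auto
    ultimately have "P \<subset> {..<m} - {k}" by blast
    then have "card P < card ({..<m} - {k})" by (intro psubset_card_mono) auto
    then show ?thesis using k by simp
  qed
  have big: "F j (\<lambda>q. if q \<in> P' then \<delta> q else a j) \<in> C a j"
    if "P' \<subseteq> {..<m}" "card P < card P'" "\<And>q. q \<in> P' \<Longrightarrow> \<delta> q \<in> C a j" for P' \<delta>
    using max[of P'] that unfolding Q_def by (meson leD)
  define \<Psi> where "\<Psi> = (\<lambda>l x. F l (\<lambda>q. if q \<in> P then (a(j := \<gamma> q)) l else x))"
  have \<Psi>: "vf \<Psi>" unfolding \<Psi>_def by (rule vf_F, rule CD, rule \<gamma>) auto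
  have "(\<lambda>l. \<Psi> l (a l)) = (\<lambda>l. F l (\<lambda>q. (a(j := (if q \<in> P then \<gamma> q else a j))) l))"
    unfolding \<Psi>_def by (intro ext arg_cong[where f = "F _"]) auto
  then have "(\<lambda>l. \<Psi> l (a l)) \<notin> R" using notC by (simp only: F_upd[OF aT j] not_False_eq_True)
  then have inj: "inj_on (\<Psi> l) (A l)" if "l < n" for l
    using key_image_inj[OF a \<Psi> _ that] by blast
  obtain \<Phi> where \<Phi>: "vf \<Phi>" "\<And>j x. j < n \<Longrightarrow> x \<in> A j \<Longrightarrow> \<Phi> j (\<Psi> j x) = x"
    "\<And>j x. j < n \<Longrightarrow> x \<in> A j \<Longrightarrow> \<Psi> j (\<Phi> j x) = x"
    by (rule vf_inverse[OF \<Psi> inj], assumption, rule that)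
  have \<Psi>a: "\<Psi> l (a l) = a l" if "l < n" "l \<noteq> j" for l
    unfolding \<Psi>_def by (rule F_const[OF that(1) key_in[OF a that(1)]]) (use that in auto)
  have \<Phi>a: "\<Phi> l (a l) = a l" if "l < n" "l \<noteq> j" for l
    using \<Phi>(2)[OF that(1) key_in[OF a that(1)]] \<Psi>a[OF that] by simp
  \<comment> \<open>The diagonal of \<open>G\<close> is \<open>\<Psi>\<close>, so undoing
    \<open>\<Psi>\<close> makes \<open>v\<close> idempotent. Either way of putting \<open>c\<close>
    against \<open>a j\<close> fills more positions than \<open>P\<close> has, and maximality makes
    the value repair.\<close>
  define G where "G = (\<lambda>l x y. F l (\<lambda>q. if q \<in> P then (a(j := \<gamma> q)) l else if q = k then x else y))"
  define v where "v = (\<lambda>l x y. \<Phi> l (G l x y))"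
  have \<gamma>R: "a(j := \<gamma> q) \<in> R" if "q \<in> P" for q using CD[OF \<gamma>[OF that]] .
  have "pol2 v" unfolding pol2_def
  proof (intro conjI allI impI ballI)
    fix l x y assume l: "l < n" "x \<in> A l" "y \<in> A l"
    have "G l x y \<in> A l" unfolding G_def
      by (rule F_in[OF l(1)]) (use l R_in[OF \<gamma>R l(1)] in auto)
    then show "v l x y \<in> A l" unfolding v_def using vf_in[OF \<Phi>(1) l(1)] by blast
  next
    fix l x assume l: "l < n" "x \<in> A l"
    have "G l x x = \<Psi> l x" unfolding G_def \<Psi>_def by (rule F_cong[OF l(1)]) auto
    then show "v l x x = x" unfolding v_def using \<Phi>(2)[OF l] by simp
  next
    fix s t assume st: "s \<in> R" "t \<in> R"
    have "(\<lambda>l. F l (\<lambda>q. (if q \<in> P then a(j := \<gamma> q) else if q = k then s else t) l)) \<in> R"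
      by (rule F_R) (use \<gamma>R st in auto)
    moreover have "(\<lambda>l. F l (\<lambda>q. (if q \<in> P then a(j := \<gamma> q) else if q = k then s else t) l)) =
        (\<lambda>l. G l (s l) (t l))"
      unfolding G_def by (intro ext arg_cong[where f = "F _"]) auto
    ultimately have "(\<lambda>l. G l (s l) (t l)) \<in> R" by simp
    then show "(\<lambda>l. v l (s l) (t l)) \<in> R" unfolding v_def by (rule vf_R[OF \<Phi>(1)])
  qed
  moreover have "two_sided v a j" unfolding two_sided_def
  proof (intro ballI conjI)
    fix c assume c: "c \<in> C a j"
    have "G j (a j) c = F j (\<lambda>q. if q \<in> {..<m} - {k} then (if q \<in> P then \<gamma> q else c) else a j)"
      unfolding G_def by (rule F_cong[OF j]) (use k in auto)
    also have "\<dots> \<in> C a j" by (rule big) (use \<gamma> c cardP k in auto)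
    finally have "G j (a j) c \<in> C a j" .
    then show "v j (a j) c \<in> C a j" unfolding v_def by (rule C_vf[OF \<Phi>(1) _ \<Phi>a])
    have "G j c (a j) = F j (\<lambda>q. if q \<in> insert k P then (\<gamma>(k := c)) q else a j)"
      unfolding G_def by (rule F_cong[OF j]) (use k in auto)
    also have "\<dots> \<in> C a j" by (rule big) (use sub k finP \<gamma> c in auto)
    finally have "G j c (a j) \<in> C a j" .
    then show "v j c (a j) \<in> C a j" unfolding v_def by (rule C_vf[OF \<Phi>(1) _ \<Phi>a])
  qed
  ultimately show ?thesis using that by blast
qed

lemma two_sided_opr:
  assumes a: "key a" and j: "j < n" and nl: "\<not> lin a j" and id: "\<And>x. x \<in> A j \<Longrightarrow> opr j (a j) x = x"
  shows "two_sided (\<lambda>i x y. opr i y x) a j"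
  unfolding two_sided_def
proof (intro ballI conjI)
  fix c assume c: "c \<in> C a j"
  have "F j ((\<lambda>_. c)(0 := a j)) \<in> C a j" by (rule not_linD[OF nl m_pos c])
  then show "opr j c (a j) \<in> C a j" by (simp add: opr_def)
  show "opr j (a j) c \<in> C a j" using id[OF C_in_A[OF c j]] c by simp
qed

text \<open>Take \<open>u\<close> two-sided at as many coordinates as possible. Where it is not, a
  failure on one side only could be improved, so it fails on both; this leaves one repairing element
  and makes the substitutions permutations. Two such coordinates turn \<open>u\<close> into a
  quasigroup around \<open>a\<close>, which excludes a square there, so the pattern puts both into
  the class.\<close>

lemma two_sided_structure_no_lin:
  assumes a: "key a" and nl: "\<And>i. i < n \<Longrightarrow> \<not> lin a i"
  obtains u where "pol2 u" "\<And>i. i < n \<Longrightarrow> \<not> two_sided u a i \<Longrightarrow> \<exists>c. C a i = {c}"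
    "\<And>i j. i < n \<Longrightarrow> j < n \<Longrightarrow> i \<noteq> j \<Longrightarrow> \<not> two_sided u a i \<Longrightarrow> \<not> two_sided u a j \<Longrightarrow>
      i < r \<and> j < r \<and> (\<forall>l<n. inj_on (\<lambda>x. u l x (a l)) (A l))"
proof -
  define f where "f = (\<lambda>u. card {j. j < n \<and> two_sided u a j})"
  have "f u < Suc n" for u
    using card_mono[of "{..<n}" "{j. j < n \<and> two_sided u a j}"] by (auto simp: f_def less_Suc_eq_le)
  then obtain u where u: "pol2 u" and max: "\<And>w. pol2 w \<Longrightarrow> f w \<le> f u"
    using ex_has_greatest_nat[of pol2 "\<lambda>i x y. x" f "Suc n"] pol2_proj1 by blast
  have no_improve: False
    if "i < n" "\<not> two_sided u a i" "pol2 w" "two_sided w a i" "\<And>j. two_sided u a j \<Longrightarrow> two_sided w a j"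
    for i w
  proof -
    have "{j. j < n \<and> two_sided u a j} \<subset> {j. j < n \<and> two_sided w a j}" using that by blast
    then have "f u < f w" unfolding f_def by (intro psubset_card_mono) auto
    then show False using max[OF that(3)] by simp
  qed
  have swap: "two_sided (\<lambda>i x y. u i y x) a j \<longleftrightarrow> two_sided u a j" for j
    by (auto simp: two_sided_def)
  have bad: "\<exists>c. C a i = {c} \<and> u i (a i) c \<notin> C a i \<and> u i c (a i) \<notin> C a i"
    if i: "i < n" and ns: "\<not> two_sided u a i" for i
  proof -
    obtain v where v: "pol2 v" "two_sided v a i" using two_sided_exists[OF a i nl[OF i]] by blast
    have "\<exists>c\<in>C a i. u i (a i) c \<notin> C a i"
    proof (rule ccontr)
      assume "\<not> ?thesis"
      then obtain w where "pol2 w" "two_sided w a i" "\<And>j. two_sided u a j \<Longrightarrow> two_sided w a j"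
        using two_sided_improve[OF u v(1) a v(2)] by metis
      then show False using no_improve[OF i ns] by blast
    qed
    then obtain c where c: "c \<in> C a i" "u i (a i) c \<notin> C a i" by blast
    have "\<exists>c\<in>C a i. u i c (a i) \<notin> C a i"
    proof (rule ccontr)
      assume "\<not> ?thesis"
      then obtain w where "pol2 w" "two_sided w a i" "\<And>j. two_sided u a j \<Longrightarrow> two_sided w a j"
        using two_sided_improve[OF pol2_swap[OF u] v(1) a v(2)] swap by metis
      then show False using no_improve[OF i ns] by blast
    qed
    then obtain c' where c': "c' \<in> C a i" "u i c' (a i) \<notin> C a i" by blast
    have "C a i = {c}" by (rule both_sides_bad[OF u a i c(1) c'(1) c(2) c'(2)])
    then show ?thesis using c c' by auto
  qed
  show ?thesis
  proof (rule that[OF u])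
    fix i assume "i < n" "\<not> two_sided u a i"
    then show "\<exists>c. C a i = {c}" using bad by blast
  next
    fix i j assume ij: "i < n" "j < n" "i \<noteq> j" and ns: "\<not> two_sided u a i" "\<not> two_sided u a j"
    obtain c where c: "C a i = {c}" "u i (a i) c \<notin> C a i" "u i c (a i) \<notin> C a i"
      using bad[OF ij(1) ns(1)] by blast
    obtain d where d: "C a j = {d}" "u j (a j) d \<notin> C a j" "u j d (a j) \<notin> C a j"
      using bad[OF ij(2) ns(2)] by blast
    have cC: "c \<in> C a i" and dC: "d \<in> C a j" using c d by auto
    note u' = pol2_swap[OF u]
    note ic = pol2_inj[OF u a ij(1) cC c(2)] and ic' = pol2_inj[OF u' a ij(1) cC c(3)]
      and id = pol2_inj[OF u a ij(2) dC d(2)] and id' = pol2_inj[OF u' a ij(2) dC d(3)]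
    have inj: "inj_on (\<lambda>x. u l x (a l)) (A l)" if "l < n" for l
      using ic(2) id(2) that ij(3) by (cases "l = i") auto
    have inj': "inj_on (\<lambda>x. u l (a l) x) (A l)" if "l < n" for l
      using ic'(2) id'(2) that ij(3) by (cases "l = i") auto
    have "a(i := c, j := d) \<notin> R"
      by (rule pol2_maltsev_square[OF u a ij cC dC inj inj' ic(1) ic'(1) id(1) id'(1)])
    moreover have "c' = c \<and> d' = d" if "square i j a c' d'" for c' d'
      using that c(1) d(1) by (auto simp: square_def C_def)
    ultimately have "\<not> (\<exists>c d. square i j a c d)" by (auto simp: square_def)
    then have "\<not> (\<exists>x c d. square i j x c d)" using square_at_key[OF a _ ij(3)] by blast
    then show "i < r \<and> j < r \<and> (\<forall>l<n. inj_on (\<lambda>x. u l x (a l)) (A l))"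
      using pattern_square[OF ij] inj by blast
  qed
qed

text \<open>If some coordinate is linear, \<open>opr\<close> with swapped arguments already serves:
  \<open>opr j (a j)\<close> is the identity off that coordinate, so only linear coordinates can
  fail to be two-sided, and any two of them share the class.\<close>

lemma two_sided_structure:
  assumes a: "key a"
  obtains u where "pol2 u" "\<And>i. i < n \<Longrightarrow> \<not> two_sided u a i \<Longrightarrow> \<exists>c. C a i = {c}"
    "\<And>i j. i < n \<Longrightarrow> j < n \<Longrightarrow> i \<noteq> j \<Longrightarrow> \<not> two_sided u a i \<Longrightarrow> \<not> two_sided u a j \<Longrightarrow>
      i < r \<and> j < r \<and> (\<forall>l<n. inj_on (\<lambda>x. u l x (a l)) (A l))"
proof (cases "\<exists>i<n. lin a i")
  case False
  then show ?thesis using two_sided_structure_no_lin[OF a] that by blast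
next
  case True
  then obtain i where i: "i < n" "lin a i" by blast
  let ?u = "\<lambda>i x y. opr i y x"
  have id: "opr j (a j) x = x" if "j < n" "j \<noteq> i" "x \<in> A j" for j x
    using lin_props[OF a i] that by metis
  have two: "two_sided ?u a j" if "j < n" "j \<noteq> i" "\<not> lin a j" for j
    using two_sided_opr[OF a that(1,3)] id[OF that(1,2)] by blast
  have bad_lin: "lin a j" if "j < n" "\<not> two_sided ?u a j" for j
    using two that i by blast
  show ?thesis
  proof (rule that[OF pol2_swap[OF opr_pol2]])
    fix j assume "j < n" "\<not> two_sided ?u a j"
    then show "\<exists>c. C a j = {c}" using lin_props[OF a _ bad_lin] by metis
  next
    fix j k assume jk: "j < n" "k < n" "j \<noteq> k" and ns: "\<not> two_sided ?u a j" "\<not> two_sided ?u a k"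
    have lin: "lin a j" "lin a k" using bad_lin jk ns by auto
    have "opr l (a l) x = x" if "l < n" "x \<in> A l" for l x
      using lin_props[OF a jk(1) lin(1)] lin_props[OF a jk(2) lin(2)] that jk(3) by metis
    then show "j < r \<and> k < r \<and> (\<forall>l<n. inj_on (\<lambda>x. opr l (a l) x) (A l))"
      using lin_pair[OF a jk lin] by (auto simp: inj_on_def)
  qed
qed

end

section \<open>Classes of at most two coordinates\<close>

definition override :: "(nat \<Rightarrow> 'a) \<Rightarrow> (nat \<Rightarrow> 'a) \<Rightarrow> nat set \<Rightarrow> nat \<Rightarrow> 'a" where
  "override a b J = (\<lambda>j. if j \<in> J then b j else a j)"

context core_relation
begin

text \<open>Single repairs are joined by \<open>l\<close>, which keeps \<open>b j\<close> when it
  meets \<open>a j\<close> on either side.\<close>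

lemma semilattice_box:
  assumes l: "pol2 l" and a: "key a" and J: "finite J" "J \<noteq> {}"
    and b: "\<And>j. j \<in> J \<Longrightarrow> b j \<in> C a j" "\<And>j. j \<in> J \<Longrightarrow> l j (a j) (b j) = b j"
      "\<And>j. j \<in> J \<Longrightarrow> l j (b j) (a j) = b j"
  shows "override a b J \<in> R"
  using J b
proof (induction J rule: finite_ne_induct)
  case (singleton j)
  show ?case by (rule R_cong[OF CD[OF singleton(1)]]) (auto simp: override_def)
next
  case (insert j J)
  have "override a b J \<in> R" using insert by blast
  from pol2_R[OF l this CD[OF insert.prems(1)[of j]]]
  have "(\<lambda>i. l i (override a b J i) ((a(j := b j)) i)) \<in> R" by blast
  then show ?case
    by (rule R_cong)
      (use insert.hyps insert.prems pol2_idem[OF l] key_in[OF a] in \<open>auto simp: override_def\<close>)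
qed

text \<open>Substituting \<open>override a b J\<close> as second argument of \<open>l\<close> sends
  \<open>a\<close> into the relation, hence every key tuple too; by \<open>id\<close> it changes
  nothing outside \<open>J\<close>.\<close>

lemma override_absorb:
  assumes l: "pol2 l" and a: "key a" and id: "\<And>j x. j < n \<Longrightarrow> x \<in> A j \<Longrightarrow> l j x (a j) = x"
    and J: "override a b J \<in> R" "\<And>j. j \<in> J \<Longrightarrow> j < n \<Longrightarrow> l j (a j) (b j) = b j"
    and x: "x \<in> R \<or> key x" "\<And>j. j \<in> J \<Longrightarrow> j < n \<Longrightarrow> x j = a j"
  shows "override x b J \<in> R"
proof -
  define \<Psi> where "\<Psi> = (\<lambda>j z. l j z (override a b J j))"
  have \<Psi>: "vf \<Psi>" unfolding \<Psi>_def by (rule vf_pol2_left[OF l J(1)])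
  have "(\<lambda>j. \<Psi> j (a j)) \<in> R" unfolding \<Psi>_def
    by (rule R_cong[OF J(1)]) (use J(2) pol2_idem[OF l] key_in[OF a] in \<open>auto simp: override_def\<close>)
  then have "(\<lambda>j. \<Psi> j (x j)) \<in> R" using x(1) key_absorb[OF a \<Psi>] vf_R[OF \<Psi>] by blast
  then show ?thesis
  proof (rule R_cong)
    fix j assume j: "j < n"
    have "x j \<in> A j" using x(1) R_in key_in j by blast
    then show "\<Psi> j (x j) = override x b J j"
      using J(2)[OF _ j] x(2)[OF _ j] id[OF j] by (auto simp: \<Psi>_def override_def)
  qed
qed

end

context core_wnu
begin

text \<open>Rectangularity keeps the tuple outside the relation. A function taking it to
  \<open>a\<close> also keeps \<open>a\<close> outside, again by rectangularity, so it is a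
  permutation and its inverse takes \<open>a\<close> to the tuple.\<close>

lemma key_swap:
  assumes a: "key a" and ij: "i < r" "j < r" "i \<noteq> j" and c: "c \<in> C a i" and d: "d \<in> C a j"
  shows "key (a(i := c, j := d))"
proof -
  let ?y = "a(i := c, j := d)"
  have nn: "i < n" "j < n" using ij r_le by auto
  have aid: "a(i := x, j := a j) = a(i := x)" "a(i := a i, j := x) = a(j := x)" for x
    using ij by (auto simp: fun_upd_idem)
  have aR: "a(i := a i, j := a j) \<notin> R" using key_notR[OF a] by simp
  have notR: "?y \<notin> R"
    using rectangular[OF ij, of a c d "a j" "a i"] CD[OF c] CD[OF d] aR aid by metis
  have T: "?y \<in> T" using T_upd[OF T_upd[OF key_T[OF a]]] C_in_A c d nn by blast
  obtain \<Phi> where \<Phi>: "vf \<Phi>" "\<And>l. l < n \<Longrightarrow> \<Phi> l (?y l) = a l"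
    by (rule key_reach[OF a T notR]) (rule that)
  have "\<Phi> l (a l) = a l" if "l < n" "l \<noteq> i" "l \<noteq> j" for l
    using \<Phi>(2)[OF that(1)] that by simp
  then have \<Phi>v: "\<Phi> i c = a i" "\<Phi> j d = a j" "\<And>l. l < n \<Longrightarrow> l \<noteq> i \<Longrightarrow> l \<noteq> j \<Longrightarrow> \<Phi> l (a l) = a l"
    using \<Phi>(2)[OF nn(1)] \<Phi>(2)[OF nn(2)] ij(3) by auto
  have "a(i := a i, j := \<Phi> j (a j)) \<in> R"
    by (rule R_cong[OF vf_R[OF \<Phi>(1) CD[OF c]]]) (use \<Phi>v ij in auto)
  moreover have "a(i := \<Phi> i (a i), j := a j) \<in> R"
    by (rule R_cong[OF vf_R[OF \<Phi>(1) CD[OF d]]]) (use \<Phi>v ij in auto)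
  ultimately have "a(i := \<Phi> i (a i), j := \<Phi> j (a j)) \<notin> R"
    using rectangular[OF ij, of a "\<Phi> i (a i)" "\<Phi> j (a j)" "a j" "a i"] aR by blast
  then have "(\<lambda>l. \<Phi> l (a l)) \<notin> R"
    by (subst R_cong_iff[of _ "a(i := \<Phi> i (a i), j := \<Phi> j (a j))"]) (use \<Phi>v in auto)
  then have inj: "inj_on (\<Phi> l) (A l)" if "l < n" for l
    using key_image_inj[OF a \<Phi>(1) _ that] by blast
  obtain \<Theta> where \<Theta>: "vf \<Theta>" "\<And>l x. l < n \<Longrightarrow> x \<in> A l \<Longrightarrow> \<Theta> l (\<Phi> l x) = x"
    by (rule vf_inverse[OF \<Phi>(1) inj], assumption, rule that)
  have \<Theta>a: "\<Theta> l (a l) = ?y l" if "l < n" for l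
    using \<Theta>(2)[OF that T_in[OF T that]] \<Phi>(2)[OF that] by simp
  then have "(\<lambda>l. \<Theta> l (a l)) \<notin> R" using R_cong_iff[of "\<lambda>l. \<Theta> l (a l)" ?y] notR by blast
  from key_cong[OF key_image[OF a \<Theta>(1) this] \<Theta>a] show ?thesis by blast
qed

text \<open>The repairs must be compatible with each other, so they are chosen together. Sets
  containing both entries of a class of two are excluded because replacing exactly these two gives a
  key tuple again.\<close>

lemma small_class_override:
  assumes a: "key a" and r2: "r \<le> 2"
  obtains b where "\<And>j. j < n \<Longrightarrow> b j \<in> C a j"
    "\<And>J. J \<subseteq> {..<n} \<Longrightarrow> J \<noteq> {} \<Longrightarrow> \<not> (r = 2 \<and> {0, 1} \<subseteq> J) \<Longrightarrow> override a b J \<in> R"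
proof -
  obtain u where u: "pol2 u" and single: "\<And>i. i < n \<Longrightarrow> \<not> two_sided u a i \<Longrightarrow> \<exists>c. C a i = {c}"
    and two: "\<And>i j. i < n \<Longrightarrow> j < n \<Longrightarrow> i \<noteq> j \<Longrightarrow> \<not> two_sided u a i \<Longrightarrow> \<not> two_sided u a j \<Longrightarrow>
      i < r \<and> j < r \<and> (\<forall>l<n. inj_on (\<lambda>x. u l x (a l)) (A l))"
    by (rule two_sided_structure[OF a]) (rule that)
  obtain l w where l: "pol2 l" and w: "pol2 w"
    and wC: "\<And>j c. j < n \<Longrightarrow> two_sided u a j \<Longrightarrow> c \<in> C a j \<Longrightarrow> w j (a j) c \<in> C a j"
    and lw1: "\<And>j c. j < n \<Longrightarrow> two_sided u a j \<Longrightarrow> c \<in> C a j \<Longrightarrow> l j (a j) (w j (a j) c) = w j (a j) c"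
    and lw2: "\<And>j c. j < n \<Longrightarrow> two_sided u a j \<Longrightarrow> c \<in> C a j \<Longrightarrow> l j (w j (a j) c) (a j) = w j (a j) c"
    and l_id: "\<And>j x. j < n \<Longrightarrow> inj_on (\<lambda>x. u j x (a j)) (A j) \<Longrightarrow> x \<in> A j \<Longrightarrow> l j x (a j) = x"
    by (rule semilattice_term[OF u a]) (rule that)
  have box: "override a b J \<in> R"
    if J: "J \<subseteq> {..<n}" "J \<noteq> {}" "\<And>j. j \<in> J \<Longrightarrow> two_sided u a j \<and> (\<exists>c\<in>C a j. b j = w j (a j) c)" for b J
  proof (rule semilattice_box[OF l a])
    show "finite J" using J(1) finite_subset by blast
    show "J \<noteq> {}" by fact
    fix j assume j: "j \<in> J"
    then have jn: "j < n" using J(1) by auto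
    obtain c where c: "two_sided u a j" "c \<in> C a j" "b j = w j (a j) c" using J(3)[OF j] by blast
    show "b j \<in> C a j" "l j (a j) (b j) = b j" "l j (b j) (a j) = b j"
      unfolding c(3) using wC[OF jn c(1,2)] lw1[OF jn c(1,2)] lw2[OF jn c(1,2)] by blast+
  qed
  have "\<forall>j<n. \<exists>c. c \<in> C a j" using C_nonempty[OF a] by metis
  then obtain c where c: "\<And>j. j < n \<Longrightarrow> c j \<in> C a j" by metis
  consider (none) "\<And>j. j < n \<Longrightarrow> two_sided u a j"
    | (one) i where "i < n" "\<not> two_sided u a i" "\<And>j. j < n \<Longrightarrow> j \<noteq> i \<Longrightarrow> two_sided u a j"
    | (more) i j where "i < n" "j < n" "i \<noteq> j" "\<not> two_sided u a i" "\<not> two_sided u a j"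
    by blast
  then show ?thesis
  proof cases
    case none
    show ?thesis
    proof (rule that)
      fix j assume "j < n"
      then show "w j (a j) (c j) \<in> C a j" using wC none c by blast
    next
      fix J assume "J \<subseteq> {..<n}" "J \<noteq> {}"
      then show "override a (\<lambda>j. w j (a j) (c j)) J \<in> R"
        using none c by (intro box) blast+
    qed
  next
    case (one i)
    obtain ci where ci: "C a i = {ci}" using single[OF one(1,2)] by blast
    \<comment> \<open>At \<open>i\<close> the repair \<open>ci\<close> is forced, so the others are
      chosen compatible with it: a square at \<open>a\<close> provides \<open>d\<close>, unless
      \<open>j\<close> shares the class of \<open>i\<close>.\<close>
    have "\<exists>d. d \<in> C a j \<and> (\<not> (i < r \<and> j < r) \<longrightarrow> a(i := ci, j := d) \<in> R)" if j: "j < n" "j \<noteq> i" for j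
    proof (cases "i < r \<and> j < r")
      case False
      then obtain c' d where "square i j a c' d"
        using pattern_square[OF one(1) j(1)] square_at_key[OF a] j by metis
      then show ?thesis using ci by (auto simp: square_def C_def)
    qed (use c j in auto)
    then obtain d where d: "\<And>j. j < n \<Longrightarrow> j \<noteq> i \<Longrightarrow> d j \<in> C a j"
      "\<And>j. j < n \<Longrightarrow> j \<noteq> i \<Longrightarrow> \<not> (i < r \<and> j < r) \<Longrightarrow> a(i := ci, j := d j) \<in> R" by metis
    define b where "b = (\<lambda>j. if j = i then ci else w j (a j) (d j))"
    have ciA: "ci \<in> A i" using ci C_in_A[of ci a i] one by auto
    have bj: "b j = w j (a j) (d j)" if "j \<noteq> i" for j using that by (simp add: b_def)
    have bC: "b j \<in> C a j" if "j < n" for j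
      using that wC[OF that one(3)] d(1) ci by (cases "j = i") (auto simp: b_def)
    have ciR: "a(i := ci) \<in> R" using ci CD[of ci a i] by auto
    \<comment> \<open>Applying \<open>w\<close> to \<open>a(i := ci)\<close> and the corner of the
      square turns \<open>d j\<close> into the semilattice element \<open>b j\<close> while
      \<open>ci\<close> stays.\<close>
    have pair: "a(i := ci, j := b j) \<in> R" if j: "j < n" "j \<noteq> i" "\<not> (i < r \<and> j < r)" for j
      by (rule R_cong[OF pol2_R[OF w ciR d(2)[OF j]]])
        (use j bj pol2_idem[OF w] ciA key_in[OF a] in auto)
    have with_i: "override a b (insert i J) \<in> R"
      if "finite J" "\<And>j. j \<in> J \<Longrightarrow> j < n \<and> j \<noteq> i \<and> \<not> (i < r \<and> j < r)" for J
      using that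
    proof (induction J rule: finite_induct)
      case empty
      show ?case by (rule R_cong[OF ciR]) (auto simp: override_def b_def)
    next
      case (insert j J)
      have j: "j < n" "j \<noteq> i" "\<not> (i < r \<and> j < r)" using insert.prems by auto
      have "override a b (insert i J) \<in> R" using insert by blast
      from pol2_R[OF l this pair[OF j]]
      have "(\<lambda>k. l k (override a b (insert i J) k) ((a(i := ci, j := b j)) k)) \<in> R" .
      then show ?case
      proof (rule R_cong)
        fix k assume k: "k < n"
        have lk: "l k (a k) (b k) = b k" "l k (b k) (a k) = b k" if "k \<noteq> i"
          using lw1[OF k one(3)[OF k that] d(1)[OF k that]] lw2[OF k one(3)[OF k that] d(1)[OF k that]]
            bj[OF that] by auto
        show "l k (override a b (insert i J) k) ((a(i := ci, j := b j)) k) = override a b (insert i (insert j J)) k"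
        proof (cases "k = i")
          case True
          then show ?thesis using pol2_idem[OF l one(1) ciA] j by (simp add: override_def b_def)
        next
          case False
          then show ?thesis using lk[OF False] j insert.hyps pol2_idem[OF l k key_in[OF a k]]
            by (cases "k = j") (auto simp: override_def)
        qed
      qed
    qed
    show ?thesis
    proof (rule that[of b, OF bC])
      fix J assume J: "J \<subseteq> {..<n}" "J \<noteq> {}" "\<not> (r = 2 \<and> {0, 1} \<subseteq> J)"
      show "override a b J \<in> R"
      proof (cases "i \<in> J")
        case False
        have "two_sided u a j \<and> (\<exists>c\<in>C a j. b j = w j (a j) c)" if "j \<in> J" for j
        proof -
          have "j < n" "j \<noteq> i" using that J(1) False by auto
          then show ?thesis using one(3) d(1) bj by blast
        qed
        then show ?thesis by (rule box[OF J(1,2)])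
      next
        case True
        have "override a b (insert i (J - {i})) \<in> R"
        proof (rule with_i)
          show "finite (J - {i})" using J(1) finite_subset by blast
          fix j assume j: "j \<in> J - {i}"
          have "\<not> (i < r \<and> j < r)"
          proof
            assume "i < r \<and> j < r"
            then have r: "r = 2" and "i = 0 \<and> j = 1 \<or> i = 1 \<and> j = 0" using j r2 by auto
            then have "0 \<in> J" "1 \<in> J" using True j by blast+
            then show False using J(3) r by simp
          qed
          then show "j < n \<and> j \<noteq> i \<and> \<not> (i < r \<and> j < r)" using j J(1) by auto
        qed
        then show ?thesis using True by (simp add: insert_absorb)
      qed
    qed auto
  next
    case (more i j)
    have ijr: "i < r" "j < r" and inj: "\<And>l. l < n \<Longrightarrow> inj_on (\<lambda>x. u l x (a l)) (A l)"
      using two[OF more] by auto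
    have r_eq: "r = 2" using ijr r2 more(3) by auto
    have ts: "two_sided u a k" if k: "k < n" "2 \<le> k" for k
    proof (rule ccontr)
      assume "\<not> ?thesis"
      then have "k < r" using two[OF more(1) k(1) _ more(4)] k ijr r2 by fastforce
      then show False using k r2 by simp
    qed
    \<comment> \<open>The two bad coordinates are \<open>0\<close> and \<open>1\<close>. Their
      repairs are arbitrary: compatibility with the rest comes from \<open>override_absorb\<close>,
      available because \<open>u\<close> is injective in its first argument against
      \<open>a\<close>.\<close>
    define b where "b = (\<lambda>k. if k < 2 then c k else w k (a k) (c k))"
    have bC: "b k \<in> C a k" if "k < n" for k
      using wC[OF that ts[OF that]] c[OF that] by (auto simp: b_def)
    show ?thesis
    proof (rule that[of b, OF bC])
      fix J assume J: "J \<subseteq> {..<n}" "J \<noteq> {}" "\<not> (r = 2 \<and> {0, 1} \<subseteq> J)"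
      define J1 where "J1 = J \<inter> {0, 1}"
      define J2 where "J2 = J \<inter> {2..}"
      have J12: "J = J1 \<union> J2" by (auto simp: J1_def J2_def)
      have J1_single: "J1 = {} \<or> (\<exists>k<n. J1 = {k})"
      proof -
        have "J1 = {} \<or> J1 = {0} \<or> J1 = {1}" using J(3) r_eq by (auto simp: J1_def)
        then show ?thesis using n_ge by (metis One_nat_def Suc_lessD Suc_le_lessD numeral_3_eq_3)
      qed
      have single_R: "override a b {k} \<in> R" if "k < n" for k
        by (rule R_cong[OF CD[OF bC[OF that]]]) (auto simp: override_def)
      show "override a b J \<in> R"
      proof (cases "J2 = {}")
        case True
        then show ?thesis using J1_single J(2) J12 single_R by auto
      next
        case False
        have J2_two: "two_sided u a k \<and> (\<exists>c\<in>C a k. b k = w k (a k) c)" if "k \<in> J2" for k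
        proof -
          have "k < n" "2 \<le> k" using that J(1) by (auto simp: J2_def)
          then show ?thesis using ts c by (auto simp: b_def)
        qed
        have "override (override a b J1) b J2 \<in> R"
        proof (rule override_absorb[OF l a l_id[OF _ inj]])
          show "override a b J2 \<in> R" using J(1) J2_two by (intro box False) (auto simp: J2_def)
          show "l k (a k) (b k) = b k" if "k \<in> J2" "k < n" for k
            using J2_two[OF that(1)] lw1[OF that(2)] by metis
          show "override a b J1 \<in> R \<or> key (override a b J1)"
            using J1_single single_R a by (auto simp: override_def)
          show "override a b J1 k = a k" if "k \<in> J2" for k
            using that by (auto simp: override_def J1_def J2_def)
        qed auto
        then show ?thesis by (rule R_cong) (auto simp: override_def J12)
      qed
    qed auto
  qed
qed

text \<open>The goal in terms of functional tuples, with \<open>R\<close> in place of \<rho>;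
  residues modulo \<open>p\<close> are represented by the integers from \<open>0\<close> to
  \<open>p - 1\<close>.\<close>

definition linear_box :: "(nat \<Rightarrow> 'a) \<Rightarrow> (nat \<Rightarrow> 'a set) \<Rightarrow> nat \<Rightarrow> (nat \<Rightarrow> 'a \<Rightarrow> int) \<Rightarrow> (nat \<Rightarrow> 'a) \<Rightarrow> bool" where
  "linear_box a B p \<phi> b \<longleftrightarrow> (\<forall>i<n. B i \<subseteq> A i) \<and> prime p
     \<and> (\<forall>i<r. bij_betw (\<phi> i) (B i) {0..<int p})
     \<and> (\<forall>i\<in>{r..<n}. b i \<in> A i \<and> b i \<noteq> a i \<and> B i = {a i, b i})
     \<and> (\<forall>i<n. a i \<in> B i)
     \<and> (\<forall>x. (\<forall>i<n. x i \<in> B i) \<longrightarrow>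
          (x \<in> R \<longleftrightarrow> (\<Sum>i<r. \<phi> i (x i)) mod int p = 0 \<or> (\<exists>i\<in>{r..<n}. x i = b i))
          \<and> (x \<notin> R \<longrightarrow> key x))"

lemma small_class_linear_box:
  assumes a: "key a" and r2: "r \<le> 2"
  shows "\<exists>B p \<phi> b. linear_box a B p \<phi> b"
proof -
  obtain b where bC: "\<And>j. j < n \<Longrightarrow> b j \<in> C a j"
    and bJ: "\<And>J. J \<subseteq> {..<n} \<Longrightarrow> J \<noteq> {} \<Longrightarrow> \<not> (r = 2 \<and> {0, 1} \<subseteq> J) \<Longrightarrow> override a b J \<in> R"
    by (rule small_class_override[OF a r2]) (rule that)
  \<comment> \<open>The labels are reversed at coordinate \<open>0\<close>, so that \<open>a\<close>
    has sum one. For \<open>r = 2\<close> the sum is even exactly if one of the two class entries is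
    replaced, for \<open>r = 1\<close> exactly if the only one is.\<close>
  define \<phi> where "\<phi> = (\<lambda>i x. if i = 0 then (if x = a 0 then 1 else 0) else (if x = a i then 0 else 1 :: int))"
  define B where "B = (\<lambda>i. {a i, b i})"
  have bA: "b j \<in> A j" if "j < n" for j using C_in_A[OF bC[OF that] that] .
  have ba: "b j \<noteq> a j" if "j < n" for j using bC[OF that] C_neq[OF a, of j] by metis
  have r12: "r = 1 \<or> r = 2" using r2 r_pos by auto
  have int2: "{0..<2::int} = {0, 1}" by auto
  have bij: "bij_betw (\<phi> i) (B i) {0..<int 2}" if "i < r" for i
    using ba[of i] that r_le int2 by (auto simp: bij_betw_def inj_on_def B_def \<phi>_def)
  have main: "(x \<in> R \<longleftrightarrow> (\<Sum>i<r. \<phi> i (x i)) mod int 2 = 0 \<or> (\<exists>i\<in>{r..<n}. x i = b i)) \<and> (x \<notin> R \<longrightarrow> key x)"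
    if x: "\<And>i. i < n \<Longrightarrow> x i \<in> B i" for x
  proof -
    define J where "J = {i. i < n \<and> x i = b i}"
    have Jn: "J \<subseteq> {..<n}" by (auto simp: J_def)
    have xJ: "override a b J i = x i" if "i < n" for i
      using x[OF that] that by (auto simp: override_def J_def B_def)
    have xR: "x \<in> R" if "override a b J \<in> R" by (rule R_cong[OF that xJ])
    have xa: "x i = a i \<longleftrightarrow> i \<notin> J" if "i < n" for i
      using x[OF that] ba[OF that] that by (auto simp: J_def B_def)
    have empty: "x \<notin> R \<and> key x" if "J = {}"
    proof -
      have "key x" by (rule key_cong[OF a]) (use xa that in auto)
      then show ?thesis using key_notR by blast
    qed
    have n0: "0 < n" "1 < n" using n_ge by auto
    show ?thesis
    proof (cases "r = 1")
      case True
      have sum: "(\<Sum>i<r. \<phi> i (x i)) = (if 0 \<in> J then 0 else 1)" using True xa[OF n0(1)] by (simp add: \<phi>_def)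
      show ?thesis
      proof (cases "J = {}")
        case True
        then show ?thesis using empty sum by (auto simp: J_def)
      next
        case False
        then have "x \<in> R" using xR bJ[OF Jn False] \<open>r = 1\<close> by simp
        moreover obtain i where "i \<in> J" using False by blast
        ultimately show ?thesis using sum \<open>r = 1\<close> by (cases "i = 0") (auto simp: J_def)
      qed
    next
      case False
      then have r: "r = 2" using r12 by simp
      have "{..<2::nat} = {0, 1}" by auto
      then have sum: "(\<Sum>i<r. \<phi> i (x i)) = (if 0 \<in> J then 0 else 1) + (if 1 \<in> J then 1 else 0)"
        using r xa[OF n0(1)] xa[OF n0(2)] by (simp add: \<phi>_def)
      have J2: "(\<exists>i\<in>{r..<n}. x i = b i) \<longleftrightarrow> \<not> J \<subseteq> {0, 1}"
      proof -
        have "(\<exists>i\<in>{r..<n}. x i = b i) \<longleftrightarrow> (\<exists>i\<in>J. 2 \<le> i)" by (auto simp: J_def r)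
        also have "\<dots> \<longleftrightarrow> \<not> J \<subseteq> {0, 1}" 
        proof -
          have "2 \<le> i \<longleftrightarrow> i \<notin> {0, 1}" for i :: nat by auto
          then show ?thesis by blast
        qed
        finally show ?thesis .
      qed
      show ?thesis
      proof (cases "J \<subseteq> {0, 1}")
        case False
        have "x \<in> R"
        proof (cases "{0, 1} \<subseteq> J")
          case True
          obtain k where k: "k \<in> J" "k \<noteq> 0" "k \<noteq> 1" using False by blast
          have ov: "override a b J' \<in> R" if "J' \<subseteq> J" "J' \<noteq> {}" "\<not> {0, 1} \<subseteq> J'" for J'
            using bJ[of J'] that Jn by auto
          let ?y = "override a b (J - {0, 1})"
          \<comment> \<open>The choice of \<open>b\<close> says nothing about sets with both class
            entries. As a further entry is replaced, the three smaller sets are covered, and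
            rectangularity supplies the fourth corner.\<close>
          have "?y(0 := b 0, 1 := b 1) \<in> R"
          proof (rule rectangular[of 0 1 ?y "a 0" "a 1" "b 1" "b 0"])
            show "?y(0 := a 0, 1 := a 1) \<in> R"
              by (rule R_cong[OF ov[of "J - {0, 1}"]]) (use k in \<open>auto simp: override_def\<close>)
            show "?y(0 := a 0, 1 := b 1) \<in> R"
              by (rule R_cong[OF ov[of "J - {0}"]]) (use k True in \<open>auto simp: override_def\<close>)
            show "?y(0 := b 0, 1 := a 1) \<in> R"
              by (rule R_cong[OF ov[of "J - {1}"]]) (use k True in \<open>auto simp: override_def\<close>)
          qed (use r in auto)
          moreover have "(?y(0 := b 0, 1 := b 1)) i = x i" if "i < n" for i
            using xJ[OF that] True by (auto simp: override_def)
          ultimately show ?thesis by (rule R_cong)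
        next
          case nb: False
          show ?thesis by (rule xR, rule bJ[OF Jn]) (use nb False in auto)
        qed
        then show ?thesis using J2 False by blast
      next
        case True
        then consider "J = {}" | "J = {0}" | "J = {1}" | "J = {0, 1}" by blast
        then show ?thesis
        proof cases
          case 1
          then show ?thesis using empty sum J2 by simp
        next
          case 2
          then have "x \<in> R" using xR bJ[OF Jn] by auto
          then show ?thesis using 2 sum by simp
        next
          case 3
          then have "x \<in> R" using xR bJ[OF Jn] by auto
          then show ?thesis using 3 sum by simp
        next
          case 4
          have "key (a(0 := b 0, 1 := b 1))" using key_swap[OF a _ _ _ bC[of 0] bC[of 1]] r n0 by simp
          moreover have "(a(0 := b 0, 1 := b 1)) i = x i" if "i < n" for i
            using xJ[OF that] 4 by (auto simp: override_def)
          ultimately have "key x" by (rule key_cong)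
          then show ?thesis using 4 sum J2 key_notR by simp
        qed
      qed
    qed
  qed
  have "linear_box a B 2 \<phi> b"
    unfolding linear_box_def using bij main bA ba key_in[OF a] r_le by (auto simp: B_def)
  then show ?thesis by blast
qed

end

section \<open>The cyclic group of a class of at least three coordinates\<close>

locale linear_class = core_wnu +
  fixes a b :: "nat \<Rightarrow> 'a"
  assumes a: "key a" and r3: "3 \<le> r" and bC: "i < n \<Longrightarrow> b i \<in> C a i"
begin

text \<open>Elements \<open>c\<close> for which \<open>opr i c\<close> is known to be the identity;
  all multiples of the unit will turn out to be among them.\<close>

definition key_values :: "nat \<Rightarrow> 'a set" where
  "key_values i = {x i |x. key x}"

definition zero :: "nat \<Rightarrow> 'a" where
  "zero = a(0 := b 0)"

text \<open>Chosen so that changing \<open>zero\<close> to \<open>unit\<close> at one coordinate of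
  the class gives a key tuple; at \<open>0\<close> this tuple is \<open>a\<close> itself.\<close>

definition unit :: "nat \<Rightarrow> 'a" where
  "unit = (\<lambda>j. if j = 0 then a 0 else b j)"

text \<open>Addition of the affine structure with origin \<open>zero\<close>; as the origin is in
  the relation, this binary operation preserves it.\<close>

definition add :: "nat \<Rightarrow> 'a \<Rightarrow> 'a \<Rightarrow> 'a" where
  "add j x y = F j (\<lambda>q. if q = 0 then x else if q = 1 then y else zero j)"

definition mul :: "nat \<Rightarrow> nat \<Rightarrow> 'a \<Rightarrow> 'a" where
  "mul j k x = ((\<lambda>z. add j z x) ^^ k) (zero j)"

definition E :: "nat \<Rightarrow> nat \<Rightarrow> 'a" where
  "E j k = mul j k (unit j)"

definition tup :: "(nat \<Rightarrow> nat) \<Rightarrow> nat \<Rightarrow> 'a" where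
  "tup \<kappa> = (\<lambda>j. if j < r then E j (\<kappa> j) else a j)"

lemma n0: "0 < n" "1 < n" "2 < n" and r0: "0 < r" "1 < r" "2 < r" using r3 r_le by auto

lemma bA: "i < n \<Longrightarrow> b i \<in> A i" using C_in_A[OF bC] .

lemma ba: "i < n \<Longrightarrow> b i \<noteq> a i" using bC[of i] C_neq[OF a, of i] by metis

lemma aA: "i < n \<Longrightarrow> a i \<in> A i" using key_in[OF a] .

lemma key_valuesI: "key x \<Longrightarrow> x i \<in> key_values i" by (auto simp: key_values_def)

lemma key_values_A: "c \<in> key_values i \<Longrightarrow> i < n \<Longrightarrow> c \<in> A i"
  using key_in by (auto simp: key_values_def)

lemma opr_key_values: "c \<in> key_values i \<Longrightarrow> i < n \<Longrightarrow> x \<in> A i \<Longrightarrow> opr i c x = x"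
  using opr_key_id[OF _ r3] by (auto simp: key_values_def)

lemma a_key_values: "a i \<in> key_values i" using key_valuesI[OF a] .

lemma b_key_values:
  assumes "i < r"
  shows "b i \<in> key_values i"
proof -
  obtain j where j: "j < r" "j \<noteq> i" using r0 by (metis zero_neq_one)
  have "key (a(i := b i, j := b j))"
    using key_swap[OF a assms j(1)] j bC r_le assms by auto
  from key_valuesI[OF this, of i] show ?thesis using j by simp
qed

lemma zero_key_values: "zero i \<in> key_values i"
  using a_key_values b_key_values[OF r0(1)] by (auto simp: zero_def)

lemma zero_A: "i < n \<Longrightarrow> zero i \<in> A i" using key_values_A[OF zero_key_values] .

lemma zero_R: "zero \<in> R" unfolding zero_def using CD[OF bC[OF n0(1)]] .

lemma unit_A: "i < n \<Longrightarrow> unit i \<in> A i" using aA bA by (auto simp: unit_def)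

text \<open>The operation applied to \<open>u(i := d)\<close>, \<open>v(i := c)\<close> and copies
  of \<open>u(i := c)\<close> changes the entry \<open>c\<close> of an arbitrary \<open>v\<close> to
  \<open>d\<close>, so \<open>collapse\<close> applies. It needs a key tuple whose entry at
  \<open>i\<close> is not \<open>c\<close>: either \<open>a\<close> or one with entry
  \<open>b i\<close>.\<close>

lemma R_unique:
  assumes i: "i < r" and c: "c \<in> key_values i" and u: "\<And>j. j < n \<Longrightarrow> j \<noteq> i \<Longrightarrow> u j \<in> key_values j"
    and R: "u(i := c) \<in> R" "u(i := d) \<in> R"
  shows "c = d"
proof -
  have iN: "i < n" using i r_le by simp
  have dA: "d \<in> A i" using R_in[OF R(2) iN] by simp
  have cA: "c \<in> A i" using key_values_A[OF c iN] .
  obtain b' where b': "key b'" "b' i = b i"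
    using b_key_values[OF i] by (auto simp: key_values_def)
  obtain a' where a': "key a'" "a' i \<noteq> c"
    using a b' ba[OF iN] by metis
  show ?thesis
  proof (rule collapse[OF a'(1) iN dA cA a'(2)])
    fix v assume v: "v(i := c) \<in> R"
    define t where "t = (\<lambda>q::nat. if q = 0 then u(i := d) else if q = 1 then v(i := c) else u(i := c))"
    have "(\<lambda>j. F j (\<lambda>q. t q j)) \<in> R" by (rule F_R) (use v R in \<open>simp add: t_def\<close>)
    then show "v(i := d) \<in> R"
    proof (rule R_cong)
      fix j assume j: "j < n"
      show "F j (\<lambda>q. t q j) = (v(i := d)) j"
      proof (cases "j = i")
        case True
        have "F i (\<lambda>q. t q i) = opr i c d"
          by (rule F_opr[OF iN cA dA m_pos]) (auto simp: t_def)
        then show ?thesis using True opr_key_values[OF c iN dA] by simp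
      next
        case False
        have uj: "u j \<in> key_values j" using u[OF j False] .
        have vj: "v j \<in> A j" using R_in[OF v j] False by simp
        have "F j (\<lambda>q. t q j) = opr j (u j) (v j)"
          by (rule F_opr[OF j key_values_A[OF uj j] vj, of 1]) (use m_ge False in \<open>auto simp: t_def\<close>)
        then show ?thesis using False opr_key_values[OF uj j vj] by simp
      qed
    qed
  qed
qed

lemma R_unique_tuple:
  assumes i: "i < r" and x: "x \<in> R" "\<And>j. j < n \<Longrightarrow> x j \<in> key_values j"
    and y: "y \<in> R" "\<And>j. j < n \<Longrightarrow> j \<noteq> i \<Longrightarrow> y j = x j"
  shows "y i = x i"
proof -
  have "x(i := y i) \<in> R" by (rule R_cong[OF y(1)]) (use y(2) in auto)
  from R_unique[OF i x(2) x(2) _ this] show ?thesis using x(1) i r_le by simp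
qed

lemma add_in: "j < n \<Longrightarrow> x \<in> A j \<Longrightarrow> y \<in> A j \<Longrightarrow> add j x y \<in> A j"
  unfolding add_def using zero_A by (intro F_in) auto

lemma add_R:
  assumes "s \<in> R" "t \<in> R"
  shows "(\<lambda>j. add j (s j) (t j)) \<in> R"
proof -
  have "(\<lambda>j. F j (\<lambda>q. (if q = 0 then s else if q = 1 then t else zero) j)) \<in> R"
    by (rule F_R) (use assms zero_R in auto)
  then show ?thesis unfolding add_def by (rule R_cong) (rule arg_cong[where f = "F _"], auto)
qed

lemma add_zero_right: 
  assumes "j < n" "x \<in> A j"
  shows "add j x (zero j) = x"
proof -
  have "add j x (zero j) = opr j (zero j) x" unfolding add_def
    by (rule F_opr[OF assms(1) zero_A[OF assms(1)] assms(2) m_pos]) auto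
  then show ?thesis using opr_key_values[OF zero_key_values assms] by simp
qed

lemma add_zero_left: 
  assumes "j < n" "x \<in> A j"
  shows "add j (zero j) x = x"
proof -
  have "add j (zero j) x = opr j (zero j) x" unfolding add_def
    by (rule F_opr[OF assms(1) zero_A[OF assms(1)] assms(2), of 1]) (use m_ge in auto)
  then show ?thesis using opr_key_values[OF zero_key_values assms] by simp
qed

lemma mul_0 [simp]: "mul j 0 x = zero j" by (simp add: mul_def)

lemma mul_Suc [simp]: "mul j (Suc k) x = add j (mul j k x) x" by (simp add: mul_def)

lemma mul_in: "j < n \<Longrightarrow> x \<in> A j \<Longrightarrow> mul j k x \<in> A j"
  by (induction k) (auto simp: zero_A add_in)

lemma mul_zero: "j < n \<Longrightarrow> mul j k (zero j) = zero j"
  by (induction k) (auto simp: zero_A add_zero_left)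

lemma vf_mul: "vf (\<lambda>j. mul j k)"
  unfolding vf_def
proof (intro conjI allI impI ballI)
  show "(\<lambda>j. mul j k (x j)) \<in> R" if "x \<in> R" for x
  proof (induction k)
    case 0
    then show ?case using zero_R by simp
  next
    case (Suc k)
    from add_R[OF Suc that] show ?case by simp
  qed
qed (simp add: mul_in)

lemma E_0 [simp]: "E j 0 = zero j" by (simp add: E_def)

lemma E_Suc: "E j (Suc k) = add j (E j k) (unit j)" by (simp add: E_def)

lemma E_in: "j < n \<Longrightarrow> E j k \<in> A j" unfolding E_def using mul_in unit_A by blast

lemma E_1: "j < n \<Longrightarrow> E j 1 = unit j" by (simp add: E_def add_zero_left unit_A)

lemma unit_key:
  assumes "j < r"
  shows "key (zero(j := unit j))"
proof (cases "j = 0")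
  case True
  then show ?thesis using a by (simp add: zero_def unit_def)
next
  case False
  have "key (a(0 := b 0, j := b j))"
    using key_swap[OF a r0(1) assms] False bC n0 assms r_le by auto
  then show ?thesis using False by (simp add: zero_def unit_def)
qed

lemma E_zero:
  assumes "j < r" "zero(j := E j k) \<in> R"
  shows "E j k = zero j"
  using R_unique[OF assms(1) zero_key_values zero_key_values _ assms(2)] zero_R by simp

lemma mul_unit:
  assumes "i < n"
  shows "mul i k ((zero(j := unit j)) i) = (zero(j := E j k)) i"
  using assms by (simp add: E_def mul_zero)

text \<open>Multiplication by \<open>k\<close> sends the key tuple \<open>zero(j := unit j)\<close>
  either into the relation, where uniqueness makes the multiple zero, or to another key
  tuple.\<close>

lemma E_key_values:
  assumes "j < r"
  shows "E j k \<in> key_values j"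
proof (cases "zero(j := E j k) \<in> R")
  case True
  then show ?thesis using E_zero[OF assms] zero_key_values by metis
next
  case False
  then have "(\<lambda>i. mul i k ((zero(j := unit j)) i)) \<notin> R"
    by (subst R_cong_iff[OF mul_unit])
  from key_cong[OF key_image[OF unit_key[OF assms] vf_mul this] mul_unit]
  have "key (zero(j := E j k))" .
  from key_valuesI[OF this, of j] show ?thesis by simp
qed

lemma tup_key_values: "tup \<kappa> j \<in> key_values j"
  by (auto simp: tup_def E_key_values a_key_values)

text \<open>The tuple \<open>a(j := b j)\<close> has the unit at \<open>0\<close> and at
  \<open>j\<close> and zero elsewhere. Adding such tuples to the origin reaches every tuple in
  question.\<close>

lemma tup_R:
  assumes "\<kappa> 0 = sum \<kappa> {1..<r}"
  shows "tup \<kappa> \<in> R"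
  using assms
proof (induction "sum \<kappa> {1..<r}" arbitrary: \<kappa>)
  case 0
  then have "\<kappa> j = 0" if "j < r" for j using that by (cases "j = 0") auto
  then show ?case using zero_R by (elim R_cong) (use r0 in \<open>auto simp: tup_def zero_def\<close>)
next
  case (Suc s)
  have "sum \<kappa> {1..<r} \<noteq> 0" using Suc.hyps(2) by linarith
  then obtain j where j: "j \<in> {1..<r}" "\<kappa> j \<noteq> 0" by (meson sum.neutral)
  obtain h where h: "\<kappa> j = Suc h" using j(2) not0_implies_Suc by blast
  define \<kappa>' where "\<kappa>' = \<kappa>(j := h, 0 := s)"
  have "sum \<kappa>' {1..<r} = sum (\<kappa>(j := h)) {1..<r}" by (rule sum.cong) (auto simp: \<kappa>'_def)
  also have "\<dots> = h + sum \<kappa> ({1..<r} - {j})" using j by (subst sum.remove[of _ j]) (auto intro!: sum.cong)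
  finally have "Suc (sum \<kappa>' {1..<r}) = sum \<kappa> {1..<r}"
    using j h sum.remove[of "{1..<r}" j \<kappa>] by simp
  then have s: "s = sum \<kappa>' {1..<r}" using Suc.hyps(2) by simp
  have "tup \<kappa>' \<in> R" by (rule Suc.hyps(1)[OF s]) (rule trans[OF _ s], simp add: \<kappa>'_def)
  moreover have "a(j := b j) \<in> R" using CD[OF bC] j r_le by simp
  ultimately have "(\<lambda>i. add i (tup \<kappa>' i) ((a(j := b j)) i)) \<in> R" by (rule add_R)
  then show ?case
  proof (rule R_cong)
    fix i assume i: "i < n"
    have z: "a i = zero i" if "i \<noteq> 0" using that by (simp add: zero_def)
    consider "i = 0" | "i = j" "i \<noteq> 0" | "i \<noteq> 0" "i \<noteq> j" by blast
    then show "add i (tup \<kappa>' i) ((a(j := b j)) i) = tup \<kappa> i"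
    proof cases
      case 1
      then show ?thesis using j Suc.hyps(2) Suc.prems r0 by (simp add: tup_def \<kappa>'_def E_Suc[symmetric] unit_def[symmetric])
        (metis E_Suc unit_def)
    next
      case 2
      then show ?thesis using j h by (simp add: tup_def \<kappa>'_def E_Suc unit_def)
    next
      case 3
      then have "tup \<kappa>' i = tup \<kappa> i" by (simp add: tup_def \<kappa>'_def)
      then show ?thesis using 3 z add_zero_right[OF i] key_values_A[OF tup_key_values i] by simp
    qed
  qed
qed

lemma tup_R_iff: "tup \<kappa> \<in> R \<longleftrightarrow> E 0 (\<kappa> 0) = E 0 (sum \<kappa> {1..<r})"
proof -
  let ?\<kappa> = "\<kappa>(0 := sum \<kappa> {1..<r})"
  have R: "tup ?\<kappa> \<in> R" by (rule tup_R) (auto intro!: sum.cong)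
  have eq: "tup ?\<kappa> j = tup \<kappa> j" if "j \<noteq> 0" for j using that by (simp add: tup_def)
  show ?thesis
  proof
    assume "tup \<kappa> \<in> R"
    from R_unique_tuple[OF r0(1) R tup_key_values this] show "E 0 (\<kappa> 0) = E 0 (sum \<kappa> {1..<r})"
      using r0 by (simp add: tup_def)
  next
    assume "E 0 (\<kappa> 0) = E 0 (sum \<kappa> {1..<r})"
    then show "tup \<kappa> \<in> R" using R by (elim R_cong) (auto simp: tup_def)
  qed
qed

text \<open>Arithmetic of multiples is read off from tuples that are nonzero only on three coordinates;
  this is where \<open>r \<ge> 3\<close> enters.\<close>

definition tri :: "nat \<Rightarrow> nat \<Rightarrow> nat \<Rightarrow> nat \<Rightarrow> 'a" where
  "tri x y z = tup (\<lambda>j. if j = 0 then x else if j = 1 then y else if j = 2 then z else 0)"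

lemma tri_R_iff: "tri x y z \<in> R \<longleftrightarrow> E 0 x = E 0 (y + z)"
proof -
  let ?\<kappa> = "\<lambda>j. if j = 0 then x else if j = 1 then y else if j = 2 then z else 0 :: nat"
  have "sum ?\<kappa> {1..<r} = sum ?\<kappa> {1, 2 :: nat}"
    by (rule sum.mono_neutral_right) (use r0 in auto)
  then have "sum ?\<kappa> {1..<r} = y + z" by simp
  then show ?thesis unfolding tri_def tup_R_iff by simp
qed

lemma tri_simps [simp]:
  "tri x y z 0 = E 0 x" "tri x y z (Suc 0) = E 1 y" "tri x y z 2 = E 2 z"
  "j \<noteq> 0 \<Longrightarrow> j \<noteq> 1 \<Longrightarrow> j \<noteq> 2 \<Longrightarrow> tri x y z j = zero j"
  using r0 by (auto simp: tri_def tup_def zero_def)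

lemma tri_key_values: "tri x y z j \<in> key_values j"
  unfolding tri_def by (rule tup_key_values)

lemma tri_cong:
  assumes "i \<noteq> 0 \<Longrightarrow> E 0 x = E 0 x'" "i \<noteq> 1 \<Longrightarrow> E 1 y = E 1 y'" "i \<noteq> 2 \<Longrightarrow> E 2 z = E 2 z'" "j \<noteq> i"
  shows "tri x y z j = tri x' y' z' j"
proof -
  consider "j = 0" | "j = 1" | "j = 2" | "j \<noteq> 0" "j \<noteq> 1" "j \<noteq> 2" by blast
  then show ?thesis using assms by cases auto
qed

lemma tri_cong_all:
  "E 0 x = E 0 x' \<Longrightarrow> E 1 y = E 1 y' \<Longrightarrow> E 2 z = E 2 z' \<Longrightarrow> tri x y z j = tri x' y' z' j"
  by (rule tri_cong[of "Suc j"]) auto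

text \<open>With equal entries at \<open>0\<close> and \<open>1\<close>, the sums
  \<open>k + (l - k)\<close> and \<open>k + 0\<close> have equal last summands by uniqueness at
  coordinate \<open>2\<close>; a two-coordinate tuple brings this back to coordinate
  \<open>0\<close>.\<close>

lemma E_diff:
  assumes "E 0 k = E 0 l" "k \<le> l"
  shows "E 0 (l - k) = zero 0"
proof -
  have "tri l k (l - k) \<in> R" "tri k k 0 \<in> R" using assms by (auto simp: tri_R_iff)
  from R_unique_tuple[OF r0(3) this(2) tri_key_values this(1)] have "E 2 (l - k) = zero 2"
    using tri_cong[of 2 l k k k "l - k" 0] assms by simp
  moreover have "tri (l - k) 0 (l - k) \<in> R" by (simp add: tri_R_iff)
  ultimately have "tri (l - k) 0 0 \<in> R"
    by (elim R_cong) (rule tri_cong_all; simp)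
  then show ?thesis by (simp add: tri_R_iff)
qed

lemma E_add_period:
  assumes "E 0 p = zero 0"
  shows "E 0 (k + p) = E 0 k"
proof -
  have "tri p 0 p \<in> R" "tri 0 0 0 \<in> R" by (auto simp: tri_R_iff)
  from R_unique_tuple[OF r0(3) this(2) tri_key_values this(1)] have 2: "E 2 p = zero 2"
    using tri_cong[of 2 p 0 0 0 p 0] assms by simp
  have "tri (k + p) k p \<in> R" by (simp add: tri_R_iff)
  then have "tri (k + p) k 0 \<in> R" by (rule R_cong) (rule tri_cong_all; simp add: 2)
  then show ?thesis by (simp add: tri_R_iff)
qed

lemma E_add: "add 0 (E 0 k) (E 0 l) = E 0 (k + l)"
proof -
  have "tri k k 0 \<in> R" "tri l 0 l \<in> R" by (auto simp: tri_R_iff)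
  from add_R[OF this] have R: "(\<lambda>j. add j (tri k k 0 j) (tri l 0 l j)) \<in> R" .
  have R': "tri (k + l) k l \<in> R" by (simp add: tri_R_iff)
  have "add 0 (tri k k 0 0) (tri l 0 l 0) = tri (k + l) k l 0"
  proof (rule R_unique_tuple[OF r0(1) R' tri_key_values R])
    fix j assume j: "j < n" "j \<noteq> 0"
    consider "j = 1" | "j = 2" | "j \<noteq> 1" "j \<noteq> 2" by blast
    then show "add j (tri k k 0 j) (tri l 0 l j) = tri (k + l) k l j"
      by cases (use j in \<open>auto simp: add_zero_right add_zero_left E_in n0 zero_A\<close>)
  qed
  then show ?thesis by simp
qed

text \<open>The inductive step first moves the hypothesis to coordinate \<open>1\<close>. The tuple
  with entries \<open>l + 1\<close>, \<open>l\<close>, \<open>1\<close> then acts as the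
  distributive law.\<close>

lemma mul_E: "mul 0 k (E 0 l) = E 0 (k * l)"
proof (induction l)
  case 0
  then show ?case using mul_zero n0 by simp
next
  case (Suc l)
  have "tri l l 0 \<in> R" by (simp add: tri_R_iff)
  from vf_R[OF vf_mul this] have R: "(\<lambda>j. mul j k (tri l l 0 j)) \<in> R" .
  have R': "tri (k * l) (k * l) 0 \<in> R" by (simp add: tri_R_iff)
  have "mul 1 k (tri l l 0 1) = tri (k * l) (k * l) 0 1"
  proof (rule R_unique_tuple[OF r0(2) R' tri_key_values R])
    fix j assume j: "j < n" "j \<noteq> 1"
    consider "j = 0" | "j = 2" | "j \<noteq> 0" "j \<noteq> 2" by blast
    then show "mul j k (tri l l 0 j) = tri (k * l) (k * l) 0 j"
      by cases (use j Suc.IH in \<open>auto simp: mul_zero\<close>)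
  qed
  then have 1: "mul 1 k (E 1 l) = E 1 (k * l)" by simp
  have "tri (Suc l) l 1 \<in> R" by (simp add: tri_R_iff)
  from vf_R[OF vf_mul this] have R: "(\<lambda>j. mul j k (tri (Suc l) l 1 j)) \<in> R" .
  have R': "tri (k * l + k) (k * l) k \<in> R" by (simp add: tri_R_iff)
  have 2: "mul 2 k (E 2 1) = E 2 k" using E_1[OF n0(3)] by (simp add: E_def)
  have "mul 0 k (tri (Suc l) l 1 0) = tri (k * l + k) (k * l) k 0"
  proof (rule R_unique_tuple[OF r0(1) R' tri_key_values R])
    fix j assume j: "j < n" "j \<noteq> 0"
    consider "j = 1" | "j = 2" | "j \<noteq> 1" "j \<noteq> 2" by blast
    then show "mul j k (tri (Suc l) l 1 j) = tri (k * l + k) (k * l) k j"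
      by cases (use j 1 2 in \<open>auto simp: mul_zero\<close>)
  qed
  then show ?case by (simp add: add.commute)
qed

text \<open>Tuples that are nonzero only at \<open>0\<close> and \<open>j\<close> identify the
  multiples at these two coordinates.\<close>

lemma E_eq_iff_0:
  assumes j: "j < r"
  shows "E j k = E j l \<longleftrightarrow> E 0 k = E 0 l"
proof (cases "j = 0")
  case False
  define \<kappa> where "\<kappa> = (\<lambda>x y i. if i = 0 then x else if i = j then y else 0 :: nat)"
  have sum: "sum (\<kappa> x y) {1..<r} = y" for x y
  proof -
    have "sum (\<kappa> x y) {1..<r} = sum (\<kappa> x y) {j}"
      by (rule sum.mono_neutral_right) (use j False in \<open>auto simp: \<kappa>_def\<close>)
    then show ?thesis using False by (simp add: \<kappa>_def)
  qed
  have R: "tup (\<kappa> x y) \<in> R \<longleftrightarrow> E 0 x = E 0 y" for x y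
    unfolding tup_R_iff sum by (simp add: \<kappa>_def)
  show ?thesis
  proof
    assume eq: "E j k = E j l"
    have "tup (\<kappa> k k) \<in> R" by (simp add: R)
    then have "tup (\<kappa> k l) \<in> R" by (rule R_cong) (use eq in \<open>auto simp: tup_def \<kappa>_def\<close>)
    then show "E 0 k = E 0 l" by (simp add: R)
  next
    assume "E 0 k = E 0 l"
    then have "tup (\<kappa> k l) \<in> R" "tup (\<kappa> k k) \<in> R" by (auto simp: R)
    from R_unique_tuple[OF j this(1) tup_key_values this(2)] show "E j k = E j l"
      using False j by (auto simp: tup_def \<kappa>_def)
  qed
qed simp

section \<open>The order of the group and the box\<close>

definition p :: nat where
  "p = (LEAST p. 0 < p \<and> E 0 p = zero 0)"

lemma p_pos: "0 < p" and E_p: "E 0 p = zero 0"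
  and p_least: "0 < q \<Longrightarrow> q < p \<Longrightarrow> E 0 q \<noteq> zero 0"
proof -
  have "\<not> inj (E 0)"
  proof
    assume "inj (E 0)"
    moreover have "range (E 0) \<subseteq> A 0" using E_in n0 by auto
    ultimately show False using finite_A[OF n0(1)] by (meson finite_imageD finite_subset infinite_UNIV_nat)
  qed
  then obtain k l where "k < l" "E 0 k = E 0 l"
    unfolding inj_def by (metis linorder_neqE_nat)
  then have "0 < l - k \<and> E 0 (l - k) = zero 0" using E_diff[of k l] by simp
  then have "0 < p \<and> E 0 p = zero 0" unfolding p_def by (rule LeastI)
  then show "0 < p" "E 0 p = zero 0" by auto
  show "E 0 q \<noteq> zero 0" if "0 < q" "q < p"
    using not_less_Least[of q "\<lambda>p. 0 < p \<and> E 0 p = zero 0"] that unfolding p_def by blast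
qed

lemma E_mod: "E 0 (k mod p) = E 0 k"
proof -
  have "E 0 (x + y * p) = E 0 x" for x y
  proof (induction y)
    case (Suc y)
    have "E 0 (x + Suc y * p) = E 0 ((x + y * p) + p)" by (simp add: algebra_simps)
    then show ?case using E_add_period[OF E_p] Suc by simp
  qed simp
  from this[of "k mod p" "k div p"] show ?thesis by simp
qed

lemma E_eq_iff_dvd:
  assumes "j < r"
  shows "E j k = E j l \<longleftrightarrow> int p dvd int k - int l"
proof -
  have neq: "E 0 x \<noteq> E 0 y" if "x < y" "y < p" for x y
    using E_diff[of x y] p_least[of "y - x"] that by auto
  have "E 0 k = E 0 l \<longleftrightarrow> k mod p = l mod p"
  proof
    assume "E 0 k = E 0 l"
    then have "E 0 (k mod p) = E 0 (l mod p)" by (simp add: E_mod)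
    then show "k mod p = l mod p"
      using neq[of "k mod p" "l mod p"] neq[of "l mod p" "k mod p"] p_pos
      by (metis linorder_neqE_nat mod_less_divisor)
  qed (metis E_mod)
  also have "\<dots> \<longleftrightarrow> int k mod int p = int l mod int p" by (metis of_nat_eq_iff zmod_int)
  also have "\<dots> \<longleftrightarrow> int p dvd int k - int l" by (rule mod_eq_dvd_iff)
  finally show ?thesis using E_eq_iff_0[OF assms] by simp
qed

lemma E_0_1: "E 0 1 = a 0" using E_1[OF n0(1)] by (simp add: unit_def)

lemma prime_p: "prime p"
proof (rule ccontr)
  assume np: "\<not> prime p"
  have "p \<noteq> 1"
  proof
    assume "p = 1"
    then show False using E_p E_0_1 ba[OF n0(1)] by (simp add: zero_def)
  qed
  then have "1 < p" using p_pos by simp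
  then obtain k where k: "k dvd p" "k \<noteq> 1" "k \<noteq> p" using np unfolding prime_nat_iff by blast
  then obtain l where l: "p = k * l" by blast
  then have kl: "p = k * l" "0 < k" "k < p" "0 < l" "l < p" using k p_pos by auto
  have "E 0 k \<noteq> zero 0" using p_least[of k] kl by simp
  then have "zero(0 := E 0 k) \<notin> R" using E_zero[OF r0(1)] by blast
  then have notR: "(\<lambda>i. mul i k ((zero(0 := unit 0)) i)) \<notin> R" by (subst R_cong_iff[OF mul_unit])
  have inj: "inj_on (mul 0 k) (A 0)" by (rule key_image_inj[OF unit_key[OF r0(1)] vf_mul notR n0(1)])
  have "mul 0 k (E 0 l) = mul 0 k (zero 0)" using E_p kl mul_zero n0 by (simp add: mul_E)
  then have "E 0 l = zero 0" by (rule inj_onD[OF inj]) (use E_in zero_A n0 in auto)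
  then show False using p_least[of l] kl by simp
qed

text \<open>The tuple is \<open>s + d * a\<close> for some \<open>s\<close> in the relation. Adding
  \<open>s\<close> and multiplying by \<open>d\<close> preserve the relation, and the image of a key
  tuple is key when it is outside.\<close>

lemma tup_key:
  assumes "tup \<kappa> \<notin> R"
  shows "key (tup \<kappa>)"
proof -
  define S where "S = sum \<kappa> {1..<r}"
  \<comment> \<open>This is \<open>\<kappa> 0 - S\<close> modulo \<open>p\<close>, with
    \<open>p - 1\<close> standing for \<open>-1\<close> among the natural numbers.\<close>
  define d where "d = \<kappa> 0 + (p - 1) * S"
  define s where "s = tup (\<kappa>(0 := S))"
  have s: "s \<in> R" unfolding s_def S_def by (rule tup_R) (auto intro!: sum.cong)
  have "vf (\<lambda>j x. add j (s j) x)"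
    unfolding vf_def using add_R[OF s] add_in R_in[OF s] by auto
  from vf_comp[OF this vf_mul[of d]] have vf: "vf (\<lambda>j x. add j (s j) (mul j d x))" .
  have "S + d = \<kappa> 0 + p * S" using p_pos by (cases p) (auto simp: d_def)
  then have "int (S + d) - int (\<kappa> 0) = int p * int S" by simp
  then have Sd: "E 0 (S + d) = E 0 (\<kappa> 0)" using E_eq_iff_dvd[OF r0(1)] by simp
  have eq: "add j (s j) (mul j d (a j)) = tup \<kappa> j" if j: "j < n" for j
  proof (cases "j = 0")
    case True
    have "mul 0 d (a 0) = E 0 d" by (simp add: E_def unit_def)
    then show ?thesis using True r0 E_add[of S d] Sd by (simp add: s_def tup_def)
  next
    case False
    then have "a j = zero j" by (simp add: zero_def)
    then show ?thesis using False j add_zero_right[OF j] mul_zero[OF j] key_values_A[OF tup_key_values j]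
      by (simp add: s_def tup_def)
  qed
  then have "(\<lambda>j. add j (s j) (mul j d (a j))) \<notin> R"
    using R_cong_iff[of "\<lambda>j. add j (s j) (mul j d (a j))" "tup \<kappa>"] assms by blast
  from key_cong[OF key_image[OF a vf this] eq] show ?thesis .
qed

end

context linear_class
begin

lemma dvd_small_eq:
  assumes "int p dvd int k - int l" "k < p" "l < p"
  shows "k = l"
proof -
  have "int k mod int p = int l mod int p" using assms(1) by (simp add: mod_eq_dvd_iff)
  then show ?thesis using assms by simp
qed

lemma linear_class_box:
  assumes l: "pol2 l" and l_id: "\<And>j x. j < n \<Longrightarrow> x \<in> A j \<Longrightarrow> l j x (a j) = x"
    and lb: "\<And>j. r \<le> j \<Longrightarrow> j < n \<Longrightarrow> l j (a j) (b j) = b j"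
  shows "\<exists>B p \<phi> b. linear_box a B p \<phi> b"
proof -
  \<comment> \<open>Coordinate \<open>0\<close> is negated, with \<open>p - 1\<close> for
    \<open>-1\<close>: equality of entry \<open>0\<close> with the sum of the others becomes a
    vanishing sum.\<close>
  define G where "G = (\<lambda>i k. if i = 0 then E 0 ((p - 1) * k) else E i k)"
  define B where "B = (\<lambda>i. if i < r then G i ` {..<p} else {a i, b i})"
  define \<phi> where "\<phi> = (\<lambda>i x. int (inv_into {..<p} (G i) x))"
  have p1: "1 < p" using prime_p prime_gt_1_nat by blast
  have int_p: "int (p - 1) = int p - 1" using p1 by simp
  have dvd_iff: "int p dvd int ((p - 1) * k) - z \<longleftrightarrow> int p dvd int k + z" for k z
  proof -
    have "int ((p - 1) * k) = (int p - 1) * int k" by (simp only: of_nat_mult int_p)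
    then have e: "int ((p - 1) * k) - z = int p * int k - (int k + z)" by (simp add: algebra_simps)
    show ?thesis unfolding e by (intro dvd_diff_right_iff dvd_triv_left)
  qed
  have G_inj: "inj_on (G i) {..<p}" if i: "i < r" for i
  proof (rule inj_onI)
    fix k h assume kh: "k \<in> {..<p}" "h \<in> {..<p}" "G i k = G i h"
    have "int p dvd int k - int h"
    proof (cases "i = 0")
      case True
      then have "int p dvd int ((p - 1) * k) - int ((p - 1) * h)"
        using kh(3) E_eq_iff_dvd[OF r0(1)] by (simp add: G_def)
      then have "int p dvd int k + int ((p - 1) * h)" by (simp only: dvd_iff)
      then have "int p dvd int ((p - 1) * h) - (- int k)" by (simp add: add.commute)
      then have "int p dvd int h + (- int k)" by (simp only: dvd_iff)
      then show ?thesis by (metis dvd_minus_iff minus_diff_eq uminus_add_conv_diff add.commute)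
    next
      case False
      then show ?thesis using kh(3) E_eq_iff_dvd[OF i] by (simp add: G_def)
    qed
    then show "k = h" using kh dvd_small_eq by auto
  qed
  have bij: "bij_betw (\<phi> i) (B i) {0..<int p}" if i: "i < r" for i
  proof -
    have "bij_betw (inv_into {..<p} (G i)) (B i) {..<p}"
      using G_inj[OF i] i by (intro bij_betw_inv_into) (simp add: bij_betw_def B_def)
    moreover have "bij_betw int {..<p} {0..<int p}"
      using image_int_atLeastLessThan[of 0 p] by (simp add: bij_betw_def lessThan_atLeast0)
    ultimately have "bij_betw (int \<circ> inv_into {..<p} (G i)) (B i) {0..<int p}"
      by (rule bij_betw_trans)
    then show ?thesis by (simp add: \<phi>_def comp_def)
  qed
  have aB: "a i \<in> B i" if "i < n" for i
  proof (cases "i < r")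
    case True
    show ?thesis
    proof (cases "i = 0")
      case True
      \<comment> \<open>Because of the negation, the unit \<open>a 0\<close> has index
        \<open>p - 1\<close> at coordinate \<open>0\<close>.\<close>
      have "int p dvd int ((p - 1) * (p - 1)) - 1" unfolding dvd_iff using p1 by simp
      then have "E 0 ((p - 1) * (p - 1)) = E 0 1" using E_eq_iff_dvd[OF r0(1)] by simp
      then have "a 0 = G 0 (p - 1)" using E_0_1 by (simp add: G_def)
      then show ?thesis using True r0 p1 by (auto simp: B_def)
    next
      case False
      then have "a i = G i 0" by (simp add: G_def zero_def)
      then show ?thesis using True p1 by (auto simp: B_def)
    qed
  qed (simp add: B_def)
  have main: "(x \<in> R \<longleftrightarrow> (\<Sum>i<r. \<phi> i (x i)) mod int p = 0 \<or> (\<exists>i\<in>{r..<n}. x i = b i)) \<and> (x \<notin> R \<longrightarrow> key x)"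
    if x: "\<And>i. i < n \<Longrightarrow> x i \<in> B i" for x
  proof -
    define k where "k = (\<lambda>i. inv_into {..<p} (G i) (x i))"
    define \<kappa> where "\<kappa> = (\<lambda>i. if i = 0 then (p - 1) * k 0 else k i)"
    have xk: "x i = E i (\<kappa> i)" if "i < r" for i
    proof -
      have "x i \<in> G i ` {..<p}" using x[of i] that r_le by (simp add: B_def)
      from f_inv_into_f[OF this] show ?thesis by (simp add: k_def \<kappa>_def G_def split: if_splits)
    qed
    define J where "J = {j\<in>{r..<n}. x j = b j}"
    have xJ: "override (tup \<kappa>) b J i = x i" if "i < n" for i
      using x[OF that] that xk by (auto simp: override_def J_def tup_def B_def)
    show ?thesis
    proof (cases "J = {}")
      case True
      have xt: "tup \<kappa> i = x i" if "i < n" for i using xJ[OF that] True by (simp add: override_def)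
      have "sum \<kappa> {1..<r} = sum k {1..<r}" by (rule sum.cong) (auto simp: \<kappa>_def)
      moreover have "{..<r} = insert 0 {1..<r}" using r0 by auto
      ultimately have sum: "(\<Sum>i<r. \<phi> i (x i)) = int (k 0) + int (sum \<kappa> {1..<r})"
        by (simp add: \<phi>_def k_def)
      have xR: "x \<in> R \<longleftrightarrow> tup \<kappa> \<in> R" by (rule R_cong_iff) (simp add: xt)
      also have "\<dots> \<longleftrightarrow> int p dvd int ((p - 1) * k 0) - int (sum \<kappa> {1..<r})"
        unfolding tup_R_iff E_eq_iff_dvd[OF r0(1)] by (simp add: \<kappa>_def)
      also have "\<dots> \<longleftrightarrow> (\<Sum>i<r. \<phi> i (x i)) mod int p = 0"
        unfolding dvd_iff sum by (simp only: dvd_eq_mod_eq_0)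
      finally have "x \<in> R \<longleftrightarrow> (\<Sum>i<r. \<phi> i (x i)) mod int p = 0" .
      moreover have "\<not> (\<exists>i\<in>{r..<n}. x i = b i)" using True by (auto simp: J_def)
      moreover have "key x" if "x \<notin> R"
        by (rule key_cong[OF tup_key xt]) (use xR that in auto)
      ultimately show ?thesis by simp
    next
      case False
      have Jn: "j < n" "r \<le> j" if "j \<in> J" for j using that by (auto simp: J_def)
      have fin: "finite J" by (simp add: J_def)
      have ov: "override a b J \<in> R"
        by (rule semilattice_box[OF l a fin False]) (use Jn bC lb l_id bA in auto)
      \<comment> \<open>The tuple before replacement is in the relation or key, and absorption on
        \<open>J\<close> puts the result into the relation in both cases.\<close>
      have "override (tup \<kappa>) b J \<in> R"
      proof (rule override_absorb[OF l a l_id ov])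
        show "tup \<kappa> \<in> R \<or> key (tup \<kappa>)" using tup_key by blast
        show "tup \<kappa> j = a j" if "j \<in> J" for j using Jn(2)[OF that] by (simp add: tup_def)
      qed (use Jn lb in auto)
      then have "x \<in> R" by (rule R_cong) (rule xJ)
      moreover have "\<exists>i\<in>{r..<n}. x i = b i" using False by (auto simp: J_def)
      ultimately show ?thesis by blast
    qed
  qed
  have BA: "B i \<subseteq> A i" if "i < n" for i
    using aA[OF that] bA[OF that] E_in[OF that] by (auto simp: B_def G_def)
  have "linear_box a B p \<phi> b"
    unfolding linear_box_def using bij main aB BA prime_p bA ba by (auto simp: B_def)
  then show ?thesis by blast
qed

end

context core_wnu
begin

text \<open>For \<open>r \<ge> 3\<close> the class is linear, hence no other coordinate is, and
  swapped \<open>opr\<close> is two-sided outside the class. As all \<open>opr j (a j)\<close> are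
  identities, its semilattice term satisfies \<open>l j x (a j) = x\<close> everywhere and leaves
  the class untouched.\<close>

theorem linear_box_exists:
  assumes a: "key a"
  shows "\<exists>B p \<phi> b. linear_box a B p \<phi> b"
proof (cases "r \<le> 2")
  case True
  then show ?thesis using small_class_linear_box[OF a] by blast
next
  case False
  then have r3: "3 \<le> r" by simp
  define u where "u = (\<lambda>i x y. opr i y x)"
  have u: "pol2 u" unfolding u_def by (rule pol2_swap[OF opr_pol2])
  have id: "opr j (a j) x = x" if "j < n" "x \<in> A j" for j x using opr_key_id[OF a r3 that] .
  have ts: "two_sided u a j" if j: "r \<le> j" "j < n" for j
    unfolding u_def
  proof (rule two_sided_opr[OF a j(2)])
    show "\<not> lin a j"
    proof
      assume "lin a j"
      then have "j < r" using lin_pair[OF a _ j(2) _ lin_class[OF a r3, of 0]] r3 j by auto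
      then show False using j by simp
    qed
  qed (use id j in auto)
  obtain l w where l: "pol2 l"
    and wC: "\<And>j c. j < n \<Longrightarrow> two_sided u a j \<Longrightarrow> c \<in> C a j \<Longrightarrow> w j (a j) c \<in> C a j"
    and lw: "\<And>j c. j < n \<Longrightarrow> two_sided u a j \<Longrightarrow> c \<in> C a j \<Longrightarrow> l j (a j) (w j (a j) c) = w j (a j) c"
    and l_id: "\<And>j x. j < n \<Longrightarrow> inj_on (\<lambda>x. u j x (a j)) (A j) \<Longrightarrow> x \<in> A j \<Longrightarrow> l j x (a j) = x"
    by (rule semilattice_term[OF u a]) (rule that)
  have "\<forall>j<n. \<exists>c. c \<in> C a j" using C_nonempty[OF a] by metis
  then obtain c where c: "\<And>j. j < n \<Longrightarrow> c j \<in> C a j" by metis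
  define b where "b = (\<lambda>j. if j < r then c j else w j (a j) (c j))"
  interpret linear_class n A R m F r a b
  proof unfold_locales
    fix i assume i: "i < n"
    show "b i \<in> C a i" using c[OF i] wC[OF i ts] i by (auto simp: b_def)
  qed (use a r3 in auto)
  show ?thesis
  proof (rule linear_class_box[OF l])
    fix j x assume "j < n" "x \<in> A j"
    moreover have "inj_on (\<lambda>x. u j x (a j)) (A j)" if "j < n"
      using id[OF that] by (simp add: u_def inj_on_def)
    ultimately show "l j x (a j) = x" using l_id by blast
  next
    fix j assume "r \<le> j" "j < n"
    then show "l j (a j) (b j) = b j" using lw[OF _ ts] c by (simp add: b_def)
  qed
qed

end

section \<open>Reduction to a core\<close>

context tuple_relation
begin

text \<open>Arguments are cut into \<open>m\<close> blocks of length \<open>m'\<close>. A single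
  deviating position lies in one block, so the outer operation sees one deviating value; the induced
  binary operations are composed in their second argument.\<close>

lemma wnu_relation_nest:
  assumes F: "wnu_relation n A R m F" and G: "wnu_relation n A R m' G"
  defines "H \<equiv> (\<lambda>i g. F i (\<lambda>j. G i (\<lambda>q. g (j * m' + q))))"
  shows "wnu_relation n A R (m * m') H"
    "\<And>i x y. i < n \<Longrightarrow> x \<in> A i \<Longrightarrow> y \<in> A i \<Longrightarrow>
      H i ((\<lambda>_. x)(0 := y)) = F i ((\<lambda>_. x)(0 := G i ((\<lambda>_. x)(0 := y))))"
proof -
  interpret F: wnu_relation n A R m F by (rule F)
  interpret G: wnu_relation n A R m' G by (rule G)
  have idx: "j * m' + q < m * m'" if "j < m" "q < m'" for j q
  proof -
    have "j * m' + q < Suc j * m'" using that by simp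
    also have "\<dots> \<le> m * m'" using that by (intro mult_le_mono1) simp
    finally show ?thesis .
  qed
  have single: "H i ((\<lambda>_. x)(k := y)) = F i ((\<lambda>_. x)(0 := G i ((\<lambda>_. x)(0 := y))))"
    if i: "i < n" and x: "x \<in> A i" and y: "y \<in> A i" and k: "k < m * m'" for i x y k
  proof -
    let ?g = "(\<lambda>_. x)(k := y)"
    have kd: "k div m' < m" using k by (simp add: less_mult_imp_div_less)
    have km: "k mod m' < m'" using G.m_ge by simp
    have inner: "G i (\<lambda>q. ?g (j * m' + q)) = ((\<lambda>_. x)(k div m' := G i ((\<lambda>_. x)(0 := y)))) j" for j
    proof (cases "j = k div m'")
      case True
      have "G i (\<lambda>q. ?g (j * m' + q)) = G i ((\<lambda>_. x)(k mod m' := y))"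
      proof (rule G.F_cong[OF i])
        fix q assume "q < m'"
        then have "j * m' + q = k \<longleftrightarrow> q = k mod m'" using True div_mult_mod_eq[of k m'] by (metis add_left_cancel)
        then show "?g (j * m' + q) = ((\<lambda>_. x)(k mod m' := y)) q" by simp
      qed
      then show ?thesis using True G.F_wnu[OF i x y km] by simp
    next
      case False
      have "G i (\<lambda>q. ?g (j * m' + q)) = G i (\<lambda>_. x)"
      proof (rule G.F_cong[OF i])
        fix q assume "q < m'"
        then have "(j * m' + q) div m' = j" by simp
        then have "j * m' + q \<noteq> k" using False by auto
        then show "?g (j * m' + q) = x" by simp
      qed
      then show ?thesis using False G.F_idem[OF i x] by simp
    qed
    have "H i ?g = F i ((\<lambda>_. x)(k div m' := G i ((\<lambda>_. x)(0 := y))))"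
      unfolding H_def by (rule F.F_cong[OF i]) (rule inner)
    also have "\<dots> = F i ((\<lambda>_. x)(0 := G i ((\<lambda>_. x)(0 := y))))"
      using x y by (intro F.F_wnu[OF i x _ kd] G.F_in[OF i]) auto
    finally show ?thesis .
  qed
  have pos: "0 < m * m'" using F.m_ge G.m_ge by simp
  show "H i ((\<lambda>_. x)(0 := y)) = F i ((\<lambda>_. x)(0 := G i ((\<lambda>_. x)(0 := y))))"
    if "i < n" "x \<in> A i" "y \<in> A i" for i x y using single[OF that pos] .
  show "wnu_relation n A R (m * m') H"
  proof unfold_locales
    have "2 * 1 \<le> m * m'" using F.m_ge G.m_ge by (intro mult_le_mono) auto
    then show "2 \<le> m * m'" by simp
  next
    fix i :: nat and g g' :: "nat \<Rightarrow> 'a" assume i: "i < n" and eq: "\<And>k. k < m * m' \<Longrightarrow> g k = g' k"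
    show "H i g = H i g'" unfolding H_def
      by (rule F.F_cong[OF i], rule G.F_cong[OF i], rule eq, rule idx)
  next
    fix i :: nat and g :: "nat \<Rightarrow> 'a" assume i: "i < n" and g: "\<And>k. k < m * m' \<Longrightarrow> g k \<in> A i"
    show "H i g \<in> A i" unfolding H_def
      by (rule F.F_in[OF i], rule G.F_in[OF i], rule g, rule idx)
  next
    fix i x assume "i < n" "x \<in> A i"
    then show "H i (\<lambda>_. x) = x" unfolding H_def by (simp add: F.F_idem G.F_idem)
  next
    fix i x y k assume *: "i < n" "x \<in> A i" "y \<in> A i" "k < m * m'"
    show "H i ((\<lambda>_. x)(k := y)) = H i ((\<lambda>_. x)(0 := y))"
      unfolding single[OF *] single[OF *(1-3) pos] ..
  next
    fix t assume t: "\<And>k. k < m * m' \<Longrightarrow> t k \<in> R"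
    have "(\<lambda>i. G i (\<lambda>q. t (j * m' + q) i)) \<in> R" if "j < m" for j
      by (rule G.F_R, rule t, rule idx[OF that])
    then show "(\<lambda>i. H i (\<lambda>k. t k i)) \<in> R" unfolding H_def by (rule F.F_R)
  qed
qed

text \<open>Nesting \<open>N\<close> copies of \<open>F\<close> replaces \<open>f i x\<close> by its
  \<open>N\<close>-th iterate, which is idempotent.\<close>

lemma wnu_relation_special:
  assumes F: "wnu_relation n A R m F"
  obtains m' F' where "wnu_relation n A R m' F'"
    "\<And>i x y. i < n \<Longrightarrow> x \<in> A i \<Longrightarrow> y \<in> A i \<Longrightarrow>
      F' i ((\<lambda>_. x)(0 := F' i ((\<lambda>_. x)(0 := y)))) = F' i ((\<lambda>_. x)(0 := y))"
proof -
  interpret F: wnu_relation n A R m F by (rule F)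
  define f where "f = (\<lambda>i x y. F i ((\<lambda>_. x)(0 := y)))"
  have f_in: "f i x y \<in> A i" if "i < n" "x \<in> A i" "y \<in> A i" for i x y
    unfolding f_def using that by (intro F.F_in) auto
  have pow_in: "((f i x) ^^ k) y \<in> A i" if "i < n" "x \<in> A i" "y \<in> A i" for i x y k
    by (induction k) (use that f_in in auto)
  have "\<exists>m' F'. wnu_relation n A R m' F' \<and> (\<forall>i<n. \<forall>x\<in>A i. \<forall>y\<in>A i.
      F' i ((\<lambda>_. x)(0 := y)) = ((f i x) ^^ Suc k) y)" for k
  proof (induction k)
    case 0
    show ?case
      by (intro exI[of _ m] exI[of _ F] conjI F ballI allI impI)
        (simp only: f_def funpow.simps o_apply id_apply)
  next
    case (Suc k)
    then obtain m' G where G: "wnu_relation n A R m' G"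
      "\<And>i x y. i < n \<Longrightarrow> x \<in> A i \<Longrightarrow> y \<in> A i \<Longrightarrow> G i ((\<lambda>_. x)(0 := y)) = ((f i x) ^^ Suc k) y" by blast
    let ?H = "\<lambda>i g. F i (\<lambda>j. G i (\<lambda>q. g (j * m' + q)))"
    have "?H i ((\<lambda>_. x)(0 := y)) = ((f i x) ^^ Suc (Suc k)) y" if "i < n" "x \<in> A i" "y \<in> A i" for i x y
      using wnu_relation_nest(2)[OF F G(1) that] G(2)[OF that] by (simp add: f_def)
    then show ?case using wnu_relation_nest(1)[OF F G(1)] by blast
  qed
  moreover obtain N' where N': "N = Suc N'" using N_pos gr0_conv_Suc by auto
  ultimately obtain m' F' where F': "wnu_relation n A R m' F'"
    "\<And>i x y. i < n \<Longrightarrow> x \<in> A i \<Longrightarrow> y \<in> A i \<Longrightarrow> F' i ((\<lambda>_. x)(0 := y)) = ((f i x) ^^ N) y"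
    by metis
  show ?thesis
  proof (rule that[OF F'(1)])
    fix i x y assume *: "i < n" "x \<in> A i" "y \<in> A i"
    show "F' i ((\<lambda>_. x)(0 := F' i ((\<lambda>_. x)(0 := y)))) = F' i ((\<lambda>_. x)(0 := y))"
      unfolding F'(2)[OF *] F'(2)[OF *(1,2) pow_in[OF *]]
      using f_in * by (intro funpow_N_idem) auto
  qed
qed

end

text \<open>\<open>\<Psi>_minimal\<close> is minimality of the image in usable form: no preserving
  function that fixes \<open>a\<close> identifies two of its elements.\<close>

locale core_retract = tuple_relation +
  fixes a :: "nat \<Rightarrow> 'a" and \<Psi> :: "nat \<Rightarrow> 'a \<Rightarrow> 'a"
  assumes a: "key a" and \<Psi>: "vf \<Psi>" and \<Psi>a: "i < n \<Longrightarrow> \<Psi> i (a i) = a i"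
    and \<Psi>_idem: "i < n \<Longrightarrow> x \<in> A i \<Longrightarrow> \<Psi> i (\<Psi> i x) = \<Psi> i x"
    and \<Psi>_minimal: "vf \<Phi> \<Longrightarrow> (\<And>i. i < n \<Longrightarrow> \<Phi> i (a i) = a i) \<Longrightarrow> i < n \<Longrightarrow> inj_on (\<Phi> i) (\<Psi> i ` A i)"
    and essential_tuple: "\<exists>x\<in>T. x \<notin> R \<and> (\<forall>i<n. \<exists>c. x(i := c) \<in> R)"
begin

definition A' :: "nat \<Rightarrow> 'a set" where "A' i = \<Psi> i ` A i"

definition R' :: "(nat \<Rightarrow> 'a) set" where "R' = {x \<in> R. \<forall>i<n. x i \<in> A' i}"

lemma A'_subset: "i < n \<Longrightarrow> A' i \<subseteq> A i" using vf_in[OF \<Psi>] by (auto simp: A'_def)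

lemma \<Psi>_A': "i < n \<Longrightarrow> x \<in> A i \<Longrightarrow> \<Psi> i x \<in> A' i" by (auto simp: A'_def)

lemma \<Psi>_id: "i < n \<Longrightarrow> x \<in> A' i \<Longrightarrow> \<Psi> i x = x" using \<Psi>_idem by (auto simp: A'_def)

sublocale ret: tuple_relation n A' R'
proof unfold_locales
  show "finite (A' i)" if "i < n" for i using finite_A[OF that] by (simp add: A'_def)
  show "x i \<in> A' i" if "x \<in> R'" "i < n" for x i using that by (simp add: R'_def)
  show "y \<in> R'" if "x \<in> R'" "\<And>i. i < n \<Longrightarrow> x i = y i" for x y
    using that R_cong[of x y] by (auto simp: R'_def)
qed

lemma R'_iff: "x \<in> ret.T \<Longrightarrow> x \<in> R' \<longleftrightarrow> x \<in> R" by (auto simp: R'_def ret.T_def)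

lemma ret_T: "x \<in> ret.T \<Longrightarrow> x \<in> T" using A'_subset by (auto simp: ret.T_def T_def)

lemma \<Psi>_R': "x \<in> R \<Longrightarrow> (\<lambda>i. \<Psi> i (x i)) \<in> R'"
  using vf_R[OF \<Psi>] \<Psi>_A' R_in by (auto simp: R'_def)

lemma a_T: "a \<in> T" "a \<notin> R" using a by (auto simp: key_def)

lemma a_ret_T: "a \<in> ret.T" using \<Psi>_A' \<Psi>a a_T by (force simp: ret.T_def T_def)

lemma ret_vf: "vf \<Phi> \<Longrightarrow> ret.vf (\<lambda>i x. \<Psi> i (\<Phi> i x))"
  unfolding ret.vf_def
proof (intro conjI allI impI ballI)
  assume \<Phi>: "vf \<Phi>"
  show "\<Psi> i (\<Phi> i x) \<in> A' i" if "i < n" "x \<in> A' i" for i x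
    using \<Psi>_A' vf_in[OF \<Phi>] A'_subset that by blast
  show "(\<lambda>i. \<Psi> i (\<Phi> i (x i))) \<in> R'" if "x \<in> R'" for x
    by (rule \<Psi>_R', rule vf_R[OF \<Phi>]) (use that in \<open>simp add: R'_def\<close>)
qed

lemma vf_ret: "ret.vf \<Phi> \<Longrightarrow> vf (\<lambda>i x. \<Phi> i (\<Psi> i x))"
  unfolding vf_def
proof (intro conjI allI impI ballI)
  assume \<Phi>: "ret.vf \<Phi>"
  show "\<Phi> i (\<Psi> i x) \<in> A i" if "i < n" "x \<in> A i" for i x
    using ret.vf_in[OF \<Phi> that(1) \<Psi>_A'[OF that]] A'_subset[OF that(1)] by blast
  show "(\<lambda>i. \<Phi> i (\<Psi> i (x i))) \<in> R" if "x \<in> R" for x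
    using ret.vf_R[OF \<Phi> \<Psi>_R'[OF that]] by (simp add: R'_def)
qed

lemma reach_a:
  assumes "x \<in> T" "x \<notin> R"
  obtains \<Phi> where "vf \<Phi>" "ret.vf (\<lambda>i x. \<Psi> i (\<Phi> i x))" "\<And>i. i < n \<Longrightarrow> \<Phi> i (x i) = a i"
  using a assms ret_vf unfolding key_def by blast

lemma ret_key_a: "ret.key a"
  unfolding ret.key_def
proof (intro conjI ballI impI)
  show "a \<in> ret.T" by (rule a_ret_T)
  show "a \<notin> R'" using a_T R'_iff a_ret_T by blast
  fix x assume "x \<in> ret.T" "x \<notin> R'"
  then have "x \<in> T" "x \<notin> R" using R'_iff ret_T by auto
  then obtain \<Phi> where "ret.vf (\<lambda>i x. \<Psi> i (\<Phi> i x))" "\<And>i. i < n \<Longrightarrow> \<Phi> i (x i) = a i"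
    using reach_a by blast
  then show "\<exists>\<Psi>'. ret.vf \<Psi>' \<and> (\<forall>i<n. \<Psi>' i (x i) = a i)"
    using \<Psi>a by (intro exI[of _ "\<lambda>i x. \<Psi> i (\<Phi> i x)"]) simp
qed

text \<open>An outside tuple reaches \<open>a\<close> in the full relation, and a function of the
  retract, preceded by \<open>\<Psi>\<close>, leads on from \<open>a\<close> to
  \<open>x\<close>.\<close>

lemma ret_key:
  assumes "ret.key x"
  shows "key x"
  unfolding key_def
proof (intro conjI ballI impI)
  have x: "x \<in> ret.T" "x \<notin> R'" using assms by (auto simp: ret.key_def)
  show "x \<in> T" using ret_T x by blast
  show "x \<notin> R" using R'_iff x by blast
  fix y assume "y \<in> T" "y \<notin> R"
  then obtain \<Phi> where \<Phi>: "vf \<Phi>" "\<And>i. i < n \<Longrightarrow> \<Phi> i (y i) = a i"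
    using reach_a by blast
  have "a \<notin> R'" using a_T R'_iff a_ret_T by blast
  then obtain \<Theta> where \<Theta>: "ret.vf \<Theta>" "\<And>i. i < n \<Longrightarrow> \<Theta> i (a i) = x i"
    using assms a_ret_T unfolding ret.key_def by blast
  show "\<exists>\<Psi>'. vf \<Psi>' \<and> (\<forall>i<n. \<Psi>' i (y i) = x i)"
    using vf_comp[OF vf_ret[OF \<Theta>(1)] \<Phi>(1)] \<Theta>(2) \<Phi>(2) \<Psi>a
    by (intro exI[of _ "\<lambda>i x. \<Theta> i (\<Psi> i (\<Phi> i x))"]) simp
qed

sublocale ret: core_relation n A' R'
proof unfold_locales
  fix x \<Phi> i assume x: "ret.key x" and \<Phi>: "ret.vf \<Phi>" "\<And>i. i < n \<Longrightarrow> \<Phi> i (x i) = x i" and i: "i < n"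
  obtain \<Theta> where \<Theta>: "ret.vf \<Theta>" "\<And>i. i < n \<Longrightarrow> \<Theta> i (a i) = x i"
    using x ret_key_a unfolding ret.key_def by blast
  obtain \<Theta>' where \<Theta>': "ret.vf \<Theta>'" "\<And>i. i < n \<Longrightarrow> \<Theta>' i (x i) = a i"
    using x ret_key_a unfolding ret.key_def by blast
  \<comment> \<open>Minimality concerns functions fixing \<open>a\<close>, so \<open>\<Phi>\<close>
    is conjugated by functions between \<open>a\<close> and \<open>x\<close>. Injectivity of the
    composite makes \<open>\<Theta>\<close> bijective by finiteness, so \<open>\<Phi>\<close> is
    injective on all of \<open>A' i\<close>.\<close>
  have "vf (\<lambda>i z. \<Theta>' i (\<Phi> i (\<Theta> i (\<Psi> i z))))"
    using vf_ret[OF ret.vf_comp[OF \<Theta>'(1) ret.vf_comp[OF \<Phi>(1) \<Theta>(1)]]] by simp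
  then have "inj_on (\<lambda>z. \<Theta>' i (\<Phi> i (\<Theta> i (\<Psi> i z)))) (\<Psi> i ` A i)"
    using \<Psi>_minimal[of "\<lambda>i z. \<Theta>' i (\<Phi> i (\<Theta> i (\<Psi> i z)))" i] i \<Psi>a \<Theta>(2) \<Theta>'(2) \<Phi>(2) by simp
  then have inj: "inj_on (\<lambda>z. \<Theta>' i (\<Phi> i (\<Theta> i z))) (A' i)"
    using \<Psi>_id[OF i] by (simp add: inj_on_def A'_def[symmetric])
  then have "inj_on (\<Theta> i) (A' i)" by (simp add: inj_on_def)
  then have surj: "\<Theta> i ` A' i = A' i"
    using ret.vf_in[OF \<Theta>(1) i] ret.finite_A[OF i] by (intro endo_inj_surj) auto
  have "inj_on (\<Phi> i) (\<Theta> i ` A' i)"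
    using inj by (auto simp: inj_on_def)
  then show "inj_on (\<Phi> i) (A' i)" by (simp only: surj)
next
  obtain x where x: "x \<in> T" "x \<notin> R" and c: "\<And>i. i < n \<Longrightarrow> \<exists>c. x(i := c) \<in> R"
    using essential_tuple by blast
  obtain \<Phi> where \<Phi>: "ret.vf (\<lambda>i x. \<Psi> i (\<Phi> i x))" "vf \<Phi>" "\<And>i. i < n \<Longrightarrow> \<Phi> i (x i) = a i"
    using reach_a[OF x] by blast
  have "\<exists>c. a(i := c) \<in> R'" if i: "i < n" for i
  proof -
    obtain c where "x(i := c) \<in> R" using c[OF i] by blast
    from \<Psi>_R'[OF vf_R[OF \<Phi>(2) this]] have "a(i := \<Psi> i (\<Phi> i c)) \<in> R'"
      by (rule ret.R_cong) (use \<Phi>(3) \<Psi>a in auto)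
    then show ?thesis by blast
  qed
  then show "\<exists>x\<in>ret.T. x \<notin> R' \<and> (\<forall>i<n. \<exists>c. x(i := c) \<in> R')"
    using a_ret_T a_T R'_iff by blast
qed

text \<open>A square of the full relation is carried to one at \<open>a\<close> inside the retract,
  so the pattern survives the passage to the core.\<close>

lemma ret_square_iff:
  assumes ij: "i < n" "j < n" "i \<noteq> j"
  shows "(\<exists>x c d. ret.square i j x c d) \<longleftrightarrow> (\<exists>x c d. square i j x c d)"
proof
  assume "\<exists>x c d. ret.square i j x c d"
  then obtain x c d where sq: "ret.square i j x c d" by blast
  then have "square i j x c d" using ret_T R'_iff unfolding ret.square_def square_def
    by (auto simp: R'_def)
  then show "\<exists>x c d. square i j x c d" by blast
next
  assume "\<exists>x c d. square i j x c d"
  then obtain x c d where x: "x \<in> T" "x \<notin> R" "x(i := c) \<in> R" "x(j := d) \<in> R" "x(i := c, j := d) \<in> R"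
    by (auto simp: square_def)
  obtain \<Phi> where \<Phi>: "vf \<Phi>" "\<And>i. i < n \<Longrightarrow> \<Phi> i (x i) = a i"
    using reach_a[OF x(1,2)] by blast
  have "a(i := \<Psi> i (\<Phi> i c)) \<in> R'"
    by (rule ret.R_cong[OF \<Psi>_R'[OF vf_R[OF \<Phi>(1) x(3)]]]) (use \<Phi>(2) \<Psi>a in auto)
  moreover have "a(j := \<Psi> j (\<Phi> j d)) \<in> R'"
    by (rule ret.R_cong[OF \<Psi>_R'[OF vf_R[OF \<Phi>(1) x(4)]]]) (use \<Phi>(2) \<Psi>a in auto)
  moreover have "a(i := \<Psi> i (\<Phi> i c), j := \<Psi> j (\<Phi> j d)) \<in> R'"
    by (rule ret.R_cong[OF \<Psi>_R'[OF vf_R[OF \<Phi>(1) x(5)]]]) (use \<Phi>(2) \<Psi>a ij in auto)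
  ultimately have "ret.square i j a (\<Psi> i (\<Phi> i c)) (\<Psi> j (\<Phi> j d))"
    using a_ret_T a_T R'_iff unfolding ret.square_def by blast
  then show "\<exists>x c d. ret.square i j x c d" by blast
qed

lemma ret_wnu:
  assumes "wnu_relation n A R m F"
  shows "wnu_relation n A' R' m (\<lambda>i g. \<Psi> i (F i g))"
proof -
  interpret wnu_relation n A R m F by fact
  show ?thesis
  proof unfold_locales
    show "2 \<le> m" by (rule m_ge)
  next
    fix i :: nat and g g' :: "nat \<Rightarrow> 'a" assume i: "i < n" and eq: "\<And>k. k < m \<Longrightarrow> g k = g' k"
    show "\<Psi> i (F i g) = \<Psi> i (F i g')" by (rule arg_cong[where f = "\<Psi> i"], rule F_cong[OF i], rule eq)
  next
    fix i :: nat and g :: "nat \<Rightarrow> 'a" assume i: "i < n" and g: "\<And>k. k < m \<Longrightarrow> g k \<in> A' i"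
    show "\<Psi> i (F i g) \<in> A' i"
      by (rule \<Psi>_A'[OF i], rule F_in[OF i]) (use g A'_subset[OF i] in blast)
  next
    fix i x assume i: "i < n" and x: "x \<in> A' i"
    have "x \<in> A i" using A'_subset[OF i] x by blast
    then show "\<Psi> i (F i (\<lambda>_. x)) = x" using F_idem[OF i] \<Psi>_id[OF i x] by simp
  next
    fix i x y k assume *: "i < n" "x \<in> A' i" "y \<in> A' i" "k < m"
    then have "x \<in> A i" "y \<in> A i" using A'_subset[OF *(1)] by auto
    from F_wnu[OF *(1) this *(4)]
    show "\<Psi> i (F i ((\<lambda>_. x)(k := y))) = \<Psi> i (F i ((\<lambda>_. x)(0 := y)))" by (rule arg_cong)
  next
    fix t assume "\<And>k. k < m \<Longrightarrow> t k \<in> R'"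
    then have "\<And>k. k < m \<Longrightarrow> t k \<in> R" by (simp add: R'_def)
    then show "(\<lambda>i. \<Psi> i (F i (\<lambda>k. t k i))) \<in> R'" by (rule \<Psi>_R'[OF F_R])
  qed
qed

end

context tuple_relation
begin

text \<open>Take the total image size least among the functions fixing \<open>a\<close>. The
  \<open>N\<close>-th iterate is idempotent with no larger image, and a function fixing
  \<open>a\<close> that identified two of its elements would make the total smaller.\<close>

lemma core_retract_exists:
  assumes a: "key a" and ess: "\<exists>x\<in>T. x \<notin> R \<and> (\<forall>i<n. \<exists>c. x(i := c) \<in> R)"
  shows "\<exists>\<Psi>. core_retract n A R a \<Psi>"
proof -
  define Q where "Q = (\<lambda>\<Psi>. vf \<Psi> \<and> (\<forall>i<n. \<Psi> i (a i) = a i))"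
  define s where "s = (\<lambda>\<Psi> :: nat \<Rightarrow> 'a \<Rightarrow> 'a. \<Sum>i<n. card (\<Psi> i ` A i))"
  have "Q (\<lambda>i x. x)" by (simp add: Q_def vf_def)
  then obtain \<Psi>0 where \<Psi>0: "Q \<Psi>0" and min: "\<And>\<Phi>. Q \<Phi> \<Longrightarrow> s \<Psi>0 \<le> s \<Phi>"
    using ex_has_least_nat[of Q "\<lambda>i x. x" s] by blast
  have vf0: "vf \<Psi>0" and fix0: "\<And>i. i < n \<Longrightarrow> \<Psi>0 i (a i) = a i" using \<Psi>0 by (auto simp: Q_def)
  define \<Psi> where "\<Psi> = (\<lambda>i. \<Psi>0 i ^^ N)"
  have vf: "vf \<Psi>" unfolding \<Psi>_def by (rule vf_pow[OF vf0])
  have fixed: "\<Psi> i (a i) = a i" if "i < n" for i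
  proof -
    have "(\<Psi>0 i ^^ k) (a i) = a i" for k by (induction k) (use fix0[OF that] in auto)
    then show ?thesis by (simp add: \<Psi>_def)
  qed
  have fin: "finite (\<Phi> ` A i)" if "i < n" for \<Phi> :: "'a \<Rightarrow> 'a" and i using finite_A[OF that] by simp
  have sub: "\<Psi> i ` A i \<subseteq> \<Psi>0 i ` A i" if "i < n" for i
  proof -
    obtain N' where "N = Suc N'" using N_pos gr0_conv_Suc by auto
    then show ?thesis using vf_in[OF vf_pow[OF vf0, of N'] that] by (auto simp: \<Psi>_def)
  qed
  have "s \<Psi> \<le> s \<Psi>0" unfolding s_def by (rule sum_mono) (use sub fin in \<open>auto intro!: card_mono\<close>)
  then have min': "s \<Psi> \<le> s \<Phi>" if "Q \<Phi>" for \<Phi> using min[OF that] by simp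
  have "core_retract n A R a \<Psi>"
  proof unfold_locales
    fix i x assume "i < n" "x \<in> A i"
    then show "\<Psi> i (\<Psi> i x) = \<Psi> i x"
      unfolding \<Psi>_def using vf_in[OF vf0] by (intro funpow_N_idem) auto
  next
    fix \<Phi> i assume \<Phi>: "vf \<Phi>" "\<And>i. i < n \<Longrightarrow> \<Phi> i (a i) = a i" and i: "i < n"
    have "Q (\<lambda>i x. \<Phi> i (\<Psi> i x))" unfolding Q_def using vf_comp[OF \<Phi>(1) vf] \<Phi>(2) fixed by simp
    from min'[OF this] have le: "(\<Sum>i<n. card (\<Psi> i ` A i)) \<le> (\<Sum>i<n. card (\<Phi> i ` (\<Psi> i ` A i)))"
      by (simp add: s_def image_image)
    have card_le: "card (\<Phi> j ` (\<Psi> j ` A j)) \<le> card (\<Psi> j ` A j)" if "j < n" for j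
      using card_image_le[OF fin[OF that]] .
    have "card (\<Phi> i ` (\<Psi> i ` A i)) = card (\<Psi> i ` A i)"
    proof (rule ccontr)
      assume "\<not> ?thesis"
      then have "card (\<Phi> i ` (\<Psi> i ` A i)) < card (\<Psi> i ` A i)" using card_le[OF i] by simp
      then have "(\<Sum>i<n. card (\<Phi> i ` (\<Psi> i ` A i))) < (\<Sum>i<n. card (\<Psi> i ` A i))"
        using card_le i by (intro sum_strict_mono_ex1) auto
      then show False using le by simp
    qed
    then show "inj_on (\<Phi> i) (\<Psi> i ` A i)" by (rule eq_card_imp_inj_on[OF fin[OF i]])
  qed (use a vf fixed ess in auto)
  then show ?thesis by blast
qed

end

section \<open>Essential tuples and the translation from lists\<close>

lemma essential_tuple_exists:
  assumes "essential A n \<rho>" "\<rho> \<subseteq> tuples A n"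
  obtains x where "x \<in> tuples A n" "x \<notin> \<rho>" "\<And>i. i < n \<Longrightarrow> \<exists>c. x[i := c] \<in> \<rho>"
proof (rule ccontr)
  assume contra: "\<not> thesis"
  \<comment> \<open>If no such tuple exists, the projections of \<rho> that omit one coordinate
    already define \<rho>, and each has arity \<open>n - 1\<close>.\<close>
  define I where "I = (\<lambda>i. [0..<i] @ [Suc i..<n])"
  define \<sigma> where "\<sigma> = (\<lambda>i. (\<lambda>t. map ((!) t) (I i)) ` \<rho>)"
  define S where "S = (\<lambda>i. (I i, \<sigma> i)) ` {..<n}"
  have setI: "set (I i) = {..<n} - {i}" if "i < n" for i using that by (auto simp: I_def)
  have lenI: "length (I i) < n" if "i < n" for i using that by (simp add: I_def)
  have "\<forall>(I, \<sigma>)\<in>S. length I < n \<and> set I \<subseteq> {..<n} \<and> \<sigma> \<subseteq> tuples A (length I)"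
  proof -
    have "map ((!) t) (I i) \<in> tuples A (length (I i))" if "i < n" "t \<in> \<rho>" for i t
    proof -
      have "length t = n" "set t \<subseteq> A" using that assms(2) by (auto simp: tuples_def)
      then show ?thesis using setI[OF that(1)] by (auto simp: tuples_def) (metis DiffE lessThan_iff nth_mem subset_iff)
    qed
    then show ?thesis using setI lenI by (auto simp: S_def \<sigma>_def)
  qed
  moreover have "\<rho> = conj_rel A n S"
  proof
    show "\<rho> \<subseteq> conj_rel A n S" using assms(2) by (auto simp: conj_rel_def S_def \<sigma>_def)
    show "conj_rel A n S \<subseteq> \<rho>"
    proof (rule subsetI, rule ccontr)
      fix x assume x: "x \<in> conj_rel A n S" "x \<notin> \<rho>"
      have xt: "x \<in> tuples A n" using x by (simp add: conj_rel_def)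
      have "\<exists>c. x[i := c] \<in> \<rho>" if i: "i < n" for i
      proof -
        have "map ((!) x) (I i) \<in> \<sigma> i" using x(1) i by (auto simp: conj_rel_def S_def)
        then obtain t where t: "t \<in> \<rho>" "map ((!) x) (I i) = map ((!) t) (I i)" by (auto simp: \<sigma>_def)
        have eq: "x ! j = t ! j" if "j < n" "j \<noteq> i" for j
          using t(2) setI[OF i] that by (auto simp: map_eq_conv)
        have len: "length t = n" "length x = n" using t(1) xt assms(2) by (auto simp: tuples_def)
        have "x[i := t ! i] = t"
        proof (rule nth_equalityI)
          show "x[i := t ! i] ! j = t ! j" if "j < length (x[i := t ! i])" for j
            using eq[of j] that len i by (cases "j = i") auto
        qed (simp add: len)
        then show ?thesis using t(1) by metis
      qed
      then have thesis by (rule that[OF xt x(2)])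
      then show False using contra by contradiction
    qed
  qed
  ultimately show False using assms(1) unfolding essential_def by blast
qed

lemma map_fun_upd_upt: "i < n \<Longrightarrow> map (x(i := c)) [0..<n] = (map x [0..<n])[i := c]"
  by (rule nth_equalityI) (auto simp: nth_list_update)

theorem mainTheorem4:
  fixes A :: "'a set" and n r :: nat and \<rho> :: "'a list set"
  assumes "finite A" and "n \<ge> 3" and "1 \<le> r" and "r \<le> n"
    and "key_relation A n \<rho>" and "essential A n \<rho>"
    and "\<exists>m f. is_wnu A m f \<and> op_preserves m n f \<rho>"
    and "\<forall>i<n. \<forall>j<n. pattern A n \<rho> i j \<longleftrightarrow> (i = j \<or> (i < r \<and> j < r))"
    and "key_tuple A n \<rho> a"
  shows "\<exists>(B :: nat \<Rightarrow> 'a set) (p :: nat) (\<phi> :: nat \<Rightarrow> 'a \<Rightarrow> int) (b :: nat \<Rightarrow> 'a).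
     (\<forall>i<n. B i \<subseteq> A) \<and> prime p
     \<and> (\<forall>i<r. bij_betw (\<phi> i) (B i) {0..<int p})
     \<and> (\<forall>i\<in>{r..<n}. b i \<in> A \<and> b i \<noteq> a ! i \<and> B i = {a ! i, b i})
     \<and> (let Bx = {x \<in> tuples A n. \<forall>i<n. x ! i \<in> B i} in
          a \<in> Bx
        \<and> \<rho> \<inter> Bx = {x \<in> Bx. (\<Sum>i<r. \<phi> i (x ! i)) mod int p = 0 \<or> (\<exists>i\<in>{r..<n}. x ! i = b i)}
        \<and> (\<forall>\<gamma>\<in>Bx - \<rho>. key_tuple A n \<rho> \<gamma>))"
proof -
  define R where "R = {x. map x [0..<n] \<in> \<rho>}"
  have sub: "\<rho> \<subseteq> tuples A n" using assms(5) by (simp add: key_relation_def)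
  have nth_map: "map ((!) t) [0..<n] = t" if "t \<in> tuples A n" for t
    using that by (metis (mono_tags, lifting) map_nth mem_Collect_eq tuples_def)
  have R_nth: "(!) t \<in> R \<longleftrightarrow> t \<in> \<rho>" if "t \<in> tuples A n" for t
    using nth_map[OF that] by (simp add: R_def)
  interpret tuple_relation n "\<lambda>_. A" R
  proof unfold_locales
    show "x i \<in> A" if "x \<in> R" "i < n" for x i
    proof -
      have "map x [0..<n] \<in> tuples A n" using that sub by (auto simp: R_def)
      then show ?thesis using that by (auto simp: tuples_def)
    qed
    show "y \<in> R" if "x \<in> R" "\<And>i. i < n \<Longrightarrow> x i = y i" for x y
    proof -
      have eq: "map y [0..<n] = map x [0..<n]" using that(2) by simp
      show ?thesis using that(1) unfolding R_def mem_Collect_eq eq .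
    qed
  qed (use assms in auto)
  have T_iff: "x \<in> T \<longleftrightarrow> map x [0..<n] \<in> tuples A n" for x
    by (auto simp: T_def tuples_def)
  have nth_T: "(!) t \<in> T" if "t \<in> tuples A n" for t
    using nth_map[OF that] that by (simp add: T_iff)
  have apply_map: "apply_vf n \<Psi> (map x [0..<n]) = map (\<lambda>i. \<Psi> i (x i)) [0..<n]" for \<Psi> :: "nat \<Rightarrow> 'a \<Rightarrow> 'a" and x
    by (simp add: apply_vf_def)
  have vf_iff: "vf \<Psi> \<longleftrightarrow> unary_vf A n \<Psi> \<and> vf_preserves n \<Psi> \<rho>" for \<Psi>
  proof -
    have "(\<forall>x\<in>R. (\<lambda>i. \<Psi> i (x i)) \<in> R) \<longleftrightarrow> vf_preserves n \<Psi> \<rho>"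
    proof
      assume *: "\<forall>x\<in>R. (\<lambda>i. \<Psi> i (x i)) \<in> R"
      show "vf_preserves n \<Psi> \<rho>" unfolding vf_preserves_def
      proof
        fix t assume t: "t \<in> \<rho>"
        then have "(\<lambda>i. \<Psi> i (t ! i)) \<in> R" using * R_nth sub by blast
        then show "apply_vf n \<Psi> t \<in> \<rho>" by (simp add: R_def apply_vf_def)
      qed
    next
      assume "vf_preserves n \<Psi> \<rho>"
      then show "\<forall>x\<in>R. (\<lambda>i. \<Psi> i (x i)) \<in> R" unfolding vf_preserves_def R_def
        using apply_map by (metis mem_Collect_eq)
    qed
    then show ?thesis by (simp add: vf_def unary_vf_def)
  qed
  have key_iff: "key ((!) t) \<longleftrightarrow> key_tuple A n \<rho> t" if t: "t \<in> tuples A n" for t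
  proof -
    have eq: "apply_vf n \<Psi> s = t \<longleftrightarrow> (\<forall>i<n. \<Psi> i (s ! i) = t ! i)" for \<Psi> s
      using t by (auto simp: apply_vf_def tuples_def list_eq_iff_nth_eq)
    have "(\<forall>x\<in>T. x \<notin> R \<longrightarrow> (\<exists>\<Psi>. vf \<Psi> \<and> (\<forall>i<n. \<Psi> i (x i) = t ! i))) \<longleftrightarrow>
      (\<forall>s\<in>tuples A n - \<rho>. \<exists>\<Psi>. unary_vf A n \<Psi> \<and> vf_preserves n \<Psi> \<rho> \<and> apply_vf n \<Psi> s = t)"
      (is "?L \<longleftrightarrow> ?Q")
    proof
      assume L: ?L
      show ?Q
      proof
        fix s assume "s \<in> tuples A n - \<rho>"
        then have "(!) s \<in> T" "(!) s \<notin> R" using nth_T R_nth by auto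
        then obtain \<Psi> where "vf \<Psi>" "\<forall>i<n. \<Psi> i (s ! i) = t ! i" using L by blast
        then show "\<exists>\<Psi>. unary_vf A n \<Psi> \<and> vf_preserves n \<Psi> \<rho> \<and> apply_vf n \<Psi> s = t"
          using vf_iff eq by auto
      qed
    next
      assume Q: ?Q
      show ?L
      proof (intro ballI impI)
        fix x assume "x \<in> T" "x \<notin> R"
        then have "map x [0..<n] \<in> tuples A n - \<rho>" using T_iff by (simp add: R_def)
        then obtain \<Psi> where "vf \<Psi>" "apply_vf n \<Psi> (map x [0..<n]) = t" using Q vf_iff by blast
        then show "\<exists>\<Psi>. vf \<Psi> \<and> (\<forall>i<n. \<Psi> i (x i) = t ! i)" using eq by auto
      qed
    qed
    then show ?thesis using nth_T[OF t] R_nth[OF t] t by (simp add: key_def key_tuple_def)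
  qed
  have a_t: "a \<in> tuples A n" using assms(9) by (simp add: key_tuple_def)
  have key_a: "key ((!) a)" using key_iff[OF a_t] assms(9) by blast
  have ess: "\<exists>x\<in>T. x \<notin> R \<and> (\<forall>i<n. \<exists>c. x(i := c) \<in> R)"
  proof -
    obtain t where t: "t \<in> tuples A n" "t \<notin> \<rho>" "\<And>i. i < n \<Longrightarrow> \<exists>c. t[i := c] \<in> \<rho>"
      using essential_tuple_exists[OF assms(6) sub] by blast
    have "\<exists>c. ((!) t)(i := c) \<in> R" if "i < n" for i
      using t(3)[OF that] map_fun_upd_upt[OF that, of "(!) t"] nth_map[OF t(1)] by (simp add: R_def)
    then show ?thesis using nth_T[OF t(1)] R_nth[OF t(1)] t(2) by blast
  qed
  have square_iff: "(\<exists>x c d. square i j x c d) \<longleftrightarrow> \<not> (i < r \<and> j < r)"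
    if ij: "i < n" "j < n" "i \<noteq> j" for i j
  proof -
    have "(\<exists>x c d. square i j x c d) \<longleftrightarrow> \<not> pattern A n \<rho> i j"
    proof
      assume "\<exists>x c d. square i j x c d"
      then obtain x c d where sq: "x \<in> T" "x \<notin> R" "x(i := c) \<in> R" "x(j := d) \<in> R" "x(i := c, j := d) \<in> R"
        by (auto simp: square_def)
      have "c \<in> A" "d \<in> A" using R_in[OF sq(3) ij(1)] R_in[OF sq(4) ij(2)] by auto
      moreover have "(map x [0..<n])[i := c] \<in> \<rho>" "(map x [0..<n])[j := d] \<in> \<rho>"
        "(map x [0..<n])[i := c, j := d] \<in> \<rho>"
        using sq(3-5) ij by (simp_all add: R_def map_fun_upd_upt)
      ultimately show "\<not> pattern A n \<rho> i j"
        using sq(1,2) ij(3) T_iff unfolding pattern_def R_def by blast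
    next
      assume "\<not> pattern A n \<rho> i j"
      then obtain t c d where t: "t \<in> tuples A n" "t \<notin> \<rho>" "t[i := c] \<in> \<rho>" "t[j := d] \<in> \<rho>" "t[i := c, j := d] \<in> \<rho>"
        unfolding pattern_def by blast
      have "square i j ((!) t) c d"
        unfolding square_def using t nth_T R_nth ij by (simp add: R_def map_fun_upd_upt nth_map)
      then show "\<exists>x c d. square i j x c d" by blast
    qed
    then show ?thesis using assms(8) ij by blast
  qed
  obtain m0 f where f: "is_wnu A m0 f" "op_preserves m0 n f \<rho>" using assms(7) by blast
  define F0 where "F0 = (\<lambda>(i::nat) (g :: nat \<Rightarrow> 'a). f (map g [0..<m0]))"
  have wnu0: "wnu_relation n (\<lambda>_. A) R m0 F0"
  proof unfold_locales
    show "2 \<le> m0" using f(1) by (simp add: is_wnu_def)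
    show "F0 i g = F0 i g'" if "\<And>k. k < m0 \<Longrightarrow> g k = g' k" for i g g'
    proof -
      have "map g [0..<m0] = map g' [0..<m0]" using that by simp
      then show ?thesis unfolding F0_def by (rule arg_cong)
    qed
    show "F0 i g \<in> A" if "\<And>k. k < m0 \<Longrightarrow> g k \<in> A" for i g
    proof -
      have "map g [0..<m0] \<in> tuples A m0" using that by (auto simp: tuples_def)
      then show ?thesis using f(1) by (simp add: F0_def is_wnu_def)
    qed
    show "F0 i (\<lambda>_. x) = x" if "x \<in> A" for i x
      using f(1) that by (simp add: F0_def is_wnu_def map_replicate_const)
    show "F0 i ((\<lambda>_. x)(k := y)) = F0 i ((\<lambda>_. x)(0 := y))" if "x \<in> A" "y \<in> A" "k < m0" for i x y k
    proof -
      have F0_upd: "F0 i ((\<lambda>_. x)(k := y)) = f ((replicate m0 x)[k := y])" if "k < m0" for k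
        unfolding F0_def map_fun_upd_upt[OF that] by (simp only: map_replicate_const length_upt diff_zero)
      have "0 < m0" using that by simp
      moreover have "f ((replicate m0 x)[k := y]) = f ((replicate m0 x)[0 := y])"
        using f(1) that unfolding is_wnu_def by blast
      ultimately show ?thesis using F0_upd that(3) by simp
    qed
    show "(\<lambda>i. F0 i (\<lambda>k. t k i)) \<in> R" if t: "\<And>k. k < m0 \<Longrightarrow> t k \<in> R" for t
    proof -
      define ts where "ts = map (\<lambda>k. map (t k) [0..<n]) [0..<m0]"
      have "length ts = m0" "set ts \<subseteq> \<rho>" using t by (auto simp: ts_def R_def)
      then have "map (\<lambda>j. f (map (\<lambda>t. t ! j) ts)) [0..<n] \<in> \<rho>" using f(2) by (simp add: op_preserves_def)
      moreover have "map (\<lambda>j. f (map (\<lambda>t. t ! j) ts)) [0..<n] = map (\<lambda>i. F0 i (\<lambda>k. t k i)) [0..<n]"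
        by (auto simp: ts_def F0_def comp_def)
      ultimately show ?thesis by (simp add: R_def)
    qed
  qed
  obtain \<Psi> where \<Psi>: "core_retract n (\<lambda>_. A) R ((!) a) \<Psi>"
    using core_retract_exists[OF key_a ess] by blast
  interpret cr: core_retract n "\<lambda>_. A" R "(!) a" \<Psi> by (rule \<Psi>)
  obtain m F where wnu: "wnu_relation n cr.A' cr.R' m F"
    and special: "\<And>i x y. i < n \<Longrightarrow> x \<in> cr.A' i \<Longrightarrow> y \<in> cr.A' i \<Longrightarrow>
      F i ((\<lambda>_. x)(0 := F i ((\<lambda>_. x)(0 := y)))) = F i ((\<lambda>_. x)(0 := y))"
    by (rule cr.ret.wnu_relation_special[OF cr.ret_wnu[OF wnu0]]) (rule that)
  interpret W: wnu_relation n cr.A' cr.R' m F by (rule wnu)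
  interpret cw: core_wnu n cr.A' cr.R' m F r
    by unfold_locales (use assms(2-4) special cr.ret_square_iff square_iff in auto)
  obtain B p \<phi> b where box: "cw.linear_box ((!) a) B p \<phi> b"
    using cw.linear_box_exists[OF cr.ret_key_a] by blast
  have box_mem: "\<forall>x. (\<forall>i<n. x i \<in> B i) \<longrightarrow>
      (x \<in> cr.R' \<longleftrightarrow> (\<Sum>i<r. \<phi> i (x i)) mod int p = 0 \<or> (\<exists>i\<in>{r..<n}. x i = b i))
      \<and> (x \<notin> cr.R' \<longrightarrow> cr.ret.key x)"
    using box unfolding cw.linear_box_def by (elim conjE)
  have B_A': "B i \<subseteq> cr.A' i" if "i < n" for i using box that by (simp add: cw.linear_box_def)
  have B_A: "B i \<subseteq> A" if "i < n" for i using B_A'[OF that] cr.A'_subset[OF that] by blast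
  define Bx where "Bx = {x \<in> tuples A n. \<forall>i<n. x ! i \<in> B i}"
  have mem: "(x \<in> \<rho> \<longleftrightarrow> (\<Sum>i<r. \<phi> i (x ! i)) mod int p = 0 \<or> (\<exists>i\<in>{r..<n}. x ! i = b i))
      \<and> (x \<notin> \<rho> \<longrightarrow> key_tuple A n \<rho> x)" if x: "x \<in> Bx" for x
  proof -
    have xt: "x \<in> tuples A n" and xB: "\<And>i. i < n \<Longrightarrow> x ! i \<in> B i" using x by (auto simp: Bx_def)
    \<comment> \<open>The box lies inside the retract, where the restricted and the full relation
      agree; key tuples of the retract are key tuples of \<rho>.\<close>
    have "(!) x \<in> cr.ret.T" using xB B_A' by (auto simp: cr.ret.T_def)
    then have R': "(!) x \<in> cr.R' \<longleftrightarrow> x \<in> \<rho>" using cr.R'_iff R_nth[OF xt] by simp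
    have "((!) x \<in> cr.R' \<longleftrightarrow> (\<Sum>i<r. \<phi> i (x ! i)) mod int p = 0 \<or> (\<exists>i\<in>{r..<n}. x ! i = b i))
        \<and> ((!) x \<notin> cr.R' \<longrightarrow> cr.ret.key ((!) x))"
      by (rule box_mem[rule_format]) (rule xB)
    then show ?thesis unfolding R' using cr.ret_key[of "(!) x"] key_iff[OF xt] by simp
  qed
  have b': "\<forall>i\<in>{r..<n}. b i \<in> cr.A' i \<and> b i \<noteq> a ! i \<and> B i = {a ! i, b i}"
    using box unfolding cw.linear_box_def by (elim conjE)
  have b: "\<forall>i\<in>{r..<n}. b i \<in> A \<and> b i \<noteq> a ! i \<and> B i = {a ! i, b i}"
  proof
    fix i assume i: "i \<in> {r..<n}"
    then have "b i \<in> A" using bspec[OF b' i] cr.A'_subset[of i] by auto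
    then show "b i \<in> A \<and> b i \<noteq> a ! i \<and> B i = {a ! i, b i}" using bspec[OF b' i] by blast
  qed
  have p: "prime p" using box unfolding cw.linear_box_def by (elim conjE)
  have bij: "\<forall>i<r. bij_betw (\<phi> i) (B i) {0..<int p}" using box unfolding cw.linear_box_def by (elim conjE)
  have aB: "\<forall>i<n. a ! i \<in> B i" using box unfolding cw.linear_box_def by (elim conjE)
  have aBx: "a \<in> Bx" using a_t aB by (simp add: Bx_def)
  have mem1: "x \<in> \<rho> \<longleftrightarrow> (\<Sum>i<r. \<phi> i (x ! i)) mod int p = 0 \<or> (\<exists>i\<in>{r..<n}. x ! i = b i)"
    if "x \<in> Bx" for x
    using mem[OF that] by (rule conjunct1)
  have rho: "\<rho> \<inter> Bx = {x \<in> Bx. (\<Sum>i<r. \<phi> i (x ! i)) mod int p = 0 \<or> (\<exists>i\<in>{r..<n}. x ! i = b i)}"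
    by (rule set_eqI, unfold Int_iff mem_Collect_eq) (metis mem1)
  have keys: "\<forall>\<gamma>\<in>Bx - \<rho>. key_tuple A n \<rho> \<gamma>"
  proof
    fix \<gamma> assume "\<gamma> \<in> Bx - \<rho>"
    then show "key_tuple A n \<rho> \<gamma>" using mem[of \<gamma>] by simp
  qed
  show ?thesis
    by (rule exI[of _ B], rule exI[of _ p], rule exI[of _ \<phi>], rule exI[of _ b], unfold Let_def, fold Bx_def)
      (intro conjI allI impI B_A p bij[rule_format] b aBx rho keys)
qed

end
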